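(* Let $\alpha>-1$ and $0<p<\infty$. Suppose that $\varphi$ and $\psi$ are nonconstant linear fractional self-maps of $\mathbb D$. Then $$C_\varphi C_\psi^*\in S_p(\mathcal D_\alpha)$$ if and only if $$\varphi(\mathbb T)\cap\psi(\mathbb T)\cap\mathbb T=\varnothing .$$ Moreover, whenever this condition holds, $C_\varphi C_\psi^*\in S_q(\mathcal D_\alpha)$ for every $q\in(0,\infty)$.
   Context: $\mathbb D$ is the open unit disk in $\mathbb C$, $\mathbb T$ is the unit circle, and $dA$ is the normalized area measure on $\mathbb D$. For $\alpha>-1$, $dA_\alpha(z)=(1+\alpha)(1-|z|^2)^\alpha\,dA(z)$. The weighted Dirichlet space $\mathcal D_\alpha$ is the Hilbert space of analytic functions $f$ on $\mathbb D$ with $\|f\|_{\mathcal D_\alpha}^2=|f(0)|^2+\int_{\mathbb D}|f'(z)|^2\,dA_\alpha(z)<\infty$, with the associated inner product. A nonconstant linear fractional self-map of $\mathbb D$ is a map $\varphi(z)=\frac{az+b}{cz+d}$ with $ad-bc\neq0$ and $\varphi(\mathbb D)\subset\mathbb D$; it extends analytically to a neighborhood of $\overline{\mathbb D}$, and $\varphi(\mathbb T)$ is the image of $\mathbb T$ under this extension. The composition operator is $C_\varphi f=f\circ\varphi$; for such $\varphi$ it is bounded on $\mathcal D_\alpha$. $C_\psi^*$ is the Hilbert space adjoint of $C_\psi$ on $\mathcal D_\alpha$. For a separable Hilbert space $\mathcal H$ and $0<p<\infty$, the Schatten class $S_p(\mathcal H)$ consists of the compact operators $T$ on $\mathcal H$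 whose singular values $s_1(T)\ge s_2(T)\ge\cdots\ge0$ satisfy $\sum_n s_n(T)^p<\infty$. *)

theory Defs
  imports "HOL-Complex_Analysis.Complex_Analysis" "HOL-Library.Function_Algebras"
begin

abbreviation disk :: "complex set" where
  "disk \<equiv> ball 0 1"

abbreviation circle :: "complex set" where
  "circle \<equiv> sphere 0 1"

definition disk_area :: "complex measure" where
  "disk_area = uniform_measure (restrict_space lborel disk) disk"

definition weighted_area :: "real \<Rightarrow> complex measure" where
  "weighted_area \<alpha> =
     density disk_area (\<lambda>z. ennreal ((1 + \<alpha>) * (1 - (cmod z)\<^sup>2) powr \<alpha>))"

text \<open>
  A function on the disk is represented by its extension by 0 to the whole plane, so that
  equality of elements is equality of HOL functions and the vector space operations are the
  pointwise ones. Only derivatives at points of the disk enter, since the measures above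
  have the disk as their underlying space.
\<close>

definition dirichlet_space :: "real \<Rightarrow> (complex \<Rightarrow> complex) set" where
  "dirichlet_space \<alpha> =
     {f. f holomorphic_on disk \<and> (\<forall>z. z \<notin> disk \<longrightarrow> f z = 0) \<and>
         integrable (weighted_area \<alpha>) (\<lambda>z. (cmod (deriv f z))\<^sup>2)}"

definition dirichlet_inner ::
  "real \<Rightarrow> (complex \<Rightarrow> complex) \<Rightarrow> (complex \<Rightarrow> complex) \<Rightarrow> complex" where
  "dirichlet_inner \<alpha> f g =
     f 0 * cnj (g 0) + (\<integral>z. deriv f z * cnj (deriv g z) \<partial>weighted_area \<alpha>)"

definition dirichlet_norm :: "real \<Rightarrow> (complex \<Rightarrow> complex) \<Rightarrow> real" where
  "dirichlet_norm \<alpha> f =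
     sqrt ((cmod (f 0))\<^sup>2 + (\<integral>z. (cmod (deriv f z))\<^sup>2 \<partial>weighted_area \<alpha>))"

text \<open>
  Operators on the Dirichlet space are HOL functions of which only the values on
  \<^const>\<open>dirichlet_space\<close> are relevant.
\<close>

type_synonym operator = "(complex \<Rightarrow> complex) \<Rightarrow> (complex \<Rightarrow> complex)"

definition bounded_operator :: "real \<Rightarrow> operator \<Rightarrow> bool" where
  "bounded_operator \<alpha> T \<longleftrightarrow>
     (\<forall>f\<in>dirichlet_space \<alpha>. T f \<in> dirichlet_space \<alpha>) \<and>
     (\<forall>f\<in>dirichlet_space \<alpha>. \<forall>g\<in>dirichlet_space \<alpha>. T (f + g) = T f + T g) \<and>
     (\<forall>c. \<forall>f\<in>dirichlet_space \<alpha>. T (\<lambda>z. c * f z) = (\<lambda>z. c * T f z)) \<and>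
     (\<exists>B. \<forall>f\<in>dirichlet_space \<alpha>. dirichlet_norm \<alpha> (T f) \<le> B * dirichlet_norm \<alpha> f)"

definition compact_operator :: "real \<Rightarrow> operator \<Rightarrow> bool" where
  "compact_operator \<alpha> T \<longleftrightarrow>
     bounded_operator \<alpha> T \<and>
     (\<forall>f :: nat \<Rightarrow> complex \<Rightarrow> complex.
        range f \<subseteq> dirichlet_space \<alpha> \<longrightarrow> (\<exists>B. \<forall>n. dirichlet_norm \<alpha> (f n) \<le> B) \<longrightarrow>
        (\<exists>r :: nat \<Rightarrow> nat. \<exists>g\<in>dirichlet_space \<alpha>. strict_mono r \<and>
           (\<lambda>n. dirichlet_norm \<alpha> (T (f (r n)) - g)) \<longlonglongrightarrow> 0))"

definition hilbert_adjoint :: "real \<Rightarrow> operator \<Rightarrow> operator" where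
  "hilbert_adjoint \<alpha> T g =
     (THE h. h \<in> dirichlet_space \<alpha> \<and>
             (\<forall>f\<in>dirichlet_space \<alpha>. dirichlet_inner \<alpha> (T f) g = dirichlet_inner \<alpha> f h))"

definition eigenspace :: "real \<Rightarrow> operator \<Rightarrow> complex \<Rightarrow> (complex \<Rightarrow> complex) set" where
  "eigenspace \<alpha> T c = {f \<in> dirichlet_space \<alpha>. T f = (\<lambda>z. c * f z)}"

abbreviation complex_dim :: "(complex \<Rightarrow> complex) set \<Rightarrow> nat" where
  "complex_dim \<equiv> vector_space.dim (\<lambda>(c::complex) f z. c * f z)"

text \<open>
  The singular values of a compact operator \<open>T\<close> are the square roots of the eigenvalues of
  \<open>T* T\<close>, listed in nonincreasing order with multiplicity and, if only finitely many
  are positive, followed by zeros. The finiteness requirement is needed because \<^const>\<open>card\<close>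
  is 0 on infinite sets; for compact \<open>T\<close> the eigenspaces in question are finite-dimensional
  and the conditions determine \<open>s\<close> uniquely.
\<close>

definition singular_values :: "real \<Rightarrow> operator \<Rightarrow> (nat \<Rightarrow> real) \<Rightarrow> bool" where
  "singular_values \<alpha> T s \<longleftrightarrow>
     decseq s \<and> (\<forall>n. 0 \<le> s n) \<and>
     (\<forall>\<sigma>>0. finite {n. s n = \<sigma>} \<and>
        card {n. s n = \<sigma>} =
          complex_dim (eigenspace \<alpha> (hilbert_adjoint \<alpha> T \<circ> T) (complex_of_real (\<sigma>\<^sup>2))))"

definition schatten_class :: "real \<Rightarrow> real \<Rightarrow> operator set" where
  "schatten_class p \<alpha> =
     {T. compact_operator \<alpha> T \<and>
         (\<exists>s. singular_values \<alpha> T s \<and> summable (\<lambda>n. s n powr p))}"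

text \<open>
  As \<open>\<phi>\<close> is bounded on the disk, the denominator has no zero on the closed disk either.
  Hence the same formula gives the analytic extension, and the image of the unit circle
  under the extension is just \<open>\<phi> ` circle\<close>.
\<close>

definition linear_fractional_self_map :: "(complex \<Rightarrow> complex) \<Rightarrow> bool" where
  "linear_fractional_self_map \<phi> \<longleftrightarrow>
     (\<exists>a b c d. a * d - b * c \<noteq> 0 \<and> \<phi> = (\<lambda>z. (a * z + b) / (c * z + d)) \<and>
        (\<forall>z\<in>disk. c * z + d \<noteq> 0)) \<and>
     \<phi> ` disk \<subseteq> disk"

definition composition_operator :: "(complex \<Rightarrow> complex) \<Rightarrow> operator" where
  "composition_operator \<phi> f = (\<lambda>z. if z \<in> disk then f (\<phi> z) else 0)"

end

theory Submission
  imports Defs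
begin

text \<open>
  The derivative maps the weighted Dirichlet space, modulo constants, isometrically onto the
  weighted Bergman space with the same weight, whose reproducing kernel is
  \<open>(1 - cnj u * v) powr - (\<alpha> + 2)\<close>. So point evaluation of the derivative at \<open>u\<close> is
  represented by a function \<open>dkernel u\<close> whose derivative is this kernel. The adjoint of
  \<open>C\<^sub>\<psi>\<close> sends \<open>dkernel z\<close> to \<open>cnj (\<psi>' z)\<close> times \<open>dkernel (\<psi> z)\<close>, hence the product
  \<open>T = C\<^sub>\<phi> C\<^sub>\<psi>\<^sup>*\<close> satisfies
  \<open>\<langle>T (dkernel z), dkernel w\<rangle> = cnj (\<psi>' z) * (1 - cnj (\<psi> z) * \<phi> w) powr - (\<alpha> + 2) * \<phi>' w\<close>
  (\<open>deriv_product_dkernel\<close>). Everything is read off from this formula.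

  Necessity. Suppose that \<open>\<phi> \<zeta> = \<psi> \<eta>\<close> lies on the unit circle for some \<open>\<zeta>\<close>, \<open>\<eta>\<close> on
  the circle. Along \<open>w = r \<zeta>\<close>, \<open>z = r \<eta>\<close> with \<open>r\<close> tending to 1, the number
  \<open>1 - cnj (\<psi> z) * \<phi> w\<close> is of order \<open>1 - r\<close>, which is exactly what the norms of the two
  kernels can absorb: the normalised matrix entry stays bounded away from 0. As normalised
  kernels tend weakly to 0, \<open>T\<close> is not even compact (\<open>product_not_compact\<close>).

  Sufficiency. If the three circles have no common point, then \<open>cnj u * \<psi> z\<close> avoids 1 for all
  \<open>u\<close> in the closure of \<open>\<phi> ` disk\<close> and all \<open>z\<close> in the closed disk, so that, uniformly in \<open>u\<close>,
  the kernel pulled back by \<open>\<psi>\<close> is analytic and bounded on a disk of radius \<open>R > 1\<close>. Its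
  \<open>n\<close>-th Taylor coefficient decays like \<open>1 / R ^ n\<close>, and these coefficients are, up to
  conjugation and bounded factors, the derivatives at \<open>u\<close> of the images of the normalised
  monomials under \<open>C\<^sub>\<psi>\<^sup>*\<close>. Consequently the norms of \<open>T\<close> on the orthonormal basis decay
  geometrically (\<open>product_basis_decay\<close>). Such an operator turns coordinatewise convergence of
  bounded sequences into norm convergence, so it is compact. That its singular values decay
  geometrically, which puts it into every Schatten class, is shown by counting
  (\<open>schatten_class_if_geometric\<close>): eigenvectors of \<open>T\<^sup>* T\<close> for
  eigenvalues at least \<open>\<sigma>\<^sup>2\<close> span a space on which \<open>T\<close> expands by \<open>\<sigma>\<close>, while \<open>T\<close> is
  small on the functions orthogonal to the first \<open>N\<close> basis vectors, so at most \<open>N\<close> of them can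
  be independent.

  The adjoint is defined by a unique existence statement, so all this needs that the
  space is complete and that composition operators are bounded on it. Parseval's formula for
  power series (\<open>bergman_parseval\<close>) identifies the space with square-summable sequences, which
  gives completeness in the form of \<open>D_synthesis\<close>. Boundedness
  (\<open>composition_operator_bounded\<close>) holds for every \<open>\<alpha> > -1\<close>, but for negative \<open>\<alpha>\<close> the
  weight blows up at the circle and the obvious change of variables fails. It is applied
  instead to second derivatives, with the exponent \<open>\<alpha> + 2\<close>, after the norm has been
  compared with the one given by second derivatives.
\<close>

section \<open>Change of variables under injective holomorphic maps\<close>

text \<open>
  Identifies the complex plane with the real coordinate plane as a measure space, so that
  Jacobian determinants can be used for holomorphic maps.
\<close>

lemma lborel_distr_Complex:
  "distr lborel borel (\<lambda>x::real^2. Complex (x$1) (x$2)) = lborel"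
proof (rule lborel_eqI[symmetric])
  fix l u :: complex
  assume le: "\<And>b. b \<in> Basis \<Longrightarrow> l \<bullet> b \<le> u \<bullet> b"
  have lr: "Re l \<le> Re u" "Im l \<le> Im u"
    using le[of 1] le[of \<i>] by (auto simp: Basis_complex_def)
  have [measurable]: "(\<lambda>x::real^2. Complex (x$1) (x$2)) \<in> borel_measurable borel"
    by (intro borel_measurable_continuous_onI continuous_intros)
  have "(\<lambda>x::real^2. Complex (x$1) (x$2)) -` box l u = box (vector [Re l, Im l]) (vector [Re u, Im u])"
    by (auto simp: box_def Basis_complex_def Basis_vec_def inner_axis forall_2)
  moreover have le2: "\<forall>i::2. (vector [Re l, Im l] :: real^2) $ i \<le> vector [Re u, Im u] $ i"
    using lr by (simp add: forall_2)
  ultimately have "emeasure (distr lborel borel (\<lambda>x::real^2. Complex (x$1) (x$2))) (box l u)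
      = emeasure lborel (box (vector [Re l, Im l]) (vector [Re u, Im u]) :: (real^2) set)"
    by (simp add: emeasure_distr)
  also have "\<dots> = ennreal (\<Prod>b\<in>(Basis :: (real^2) set). (vector [Re u, Im u] - vector [Re l, Im l]) \<bullet> b)"
    using le2 by (intro emeasure_lborel_box) (auto simp: Basis_vec_def inner_axis)
  also have "(\<Prod>b\<in>(Basis :: (real^2) set). (vector [Re u, Im u] - vector [Re l, Im l]) \<bullet> b)
      = (Re u - Re l) * (Im u - Im l)"
  proof -
    have b: "(Basis :: (real^2) set) = {axis 1 1, axis 2 1}"
      by (auto simp: Basis_vec_def UNIV_2)
    moreover have "axis 1 1 \<noteq> (axis 2 1 :: real^2)" by (simp add: axis_eq_axis)
    ultimately show ?thesis unfolding b by (simp add: inner_axis)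
  qed
  also have "\<dots> = (\<Prod>b\<in>Basis. (u - l) \<bullet> b)"
    by (simp add: Basis_complex_def)
  finally show "emeasure (distr lborel borel (\<lambda>x::real^2. Complex (x$1) (x$2))) (box l u) = (\<Prod>b\<in>Basis. (u - l) \<bullet> b)"
    by simp
qed simp

text \<open>
  In real coordinates the derivative is multiplication by a complex number, and the
  determinant of that is its squared modulus. The case of infinite measure is covered because
  finiteness of either side of the real formula implies finiteness of the other.
\<close>

lemma emeasure_image_holomorphic:
  fixes f :: "complex \<Rightarrow> complex"
  assumes S: "open S" "f holomorphic_on S" "inj_on f S" and A: "A \<in> sets borel" "A \<subseteq> S"
    and fA: "f ` A \<in> sets borel"
  shows "emeasure lborel (f ` A) = (\<integral>\<^sup>+z. ennreal ((cmod (deriv f z))\<^sup>2) * indicator A z \<partial>lborel)"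
proof -
  define J :: "real^2 \<Rightarrow> complex" where "J = (\<lambda>x. Complex (x$1) (x$2))"
  define K :: "complex \<Rightarrow> real^2" where "K = (\<lambda>z. vector [Re z, Im z])"
  have JK [simp]: "J (K z) = z" for z by (simp add: J_def K_def)
  have KJ [simp]: "K (J x) = x" for x by (simp add: J_def K_def vec_eq_iff forall_2)
  have linJ: "bounded_linear J" unfolding J_def
    by (intro linear_conv_bounded_linear[THEN iffD1] linearI) (auto simp: complex_eq_iff)
  have linK: "bounded_linear K" unfolding K_def
    by (intro linear_conv_bounded_linear[THEN iffD1] linearI) (auto simp: vec_eq_iff forall_2)
  have mJ [measurable]: "J \<in> borel_measurable borel" and mK [measurable]: "K \<in> borel_measurable borel"
    using linear_continuous_on[OF linJ] linear_continuous_on[OF linK]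
    by (auto intro: borel_measurable_continuous_onI)
  have J: "distr lborel borel J = lborel"
    unfolding J_def by (rule lborel_distr_Complex)
  have KJ': "J -` X = K ` X" for X by (force simp: image_iff)
  have em: "emeasure lborel X = emeasure lborel (K ` X)" if "X \<in> sets borel" for X
    using that by (subst J[symmetric]) (simp add: emeasure_distr KJ')
  have setsK: "K ` X \<in> sets borel" if "X \<in> sets borel" for X
    using measurable_sets_borel[OF mJ that] by (simp add: KJ')
  define F where "F = (\<lambda>x. K (f (J x)))"
  define F' where "F' = (\<lambda>x h. K (deriv f (J x) * J h))"
  have der: "(F has_derivative F' x) (at x within K ` A)" if x: "x \<in> K ` A" for x
  proof -
    have "J x \<in> S" using x A by auto
    then have "(f has_field_derivative deriv f (J x)) (at (J x) within J ` (K ` A))"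
      using S holomorphic_derivI has_field_derivative_at_within by blast
    then have "(f has_derivative (\<lambda>h. deriv f (J x) * h)) (at (J x) within J ` (K ` A))"
      by (simp add: has_field_derivative_def)
    from bounded_linear.has_derivative[OF linK diff_chain_within[OF bounded_linear_imp_has_derivative[OF linJ] this]]
    show ?thesis by (simp add: F_def F'_def o_def)
  qed
  have injF: "inj_on F (K ` A)"
    using S(3) A(2) by (auto simp: inj_on_def F_def) (metis JK KJ subsetD)
  have FK: "F ` (K ` A) = K ` (f ` A)" by (auto simp: F_def image_image)
  have det: "\<bar>det (matrix (F' x))\<bar> = (cmod (deriv f (J x)))\<^sup>2" for x
    by (simp add: det_2 matrix_def F'_def K_def J_def axis_def cmod_power2[unfolded power2_eq_square] power2_eq_square algebra_simps)
  have KA: "K ` A \<in> sets lebesgue" using setsK[OF A(1)] by auto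
  have KfA: "K ` f ` A \<in> sets borel" using setsK[OF fA] .
  note hm = has_measure_differentiable_image[OF KA der injF, unfolded FK det]
  have meas: "(\<lambda>z. deriv f z * indicator A z) \<in> borel_measurable borel"
  proof -
    have "continuous_on S (deriv f)" using S by (intro holomorphic_on_imp_continuous_on holomorphic_deriv)
    then have "(\<lambda>z. indicator S z *\<^sub>R deriv f z) \<in> borel_measurable borel"
      using S(1) by (intro borel_measurable_continuous_on_indicator) auto
    then have "(\<lambda>z. (indicator S z *\<^sub>R deriv f z) * indicator A z) \<in> borel_measurable borel"
      using A(1) by measurable
    moreover have "(\<lambda>z. (indicator S z *\<^sub>R deriv f z) * indicator A z) = (\<lambda>z. deriv f z * indicator A z)"
      using A(2) by (auto simp: indicator_def fun_eq_iff)
    ultimately show ?thesis by simp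
  qed
  have eqi: "ennreal ((cmod (deriv f z))\<^sup>2) * indicator A z = ennreal ((cmod (deriv f z * indicator A z))\<^sup>2)" for z
    by (auto simp: indicator_def)
  have rhs: "(\<integral>\<^sup>+z. ennreal ((cmod (deriv f z))\<^sup>2) * indicator A z \<partial>lborel)
     = (\<integral>\<^sup>+x. ennreal ((cmod (deriv f (J x) * indicator A (J x)))\<^sup>2) \<partial>lborel)"
    unfolding eqi using meas by (subst J[symmetric]) (simp add: nn_integral_distr)
  define g where "g = (\<lambda>x. (cmod (deriv f (J x) * indicator A (J x)))\<^sup>2)"
  have g: "g \<in> borel_measurable borel" unfolding g_def
    using measurable_compose[OF mJ meas] by measurable
  have gi: "(\<lambda>x. if x \<in> K ` A then (cmod (deriv f (J x)))\<^sup>2 else 0) = g"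
    by (auto simp: g_def indicator_def fun_eq_iff image_iff)
  have hm': "K ` f ` A \<in> lmeasurable \<and> measure lebesgue (K ` f ` A) = m \<longleftrightarrow> (g has_integral m) UNIV" for m
    using hm[of m] unfolding gi[symmetric] has_integral_restrict_UNIV by (simp only:)
  show ?thesis
  proof (cases "emeasure lborel (K ` f ` A) = \<infinity>")
    case False
    then have "K ` f ` A \<in> lmeasurable"
      using KfA by (auto simp: fmeasurable_def less_top)
    then have "(g has_integral measure lebesgue (K ` f ` A)) UNIV" using hm' by blast
    then have "(\<integral>\<^sup>+x. ennreal (g x) \<partial>lborel) = measure lebesgue (K ` f ` A)"
      using g by (intro nn_integral_has_integral_lborel) (auto simp: g_def)
    moreover have "emeasure lborel (K ` f ` A) = measure lebesgue (K ` f ` A)"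
      using False KfA by (simp add: emeasure_eq_ennreal_measure)
    ultimately show ?thesis using em[OF fA] rhs by (simp add: g_def)
  next
    case True
    have "(\<integral>\<^sup>+x. ennreal (g x) \<partial>lborel) = \<infinity>"
    proof (rule ccontr)
      assume "(\<integral>\<^sup>+x. ennreal (g x) \<partial>lborel) \<noteq> \<infinity>"
      then obtain m where "m \<ge> 0" "(\<integral>\<^sup>+x. ennreal (g x) \<partial>lborel) = ennreal m"
        by (metis ennreal_cases infinity_ennreal_def)
      then have "(g has_integral m) UNIV" using g
        by (intro nn_integral_has_integral) (auto simp: g_def)
      then have "K ` f ` A \<in> lmeasurable" using hm' by blast
      then show False using True KfA by (auto simp: fmeasurable_def)
    qed
    then show ?thesis using em[OF fA] rhs True by (simp add: g_def)
  qed
qed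

text \<open>
  The area formula for subsets says that the image of the measure with density \<open>\<bar>f'\<bar>\<^sup>2\<close> under
  \<open>f\<close> is Lebesgue measure on the image. Integrating against both measures gives the claim.
  Image sets are Borel because the inverse map is holomorphic.
\<close>

lemma nn_integral_holomorphic_substitution:
  fixes f :: "complex \<Rightarrow> complex"
  assumes S: "open S" "f holomorphic_on S" "inj_on f S" and h: "h \<in> borel_measurable borel"
  shows "(\<integral>\<^sup>+w. h w * indicator (f ` S) w \<partial>lborel)
       = (\<integral>\<^sup>+z. h (f z) * ennreal ((cmod (deriv f z))\<^sup>2) * indicator S z \<partial>lborel)"
proof -
  obtain g where g: "g holomorphic_on f ` S" "\<And>z. z \<in> S \<Longrightarrow> g (f z) = z"
    using holomorphic_has_inverse[OF S(2,1,3)] by metis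
  have fS: "open (f ` S)" using open_mapping_thm3[OF S(2,1,3)] by auto
  define f0 where "f0 = (\<lambda>z. indicator S z *\<^sub>R f z)"
  define g0 where "g0 = (\<lambda>w. indicator (f ` S) w *\<^sub>R g w)"
  define d where "d = (\<lambda>z. ennreal ((cmod (indicator S z *\<^sub>R deriv f z))\<^sup>2))"
  have [measurable]: "f0 \<in> borel_measurable borel" "S \<in> sets borel"
    unfolding f0_def using S holomorphic_on_imp_continuous_on
    by (auto intro!: borel_measurable_continuous_on_indicator)
  have [measurable]: "g0 \<in> borel_measurable borel" "f ` S \<in> sets borel"
    unfolding g0_def using fS g holomorphic_on_imp_continuous_on
    by (auto intro!: borel_measurable_continuous_on_indicator)
  have "(\<lambda>z. indicator S z *\<^sub>R deriv f z) \<in> borel_measurable borel"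
    using S by (intro borel_measurable_continuous_on_indicator holomorphic_on_imp_continuous_on holomorphic_deriv) auto
  then have [measurable]: "d \<in> borel_measurable borel"
    unfolding d_def by measurable
  have eq: "distr (density lborel d) borel f0 = density lborel (indicator (f ` S))"
  proof (rule measure_eqI)
    fix B assume "B \<in> sets (distr (density lborel d) borel f0)"
    then have B [measurable]: "B \<in> sets borel" by simp
    define A where "A = S \<inter> f0 -` B"
    have A: "A \<in> sets borel" "A \<subseteq> S"
      unfolding A_def using measurable_sets_borel[OF \<open>f0 \<in> borel_measurable borel\<close> B] by auto
    have "f ` A = f ` S \<inter> g0 -` A"
      using g(2) by (auto simp: g0_def A_def)
    moreover have "\<dots> \<in> sets borel" 
      using measurable_sets_borel[OF \<open>g0 \<in> borel_measurable borel\<close> A(1)] by auto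
    ultimately have fA: "f ` A \<in> sets borel" by simp
    have "emeasure (distr (density lborel d) borel f0) B = (\<integral>\<^sup>+z. d z * indicator (f0 -` B) z \<partial>lborel)"
      using measurable_sets_borel[OF \<open>f0 \<in> borel_measurable borel\<close> B]
      by (simp add: emeasure_distr emeasure_density)
    also have "\<dots> = (\<integral>\<^sup>+z. ennreal ((cmod (deriv f z))\<^sup>2) * indicator A z \<partial>lborel)"
      by (intro nn_integral_cong) (auto simp: d_def A_def indicator_def)
    also have "\<dots> = emeasure lborel (f ` A)"
      by (rule emeasure_image_holomorphic[symmetric, OF S A fA])
    also have "f ` A = B \<inter> f ` S" by (auto simp: A_def f0_def)
    also have "emeasure lborel (B \<inter> f ` S) = emeasure (density lborel (indicator (f ` S))) B"
      by (subst emeasure_density) (auto simp: indicator_inter_arith[symmetric] Int_commute)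
    finally show "emeasure (distr (density lborel d) borel f0) B = emeasure (density lborel (indicator (f ` S))) B" .
  qed simp
  have "(\<integral>\<^sup>+w. h w * indicator (f ` S) w \<partial>lborel) = (\<integral>\<^sup>+w. h w \<partial>density lborel (indicator (f ` S)))"
    using h by (subst nn_integral_density) (auto simp: mult.commute)
  also have "\<dots> = (\<integral>\<^sup>+z. d z * h (f0 z) \<partial>lborel)"
    using h by (subst eq[symmetric]) (simp add: nn_integral_distr nn_integral_density)
  also have "\<dots> = (\<integral>\<^sup>+z. h (f z) * ennreal ((cmod (deriv f z))\<^sup>2) * indicator S z \<partial>lborel)"
    by (intro nn_integral_cong) (auto simp: d_def f0_def indicator_def mult.commute)
  finally show ?thesis .
qed

section \<open>The weighted area measure\<close>

definition area_density :: "real \<Rightarrow> complex \<Rightarrow> ennreal" where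
  "area_density \<alpha> z = ennreal ((1 + \<alpha>) / pi * (1 - (cmod z)\<^sup>2) powr \<alpha>)"

lemma space_weighted_area [simp]: "space (weighted_area \<alpha>) = disk"
  by (simp add: weighted_area_def disk_area_def space_restrict_space)

lemma sets_weighted_area [measurable_cong]: "sets (weighted_area \<alpha>) = sets (restrict_space borel disk)"
  by (simp add: weighted_area_def disk_area_def sets_restrict_space)

lemma borel_measurable_weighted_area_iff:
  "h \<in> borel_measurable (weighted_area \<alpha>) \<longleftrightarrow> h \<in> borel_measurable (restrict_space borel disk)"
  by (rule arg_cong[where f="\<lambda>S. h \<in> S"], rule measurable_cong_sets) (auto simp: sets_weighted_area)

lemma continuous_on_borel_measurable_weighted_area:
  "continuous_on disk h \<Longrightarrow> h \<in> borel_measurable (weighted_area \<alpha>)"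
  by (simp add: borel_measurable_weighted_area_iff borel_measurable_continuous_on_restrict)

lemma area_density_measurable [measurable]: "area_density \<alpha> \<in> borel_measurable borel"
  unfolding area_density_def by measurable

lemma emeasure_disk: "emeasure lborel disk = ennreal pi"
  by (simp add: emeasure_ball unit_ball_vol_2)

lemma nn_integral_weighted_area:
  assumes \<alpha>: "\<alpha> > -1" and h: "h \<in> borel_measurable (weighted_area \<alpha>)"
  shows "(\<integral>\<^sup>+z. h z \<partial>weighted_area \<alpha>) = (\<integral>\<^sup>+z. h z * area_density \<alpha> z * indicator disk z \<partial>lborel)"
proof -
  have h': "h \<in> borel_measurable (restrict_space borel disk)"
    using h by (simp add: borel_measurable_weighted_area_iff)
  have m: "measurable disk_area borel = (measurable (restrict_space borel disk) borel :: (complex \<Rightarrow> ennreal) set)"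
    by (rule measurable_cong_sets) (auto simp: disk_area_def sets_restrict_space)
  have m': "measurable (restrict_space lborel disk) borel = (measurable (restrict_space borel disk) borel :: (complex \<Rightarrow> ennreal) set)"
    by (rule measurable_cong_sets) (auto simp: sets_restrict_space)
  define w where "w = (\<lambda>z. ennreal ((1 + \<alpha>) * (1 - (cmod z)\<^sup>2) powr \<alpha>))"
  have w: "w \<in> borel_measurable (restrict_space borel disk)"
    unfolding w_def by (intro measurable_restrict_space1) measurable
  have "(\<integral>\<^sup>+z. h z \<partial>weighted_area \<alpha>) = (\<integral>\<^sup>+z. w z * h z \<partial>disk_area)"
    unfolding weighted_area_def w_def[symmetric] using h' w by (intro nn_integral_density) (auto simp: m)
  also have "\<dots> = (\<integral>\<^sup>+z. indicator disk z / ennreal pi * (w z * h z) \<partial>restrict_space lborel disk)"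
    unfolding disk_area_def uniform_measure_def
    using h' w by (subst nn_integral_density) (auto simp: m' emeasure_restrict_space emeasure_disk sets_restrict_space
       intro!: measurable_restrict_space1 borel_measurable_divide_ennreal borel_measurable_indicator)
  also have "\<dots> = (\<integral>\<^sup>+z. h z * area_density \<alpha> z \<partial>restrict_space lborel disk)"
  proof (intro nn_integral_cong)
    fix z assume "z \<in> space (restrict_space lborel disk :: complex measure)"
    then have z: "z \<in> disk" by (simp add: space_restrict_space)
    have "1 / ennreal pi = ennreal (1 / pi)"
      by (metis divide_ennreal ennreal_1 pi_gt_zero zero_le_one)
    then have "indicator disk z / ennreal pi * w z = area_density \<alpha> z"
      using z \<alpha> by (simp add: w_def area_density_def ennreal_mult'[symmetric])
    moreover have "indicator disk z / ennreal pi * (w z * h z) = h z * (indicator disk z / ennreal pi * w z)"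
      by (simp only: mult_ac)
    ultimately show "indicator disk z / ennreal pi * (w z * h z) = h z * area_density \<alpha> z"
      by (simp only:)
  qed
  also have "\<dots> = (\<integral>\<^sup>+z. h z * area_density \<alpha> z * indicator disk z \<partial>lborel)"
    by (simp add: nn_integral_restrict_space)
  finally show ?thesis .
qed

text \<open>
  Since a disk of radius \<open>r\<close> has area \<open>\<pi> r\<^sup>2\<close>, the squared modulus is uniformly distributed
  on the unit interval. It replaces polar coordinates in what follows.
\<close>

lemma distr_disk_square:
  "distr (density lborel (indicator disk)) borel (\<lambda>z::complex. (cmod z)\<^sup>2)
     = density lborel (\<lambda>t. ennreal pi * indicator {0..1} t)"
proof (rule measure_eqI_lessThan)
  fix x :: real
  let ?M = "distr (density lborel (indicator disk)) borel (\<lambda>z::complex. (cmod z)\<^sup>2)"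
  have [measurable]: "disk \<in> sets borel" by simp
  have e: "emeasure ?M {x<..} = emeasure lborel ({z. (cmod z)\<^sup>2 > x} \<inter> disk)"
  proof -
    have X: "{z::complex. (cmod z)\<^sup>2 > x} \<in> sets borel" by measurable
    have "emeasure ?M {x<..} = emeasure (density lborel (indicator disk)) {z. (cmod z)\<^sup>2 > x}"
      by (subst emeasure_distr) (auto simp: vimage_def)
    also have "\<dots> = (\<integral>\<^sup>+z. indicator disk z * indicator {z. (cmod z)\<^sup>2 > x} z \<partial>lborel)"
      using X by (intro emeasure_density) auto
    also have "\<dots> = (\<integral>\<^sup>+z. indicator ({z. (cmod z)\<^sup>2 > x} \<inter> disk) z \<partial>lborel)"
      by (intro nn_integral_cong) (simp only: indicator_inter_arith mult.commute)
    finally show ?thesis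
      using nn_integral_indicator[of "{z::complex. (cmod z)\<^sup>2 > x} \<inter> disk" lborel] X by (simp only: sets_lborel sets.Int[OF X] \<open>disk \<in> sets borel\<close>)
  qed
  have e2: "emeasure (density lborel (\<lambda>t. ennreal pi * indicator {0..1} t)) {x<..}
      = ennreal pi * emeasure lborel ({0..1} \<inter> {x<..})"
  proof -
    have "emeasure (density lborel (\<lambda>t. ennreal pi * indicator {0..1} t)) {x<..}
        = (\<integral>\<^sup>+t. ennreal pi * indicator ({0..1} \<inter> {x<..}) t \<partial>lborel)"
      by (subst emeasure_density) (auto intro!: nn_integral_cong simp: indicator_def)
    then show ?thesis by (simp add: nn_integral_cmult)
  qed
  consider "x < 0" | "0 \<le> x" "x \<le> 1" | "x > 1" by linarith
  then have "emeasure lborel ({z. (cmod z)\<^sup>2 > x} \<inter> disk) = ennreal pi * emeasure lborel ({0..1} \<inter> {x<..})"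
  proof cases
    case 1
    then have "x < (cmod z)\<^sup>2" for z by (rule less_le_trans) simp
    then have "{z. (cmod z)\<^sup>2 > x} \<inter> disk = disk" by blast
    moreover have "{0..1} \<inter> {x<..} = {0..1}" using 1 by auto
    ultimately show ?thesis by (simp only: emeasure_disk emeasure_lborel_Icc) simp
  next
    case 2
    have s: "(cmod z)\<^sup>2 > x \<longleftrightarrow> \<not> cmod z \<le> sqrt x" for z
      using real_sqrt_less_iff[of x "(cmod z)\<^sup>2"] by (simp add: not_le)
    then have eq: "{z. (cmod z)\<^sup>2 > x} \<inter> disk = disk - cball 0 (sqrt x)" unfolding mem_cball_0[symmetric] by blast
    have "emeasure lborel (cball 0 (sqrt x) :: complex set) = ennreal (pi * x)"
      using 2 by (simp add: emeasure_cball unit_ball_vol_2)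
    moreover have dis: "emeasure lborel (disk - cball 0 (sqrt x)) + emeasure lborel (cball 0 (sqrt x) :: complex set)
        = emeasure lborel (disk \<union> cball 0 (sqrt x) :: complex set)"
      by (subst plus_emeasure) (auto intro!: arg_cong[where f="emeasure lborel"])
    moreover have "emeasure lborel (disk \<union> cball 0 (sqrt x) :: complex set) = ennreal pi"
    proof (rule antisym)
      have "disk \<union> cball 0 (sqrt x) \<subseteq> (cball 0 1 :: complex set)"
      proof -
        have "sqrt x \<le> 1" using 2 by simp
        then show ?thesis by (auto simp del: real_sqrt_le_1_iff)
      qed
      then have "emeasure lborel (disk \<union> cball 0 (sqrt x) :: complex set) \<le> emeasure lborel (cball 0 1 :: complex set)"
        by (rule emeasure_mono) simp
      then show "emeasure lborel (disk \<union> cball 0 (sqrt x) :: complex set) \<le> ennreal pi"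
        by (simp add: emeasure_cball unit_ball_vol_2)
      have "emeasure lborel disk \<le> emeasure lborel (disk \<union> cball 0 (sqrt x) :: complex set)"
        by (rule emeasure_mono) auto
      then show "ennreal pi \<le> emeasure lborel (disk \<union> cball 0 (sqrt x) :: complex set)"
        by (simp only: emeasure_disk)
    qed
    ultimately have "emeasure lborel (disk - cball 0 (sqrt x)) + ennreal (pi * x) = ennreal pi" by (simp only:)
    moreover have "ennreal (pi - pi * x) + ennreal (pi * x) = ennreal pi"
      using 2 by (subst ennreal_plus[symmetric]) (auto simp: mult_left_le)
    ultimately have val: "emeasure lborel (disk - cball 0 (sqrt x)) = ennreal (pi - pi * x)"
      by (metis add.commute ennreal_add_left_cancel ennreal_neq_top infinity_ennreal_def)
    have "{0..1} \<inter> {x<..} = {x<..1}" using 2 by auto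
    then have "ennreal pi * emeasure lborel ({0..1} \<inter> {x<..}) = ennreal (pi * (1 - x))"
      using 2 by (simp add: ennreal_mult')
    then show ?thesis unfolding eq val by (simp only: right_diff_distrib mult_1_right)
  next
    case 3
    have "(cmod z)\<^sup>2 < 1" if "z \<in> disk" for z :: complex
      using that by (simp add: power_less_one_iff)
    then have "\<not> (cmod z)\<^sup>2 > x" if "z \<in> disk" for z :: complex
      using 3 that by (meson less_asym less_trans)
    then have "{z. (cmod z)\<^sup>2 > x} \<inter> disk = {}" by blast
    moreover have "{0..1} \<inter> {x<..} = {}" using 3 by auto
    ultimately show ?thesis by (simp only:) simp
  qed
  then show "emeasure ?M {x<..} = emeasure (density lborel (\<lambda>t. ennreal pi * indicator {0..1} t)) {x<..}"
    by (simp add: e e2)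
  have "emeasure ?M {x<..} \<le> emeasure lborel disk"
    unfolding e by (intro emeasure_mono) auto
  then show "emeasure ?M {x<..} < \<infinity>" by (simp add: emeasure_disk le_less_trans)
qed auto

lemma nn_integral_radial:
  assumes \<alpha>: "\<alpha> > -1" and g: "g \<in> borel_measurable borel"
  shows "(\<integral>\<^sup>+z. g ((cmod z)\<^sup>2) \<partial>weighted_area \<alpha>)
       = (\<integral>\<^sup>+t. g t * ennreal ((1 + \<alpha>) * (1 - t) powr \<alpha>) * indicator {0..1} t \<partial>lborel)"
proof -
  have [measurable]: "disk \<in> sets borel" by simp
  have "(\<integral>\<^sup>+z. g ((cmod z)\<^sup>2) \<partial>weighted_area \<alpha>)
     = (\<integral>\<^sup>+z. indicator disk z * (g ((cmod z)\<^sup>2) * ennreal ((1 + \<alpha>) / pi * (1 - (cmod z)\<^sup>2) powr \<alpha>)) \<partial>lborel)"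
    using g by (subst nn_integral_weighted_area[OF \<alpha>])
      (auto simp: borel_measurable_weighted_area_iff area_density_def mult_ac intro!: measurable_restrict_space1)
  also have "\<dots> = (\<integral>\<^sup>+z. g ((cmod z)\<^sup>2) * ennreal ((1 + \<alpha>) / pi * (1 - (cmod z)\<^sup>2) powr \<alpha>) \<partial>density lborel (indicator disk))"
    using g by (subst nn_integral_density) auto
  also have "\<dots> = (\<integral>\<^sup>+t. g t * ennreal ((1 + \<alpha>) / pi * (1 - t) powr \<alpha>) \<partial>density lborel (\<lambda>t. ennreal pi * indicator {0..1} t))"
    unfolding distr_disk_square[symmetric] using g by (subst nn_integral_distr) auto
  also have "\<dots> = (\<integral>\<^sup>+t. ennreal pi * indicator {0..1} t * (g t * ennreal ((1 + \<alpha>) / pi * (1 - t) powr \<alpha>)) \<partial>lborel)"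
    using g by (subst nn_integral_density) auto
  also have "\<dots> = (\<integral>\<^sup>+t. g t * ennreal ((1 + \<alpha>) * (1 - t) powr \<alpha>) * indicator {0..1} t \<partial>lborel)"
  proof (intro nn_integral_cong)
    fix t :: real
    have "ennreal pi * ennreal ((1 + \<alpha>) / pi * (1 - t) powr \<alpha>) = ennreal ((1 + \<alpha>) * (1 - t) powr \<alpha>)"
      by (subst ennreal_mult'[symmetric]) auto
    moreover have "ennreal pi * indicator {0..1} t * (g t * ennreal ((1 + \<alpha>) / pi * (1 - t) powr \<alpha>))
       = g t * (ennreal pi * ennreal ((1 + \<alpha>) / pi * (1 - t) powr \<alpha>)) * indicator {0..1} t"
      by (simp only: mult_ac)
    ultimately show "ennreal pi * indicator {0..1} t * (g t * ennreal ((1 + \<alpha>) / pi * (1 - t) powr \<alpha>))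
       = g t * ennreal ((1 + \<alpha>) * (1 - t) powr \<alpha>) * indicator {0..1} t"
      by (simp only:)
  qed
  finally show ?thesis .
qed

text \<open>
  The integral of \<open>\<bar>z\<bar>\<^sup>2\<^sup>m\<close>, which becomes a beta integral in the variable \<open>\<bar>z\<bar>\<^sup>2\<close>.
\<close>

definition moment :: "real \<Rightarrow> nat \<Rightarrow> real" where
  "moment \<alpha> m = (1 + \<alpha>) * Beta (real m + 1) (\<alpha> + 1)"

lemma nn_integral_cmod_power:
  assumes \<alpha>: "\<alpha> > -1"
  shows "(\<integral>\<^sup>+z. ennreal ((cmod z)\<^sup>2 ^ m) \<partial>weighted_area \<alpha>) = ennreal (moment \<alpha> m)"
proof -
  have "(\<integral>\<^sup>+z. ennreal ((cmod z)\<^sup>2 ^ m) \<partial>weighted_area \<alpha>)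
     = (\<integral>\<^sup>+t. ennreal (t ^ m) * ennreal ((1 + \<alpha>) * (1 - t) powr \<alpha>) * indicator {0..1} t \<partial>lborel)"
    by (rule nn_integral_radial[OF \<alpha>, of "\<lambda>t. ennreal (t ^ m)"]) measurable
  also have "\<dots> = (\<integral>\<^sup>+t. ennreal (1 + \<alpha>) * (ennreal (t powr (real m + 1 - 1) * (1 - t) powr (\<alpha> + 1 - 1) * indicator {0..1} t)) \<partial>lborel)"
  proof (rule nn_integral_cong_AE)
    have "AE t in lborel. t \<noteq> (0::real)" by (rule AE_lborel_singleton)
    then show "AE t in lborel. ennreal (t ^ m) * ennreal ((1 + \<alpha>) * (1 - t) powr \<alpha>) * indicator {0..1} t =
       ennreal (1 + \<alpha>) * (ennreal (t powr (real m + 1 - 1) * (1 - t) powr (\<alpha> + 1 - 1) * indicator {0..1} t))"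
    proof eventually_elim
      fix t :: real assume t0: "t \<noteq> 0"
      show "ennreal (t ^ m) * ennreal ((1 + \<alpha>) * (1 - t) powr \<alpha>) * indicator {0..1} t =
       ennreal (1 + \<alpha>) * (ennreal (t powr (real m + 1 - 1) * (1 - t) powr (\<alpha> + 1 - 1) * indicator {0..1} t))"
      proof (cases "t \<in> {0..1}")
        case True
        then have t: "t > 0" using t0 by simp
        then have p: "t powr real m = t ^ m" by (simp add: powr_realpow)
        have "ennreal (t ^ m) * ennreal ((1 + \<alpha>) * (1 - t) powr \<alpha>) = ennreal (t ^ m * ((1 + \<alpha>) * (1 - t) powr \<alpha>))"
          using t by (intro ennreal_mult'[symmetric]) simp
        also have "t ^ m * ((1 + \<alpha>) * (1 - t) powr \<alpha>) = (1 + \<alpha>) * (t ^ m * (1 - t) powr \<alpha>)"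
          by (simp only: mult_ac)
        also have "ennreal \<dots> = ennreal (1 + \<alpha>) * ennreal (t ^ m * (1 - t) powr \<alpha>)"
          using \<alpha> by (intro ennreal_mult') simp
        finally show ?thesis using True by (simp add: p)
      qed simp
    qed
  qed
  also have "\<dots> = ennreal (1 + \<alpha>) * (\<integral>\<^sup>+t. ennreal (t powr (real m + 1 - 1) * (1 - t) powr (\<alpha> + 1 - 1) * indicator {0..1} t) \<partial>lborel)"
    by (subst nn_integral_cmult) auto
  also have "(\<integral>\<^sup>+t. ennreal (t powr (real m + 1 - 1) * (1 - t) powr (\<alpha> + 1 - 1) * indicator {0..1} t) \<partial>lborel)
     = ennreal (Beta (real m + 1) (\<alpha> + 1))"
  proof (rule nn_integral_has_integral_lborel)
    have "((\<lambda>t. t powr (real m + 1 - 1) * (1 - t) powr (\<alpha> + 1 - 1)) has_integral Beta (real m + 1) (\<alpha> + 1)) {0..1}"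
      using \<alpha> by (intro has_integral_Beta_real) auto
    then have "((\<lambda>t. if t \<in> {0..1} then t powr (real m + 1 - 1) * (1 - t) powr (\<alpha> + 1 - 1) else 0) has_integral Beta (real m + 1) (\<alpha> + 1)) UNIV"
      by (simp only: has_integral_restrict_UNIV)
    moreover have "(\<lambda>t. if t \<in> {0..1} then t powr (real m + 1 - 1) * (1 - t) powr (\<alpha> + 1 - 1) else 0)
      = (\<lambda>t. t powr (real m + 1 - 1) * (1 - t) powr (\<alpha> + 1 - 1) * indicator {0..1} t)"
      by (auto simp: indicator_def)
    ultimately show "((\<lambda>t. t powr (real m + 1 - 1) * (1 - t) powr (\<alpha> + 1 - 1) * indicator {0..1} t) has_integral Beta (real m + 1) (\<alpha> + 1)) UNIV"
      by simp
  qed (auto simp: indicator_def)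
  also have "ennreal (1 + \<alpha>) * ennreal (Beta (real m + 1) (\<alpha> + 1)) = ennreal (moment \<alpha> m)"
    using \<alpha> by (simp add: moment_def ennreal_mult')
  finally show ?thesis .
qed

lemma moment_pos:
  assumes "\<alpha> > -1"
  shows "moment \<alpha> m > 0"
  using assms by (auto simp: moment_def Beta_def intro!: mult_pos_pos divide_pos_pos)

lemma moment_0:
  assumes "\<alpha> > -1"
  shows "moment \<alpha> 0 = 1"
proof -
  have "Gamma (2 + \<alpha>) = (1 + \<alpha>) * Gamma (1 + \<alpha>)"
    using Gamma_plus1[of "1 + \<alpha>"] assms by (simp add: nonpos_Ints_def add_ac)
  moreover have "Gamma (1 + \<alpha>) \<noteq> 0" using Gamma_real_pos[of "1 + \<alpha>"] assms by linarith
  ultimately show ?thesis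
    using assms by (simp add: moment_def Beta_def add_ac)
qed

lemma finite_measure_weighted_area:
  assumes "\<alpha> > -1"
  shows "finite_measure (weighted_area \<alpha>)"
proof
  have "emeasure (weighted_area \<alpha>) (space (weighted_area \<alpha>)) = (\<integral>\<^sup>+z. ennreal ((cmod z)\<^sup>2 ^ 0) \<partial>weighted_area \<alpha>)"
    by simp
  also have "\<dots> < \<infinity>" by (subst nn_integral_cmod_power[OF assms]) simp
  finally show "emeasure (weighted_area \<alpha>) (space (weighted_area \<alpha>)) \<noteq> \<infinity>" by simp
qed

lemma rotation_measurable:
  assumes c: "cmod c = 1"
  shows "(\<lambda>z. c * z) \<in> measurable (weighted_area \<alpha>) (weighted_area \<alpha>)"
proof -
  have "(\<lambda>z. c * z) \<in> measurable (restrict_space borel disk) (restrict_space borel disk)"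
    using c by (auto intro!: measurable_restrict_space3 simp: norm_mult)
  then show ?thesis by (subst measurable_cong_sets[OF sets_weighted_area sets_weighted_area])
qed

text \<open>
  Both Lebesgue measure and the weight are invariant under rotations. This yields the
  orthogonality of the monomials.
\<close>

lemma weighted_area_rotate:
  assumes \<alpha>: "\<alpha> > -1" and c: "cmod c = 1"
  shows "distr (weighted_area \<alpha>) (weighted_area \<alpha>) (\<lambda>z. c * z) = weighted_area \<alpha>"
proof -
  note rot = rotation_measurable[OF c, of \<alpha>]
  have c0: "c \<noteq> 0" using c by auto
  have img: "(\<lambda>z. c * z) ` disk = disk"
  proof
    show "disk \<subseteq> (\<lambda>z. c * z) ` disk"
    proof
      fix w assume "w \<in> disk"
      then have "w = c * (w / c)" "w / c \<in> disk" using c c0 by (auto simp: norm_divide)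
      then show "w \<in> (\<lambda>z. c * z) ` disk" by blast
    qed
  qed (use c in \<open>auto simp: norm_mult\<close>)
  have der: "deriv (\<lambda>z. c * z) z = c" for z by (rule DERIV_imp_deriv) (auto intro!: derivative_eq_intros)
  show ?thesis
  proof (rule measure_eqI)
    fix B assume "B \<in> sets (distr (weighted_area \<alpha>) (weighted_area \<alpha>) (\<lambda>z. c * z))"
    then have B: "B \<in> sets (weighted_area \<alpha>)" by simp
    then have B': "B \<in> sets borel" "B \<subseteq> disk"
      by (auto simp: sets_weighted_area sets_restrict_space)
    have dens: "area_density \<alpha> (c * z) = area_density \<alpha> z" for z
      by (simp add: area_density_def norm_mult c)
    have pre: "(\<lambda>z. c * z) -` B \<inter> disk \<in> sets (weighted_area \<alpha>)"
      using measurable_sets[OF rot B] by simp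
    have "emeasure (distr (weighted_area \<alpha>) (weighted_area \<alpha>) (\<lambda>z. c * z)) B
       = (\<integral>\<^sup>+z. indicator ((\<lambda>z. c * z) -` B \<inter> disk) z \<partial>weighted_area \<alpha>)"
      using pre by (subst emeasure_distr[OF rot B]) simp
    also have "\<dots> = (\<integral>\<^sup>+z. indicator ((\<lambda>z. c * z) -` B \<inter> disk) z * area_density \<alpha> z * indicator disk z \<partial>lborel)"
      using pre by (intro nn_integral_weighted_area \<alpha>) auto
    also have "\<dots> = (\<integral>\<^sup>+z. indicator B (c * z) * area_density \<alpha> (c * z) * ennreal ((cmod (deriv (\<lambda>z. c * z) z))\<^sup>2) * indicator disk z \<partial>lborel)"
      by (intro nn_integral_cong) (auto simp: indicator_def dens der c)
    also have "\<dots> = (\<integral>\<^sup>+w. indicator B w * area_density \<alpha> w * indicator ((\<lambda>z. c * z) ` disk) w \<partial>lborel)"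
      using B' c0 by (subst nn_integral_holomorphic_substitution)
        (auto intro!: holomorphic_intros simp: inj_on_def)
    also have "\<dots> = (\<integral>\<^sup>+z. indicator B z \<partial>weighted_area \<alpha>)"
      unfolding img using B by (intro nn_integral_weighted_area[symmetric] \<alpha>) auto
    also have "\<dots> = emeasure (weighted_area \<alpha>) B" using B by simp
    finally show "emeasure (distr (weighted_area \<alpha>) (weighted_area \<alpha>) (\<lambda>z. c * z)) B = emeasure (weighted_area \<alpha>) B" .
  qed simp
qed

section \<open>Taylor coefficients and Parseval's formula\<close>

definition taylor :: "(complex \<Rightarrow> complex) \<Rightarrow> nat \<Rightarrow> complex" where
  "taylor f n = (deriv ^^ n) f 0 / fact n"

lemma taylor_sums:
  assumes "f holomorphic_on disk" "z \<in> disk"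
  shows "(\<lambda>n. taylor f n * z ^ n) sums f z"
  using holomorphic_power_series[OF assms] by (simp add: taylor_def)

lemma taylor_summable_norm:
  assumes f: "f holomorphic_on disk" and r: "0 \<le> r" "r < 1"
  shows "summable (\<lambda>n. cmod (taylor f n) * r ^ n)"
proof -
  obtain s where s: "r < s" "s < 1" using r dense by blast
  have "summable (\<lambda>n. taylor f n * (of_real s) ^ n)"
    using taylor_sums[OF f, of "of_real s"] s r by (auto simp: sums_iff)
  then have "summable (\<lambda>n. cmod (taylor f n * (of_real r) ^ n))"
    by (rule powser_insidea) (use s r in auto)
  then show ?thesis using r by (simp add: norm_mult norm_power)
qed

text \<open>
  Rotating by a suitable angle multiplies the integrand by -1 and leaves the integral unchanged.
\<close>

lemma integral_monomials_orthogonal: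
  assumes \<alpha>: "\<alpha> > -1" and "m \<noteq> n"
  shows "(\<integral>z. indicator (cball 0 r) z *\<^sub>R (z ^ m * cnj z ^ n) \<partial>weighted_area \<alpha>) = 0"
proof -
  \<comment> \<open>chosen such that \<open>c ^ m * cnj c ^ n = -1\<close>\<close>
  define c where "c = cis (pi / (real m - real n))"
  have c: "cmod c = 1" by (simp add: c_def)
  have "c ^ m * cnj c ^ n = cis (real m * (pi / (real m - real n)) + real n * - (pi / (real m - real n)))"
    by (simp only: c_def Complex.DeMoivre cis_cnj cis_mult)
  also have "real m * (pi / (real m - real n)) + real n * - (pi / (real m - real n)) = pi"
  proof -
    have e: "real m * t + real n * - t = (real m - real n) * t" for t by (simp add: algebra_simps)
    show ?thesis unfolding e using \<open>m \<noteq> n\<close> by simp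
  qed
  finally have cc: "c ^ m * cnj c ^ n = -1" by simp
  define h where "h = (\<lambda>z::complex. indicator (cball 0 r) z *\<^sub>R (z ^ m * cnj z ^ n))"
  have h: "h \<in> borel_measurable (weighted_area \<alpha>)"
    unfolding borel_measurable_weighted_area_iff h_def
    by (intro measurable_restrict_space1 borel_measurable_scaleR borel_measurable_indicator borel_measurable_times borel_measurable_continuous_onI continuous_intros) auto
  note rot = rotation_measurable[OF c, of \<alpha>]
  have hc: "h (c * z) = - h z" for z
  proof -
    have "(c * z) ^ m * cnj (c * z) ^ n = (c ^ m * cnj c ^ n) * (z ^ m * cnj z ^ n)"
      by (simp only: power_mult_distrib complex_cnj_mult mult_ac)
    then show ?thesis by (simp add: h_def cc norm_mult c indicator_def)
  qed
  have "integral\<^sup>L (weighted_area \<alpha>) h = (\<integral>z. h (c * z) \<partial>weighted_area \<alpha>)"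
    by (subst weighted_area_rotate[OF \<alpha> c, symmetric]) (rule integral_distr[OF rot h])
  also have "\<dots> = - integral\<^sup>L (weighted_area \<alpha>) h" by (simp add: hc)
  finally have "integral\<^sup>L (weighted_area \<alpha>) h = 0" by simp
  then show ?thesis by (simp add: h_def)
qed

lemma nn_integral_exhaust_disk:
  assumes h: "h \<in> borel_measurable (weighted_area \<alpha>)"
  shows "(\<integral>\<^sup>+z. h z \<partial>weighted_area \<alpha>)
       = (SUP k. \<integral>\<^sup>+z. indicator (cball 0 (1 - 1 / real (k + 2))) z * h z \<partial>weighted_area \<alpha>)"
proof -
  define f where "f = (\<lambda>k (z::complex). indicator (cball 0 (1 - 1 / real (k + 2))) z * h z)"
  have "(\<integral>\<^sup>+z. h z \<partial>weighted_area \<alpha>) = (\<integral>\<^sup>+z. (SUP k. f k z) \<partial>weighted_area \<alpha>)"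
  proof (rule nn_integral_cong)
    fix z assume "z \<in> space (weighted_area \<alpha>)"
    then have z: "cmod z < 1" by simp
    obtain k where "1 / real (Suc k) < 1 - cmod z"
      using z nat_approx_posE[of "1 - cmod z"] by auto
    moreover have "1 / real (k + 2) \<le> 1 / real (Suc k)" by (simp add: field_simps)
    ultimately have "z \<in> cball 0 (1 - 1 / real (k + 2))" by simp
    then have "h z \<le> f k z" by (simp add: f_def)
    then have "h z \<le> (SUP k. f k z)" by (rule SUP_upper2[OF UNIV_I])
    moreover have "(SUP k. f k z) \<le> h z"
      by (intro SUP_least) (auto simp: f_def indicator_def)
    ultimately show "h z = (SUP k. f k z)" by simp
  qed
  also have "\<dots> = (SUP k. \<integral>\<^sup>+z. f k z \<partial>weighted_area \<alpha>)"
  proof (rule nn_integral_monotone_convergence_SUP)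
    show "incseq f"
    proof (intro incseq_SucI le_funI)
      fix k and z :: complex
      have "1 / real (Suc k + 2) \<le> 1 / real (k + 2)" by (simp add: field_simps)
      then have "cball 0 (1 - 1 / real (k + 2)) \<subseteq> (cball 0 (1 - 1 / real (Suc k + 2)) :: complex set)"
        by (intro subset_cball) linarith
      then show "f k z \<le> f (Suc k) z"
        unfolding f_def by (intro mult_right_mono) (auto simp: indicator_def)
    qed
    fix k show "f k \<in> borel_measurable (weighted_area \<alpha>)"
    proof -
      have "indicator (cball 0 (1 - 1 / real (k + 2))) \<in> borel_measurable (weighted_area \<alpha>)"
        unfolding borel_measurable_weighted_area_iff
        by (intro measurable_restrict_space1 borel_measurable_indicator) simp
      then show ?thesis unfolding f_def using h by (intro borel_measurable_times_ennreal)
    qed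
  qed
  finally show ?thesis by (simp add: f_def)
qed

text \<open>
  On a smaller disk the partial sums of the power series are uniformly bounded, so dominated
  convergence passes from polynomials, where orthogonality applies, to the function.
\<close>

lemma nn_integral_cball_parseval:
  assumes \<alpha>: "\<alpha> > -1" and g: "g holomorphic_on disk" and r: "0 \<le> r" "r < 1"
  shows "(\<integral>\<^sup>+z. indicator (cball 0 r) z * ennreal ((cmod (g z))\<^sup>2) \<partial>weighted_area \<alpha>)
    = (\<Sum>n. ennreal ((cmod (taylor g n))\<^sup>2) * (\<integral>\<^sup>+z. indicator (cball 0 r) z * ennreal ((cmod z)\<^sup>2 ^ n) \<partial>weighted_area \<alpha>))"
proof -
  interpret finite_measure "weighted_area \<alpha>" by (rule finite_measure_weighted_area[OF \<alpha>])
  let ?M = "weighted_area \<alpha>"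
  define b where "b = taylor g"
  define ind where "ind = (\<lambda>z::complex. indicator (cball 0 r) z :: real)"
  have indm: "ind \<in> borel_measurable ?M"
    unfolding ind_def borel_measurable_weighted_area_iff
    by (intro measurable_restrict_space1 borel_measurable_indicator) simp
  have gm: "g \<in> borel_measurable ?M"
    by (intro continuous_on_borel_measurable_weighted_area holomorphic_on_imp_continuous_on g)
  have cm: "h \<in> borel_measurable ?M" if "continuous_on UNIV h" for h :: "complex \<Rightarrow> 'b::real_normed_vector"
    by (intro continuous_on_borel_measurable_weighted_area continuous_on_subset[OF that]) simp
  have mono_int: "integrable ?M (\<lambda>z. ind z *\<^sub>R (z ^ m * cnj z ^ n))" for m n
  proof (rule integrable_const_bound)
    show "AE z in ?M. cmod (ind z *\<^sub>R (z ^ m * cnj z ^ n)) \<le> 1"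
      by (rule AE_I2) (auto simp: ind_def indicator_def norm_mult norm_power intro!: mult_le_one power_le_one)
    show "(\<lambda>z. ind z *\<^sub>R (z ^ m * cnj z ^ n)) \<in> borel_measurable ?M"
      by (intro borel_measurable_scaleR indm cm continuous_intros)
  qed
  define \<rho> where "\<rho> n = (\<integral>z. ind z * (cmod z)\<^sup>2 ^ n \<partial>?M)" for n
  have zz: "z ^ n * cnj z ^ n = complex_of_real ((cmod z)\<^sup>2 ^ n)" for z n
    by (simp only: power_mult_distrib[symmetric] complex_norm_square[symmetric] of_real_power)
  have diag: "(\<integral>z. ind z *\<^sub>R (z ^ m * cnj z ^ n) \<partial>?M) = (if m = n then of_real (\<rho> n) else 0)" for m n
  proof (cases "m = n")
    case True
    have "(\<integral>z. ind z *\<^sub>R (z ^ n * cnj z ^ n) \<partial>?M) = (\<integral>z. complex_of_real (ind z * (cmod z)\<^sup>2 ^ n) \<partial>?M)"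
      by (simp only: zz scaleR_conv_of_real of_real_mult)
    also have "\<dots> = of_real (\<rho> n)" unfolding \<rho>_def by (rule integral_complex_of_real)
    finally show ?thesis using True by simp
  next
    case False
    then show ?thesis using integral_monomials_orthogonal[OF \<alpha> False] by (simp add: ind_def)
  qed
  have \<rho>i: "integrable ?M (\<lambda>z. ind z * (cmod z)\<^sup>2 ^ n)" for n
  proof (rule integrable_const_bound)
    show "AE z in ?M. norm (ind z * (cmod z)\<^sup>2 ^ n) \<le> 1"
      by (rule AE_I2) (auto simp: ind_def indicator_def intro!: power_le_one)
    show "(\<lambda>z. ind z * (cmod z)\<^sup>2 ^ n) \<in> borel_measurable ?M"
      by (intro borel_measurable_times indm cm continuous_intros)
  qed
  have \<rho>0: "\<rho> n \<ge> 0" for n unfolding \<rho>_def by (intro integral_nonneg_AE AE_I2) (auto simp: ind_def)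
  define p where "p N z = (\<Sum>n<N. b n * z ^ n)" for N z
  have part: "(\<integral>z. ind z * (cmod (p N z))\<^sup>2 \<partial>?M) = (\<Sum>n<N. (cmod (b n))\<^sup>2 * \<rho> n)" for N
  proof -
    have e: "complex_of_real (ind z * (cmod (p N z))\<^sup>2)
        = (\<Sum>m<N. \<Sum>n<N. (b m * cnj (b n)) * (ind z *\<^sub>R (z ^ m * cnj z ^ n)))" for z
      unfolding of_real_mult complex_norm_square p_def
      by (simp add: sum_product sum_distrib_left scaleR_conv_of_real mult_ac, rule sum.swap)
    have "complex_of_real (\<integral>z. ind z * (cmod (p N z))\<^sup>2 \<partial>?M)
        = (\<integral>z. complex_of_real (ind z * (cmod (p N z))\<^sup>2) \<partial>?M)" by (rule integral_complex_of_real[symmetric])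
    also have "\<dots> = (\<Sum>m<N. \<Sum>n<N. (b m * cnj (b n)) * (\<integral>z. ind z *\<^sub>R (z ^ m * cnj z ^ n) \<partial>?M))"
      unfolding e by (subst Bochner_Integration.integral_sum, (intro Bochner_Integration.integrable_sum integrable_mult_right mono_int)[1],
         subst Bochner_Integration.integral_sum, (intro integrable_mult_right mono_int)[1],
         subst integral_mult_right_zero, rule refl)
    also have "\<dots> = (\<Sum>m<N. b m * cnj (b m) * of_real (\<rho> m))"
      by (simp add: diag if_distrib[of "\<lambda>x. _ * x"] cong: if_cong)
    also have "\<dots> = of_real (\<Sum>n<N. (cmod (b n))\<^sup>2 * \<rho> n)"
      by (simp only: of_real_sum of_real_mult complex_norm_square)
    finally show ?thesis by (simp only: of_real_eq_iff)
  qed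
  define B where "B = (\<Sum>n. cmod (b n) * r ^ n)"
  have sB: "summable (\<lambda>n. cmod (b n) * r ^ n)"
    unfolding b_def by (rule taylor_summable_norm[OF g r])
  have pB: "cmod (p N z) \<le> B" if "z \<in> cball 0 r" for N z
  proof -
    have "cmod (p N z) \<le> (\<Sum>n<N. cmod (b n * z ^ n))" unfolding p_def by (rule norm_sum)
    also have "\<dots> \<le> (\<Sum>n<N. cmod (b n) * r ^ n)"
      using that r by (intro sum_mono) (auto simp: norm_mult norm_power intro!: mult_left_mono power_mono)
    also have "\<dots> \<le> B" unfolding B_def using sB r by (intro sum_le_suminf) auto
    finally show ?thesis .
  qed
  have plim: "(\<lambda>N. p N z) \<longlonglongrightarrow> g z" if "z \<in> disk" for z
    using taylor_sums[OF g that] by (simp add: sums_def p_def b_def)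
  have pm: "(\<lambda>z. ind z * (cmod (p N z))\<^sup>2) \<in> borel_measurable ?M" for N
    unfolding p_def by (intro borel_measurable_times indm cm continuous_intros)
  have gm2: "(\<lambda>z. ind z * (cmod (g z))\<^sup>2) \<in> borel_measurable ?M"
    using gm indm by measurable
  have lim: "AE z in ?M. (\<lambda>N. ind z * (cmod (p N z))\<^sup>2) \<longlonglongrightarrow> ind z * (cmod (g z))\<^sup>2"
    by (rule AE_I2) (auto intro!: tendsto_intros plim)
  have bnd: "AE z in ?M. norm (ind z * (cmod (p N z))\<^sup>2) \<le> B\<^sup>2" for N
    by (rule AE_I2) (auto simp: ind_def indicator_def intro!: power_mono pB)
  have "(\<lambda>N. \<integral>z. ind z * (cmod (p N z))\<^sup>2 \<partial>?M) \<longlonglongrightarrow> (\<integral>z. ind z * (cmod (g z))\<^sup>2 \<partial>?M)"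
    by (rule integral_dominated_convergence[where w="\<lambda>_. B\<^sup>2", OF gm2 pm _ lim bnd]) simp
  then have sums: "(\<lambda>n. (cmod (b n))\<^sup>2 * \<rho> n) sums (\<integral>z. ind z * (cmod (g z))\<^sup>2 \<partial>?M)"
    by (simp add: part sums_def)
  have gi: "integrable ?M (\<lambda>z. ind z * (cmod (g z))\<^sup>2)"
    by (rule integrable_dominated_convergence[where w="\<lambda>_. B\<^sup>2", OF gm2 pm _ lim bnd]) simp
  have "(\<integral>\<^sup>+z. indicator (cball 0 r) z * ennreal ((cmod (g z))\<^sup>2) \<partial>?M)
      = (\<integral>\<^sup>+z. ennreal (ind z * (cmod (g z))\<^sup>2) \<partial>?M)"
    by (intro nn_integral_cong) (auto simp: ind_def indicator_def)
  also have "\<dots> = ennreal (\<integral>z. ind z * (cmod (g z))\<^sup>2 \<partial>?M)"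
    by (intro nn_integral_eq_integral gi AE_I2) (auto simp: ind_def)
  also have "\<dots> = (\<Sum>n. ennreal ((cmod (b n))\<^sup>2 * \<rho> n))"
    using \<rho>0 by (intro suminf_ennreal_eq[symmetric] sums) auto
  also have "\<dots> = (\<Sum>n. ennreal ((cmod (b n))\<^sup>2) * ennreal (\<rho> n))"
    by (simp add: ennreal_mult \<rho>0)
  also have "\<dots> = (\<Sum>n. ennreal ((cmod (b n))\<^sup>2) * (\<integral>\<^sup>+z. indicator (cball 0 r) z * ennreal ((cmod z)\<^sup>2 ^ n) \<partial>?M))"
  proof -
    have "ennreal (\<rho> n) = (\<integral>\<^sup>+z. indicator (cball 0 r) z * ennreal ((cmod z)\<^sup>2 ^ n) \<partial>?M)" for n
    proof -
      have "ennreal (\<rho> n) = (\<integral>\<^sup>+z. ennreal (ind z * (cmod z)\<^sup>2 ^ n) \<partial>?M)"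
        unfolding \<rho>_def by (intro nn_integral_eq_integral[symmetric] \<rho>i AE_I2) (auto simp: ind_def)
      also have "\<dots> = (\<integral>\<^sup>+z. indicator (cball 0 r) z * ennreal ((cmod z)\<^sup>2 ^ n) \<partial>?M)"
        by (intro nn_integral_cong) (auto simp: ind_def indicator_def)
      finally show ?thesis .
    qed
    then show ?thesis by simp
  qed
  finally show ?thesis by (simp add: b_def)
qed

text \<open>
  Both sides are increasing limits of their versions on smaller concentric disks.
\<close>

lemma bergman_parseval:
  assumes \<alpha>: "\<alpha> > -1" and g: "g holomorphic_on disk"
  shows "(\<integral>\<^sup>+z. ennreal ((cmod (g z))\<^sup>2) \<partial>weighted_area \<alpha>)
    = (\<Sum>n. ennreal ((cmod (taylor g n))\<^sup>2 * moment \<alpha> n))"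
proof -
  let ?M = "weighted_area \<alpha>"
  let ?r = "\<lambda>k. 1 - 1 / real (k + 2)"
  have gm: "(\<lambda>z. ennreal ((cmod (g z))\<^sup>2)) \<in> borel_measurable ?M"
    by (intro continuous_on_borel_measurable_weighted_area continuous_on_ennreal continuous_intros holomorphic_on_imp_continuous_on g)
  have zm: "(\<lambda>z. ennreal ((cmod z)\<^sup>2 ^ n)) \<in> borel_measurable ?M" for n
    by (intro continuous_on_borel_measurable_weighted_area continuous_on_ennreal continuous_intros)
  have "(\<integral>\<^sup>+z. ennreal ((cmod (g z))\<^sup>2) \<partial>?M)
      = (SUP k. \<Sum>n. ennreal ((cmod (taylor g n))\<^sup>2) * (\<integral>\<^sup>+z. indicator (cball 0 (?r k)) z * ennreal ((cmod z)\<^sup>2 ^ n) \<partial>?M))"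
    by (subst nn_integral_exhaust_disk[OF gm], subst nn_integral_cball_parseval[OF \<alpha> g]) auto
  also have "\<dots> = (\<Sum>n. SUP k. ennreal ((cmod (taylor g n))\<^sup>2) * (\<integral>\<^sup>+z. indicator (cball 0 (?r k)) z * ennreal ((cmod z)\<^sup>2 ^ n) \<partial>?M))"
  proof (rule ennreal_suminf_SUP_eq[symmetric], rule incseq_SucI)
    fix n k
    have "1 / real (Suc k + 2) \<le> 1 / real (k + 2)" by (simp add: field_simps)
    then have "cball 0 (?r k) \<subseteq> (cball 0 (?r (Suc k)) :: complex set)"
      by (intro subset_cball) linarith
    then show "ennreal ((cmod (taylor g n))\<^sup>2) * (\<integral>\<^sup>+z. indicator (cball 0 (?r k)) z * ennreal ((cmod z)\<^sup>2 ^ n) \<partial>?M)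
        \<le> ennreal ((cmod (taylor g n))\<^sup>2) * (\<integral>\<^sup>+z. indicator (cball 0 (?r (Suc k))) z * ennreal ((cmod z)\<^sup>2 ^ n) \<partial>?M)"
      by (intro mult_left_mono nn_integral_mono mult_right_mono) (auto simp: indicator_def)
  qed
  also have "\<dots> = (\<Sum>n. ennreal ((cmod (taylor g n))\<^sup>2) * (SUP k. \<integral>\<^sup>+z. indicator (cball 0 (?r k)) z * ennreal ((cmod z)\<^sup>2 ^ n) \<partial>?M))"
    by (subst SUP_mult_left_ennreal) simp
  also have "\<dots> = (\<Sum>n. ennreal ((cmod (taylor g n))\<^sup>2) * ennreal (moment \<alpha> n))"
    by (subst nn_integral_exhaust_disk[OF zm, symmetric], subst nn_integral_cmod_power[OF \<alpha>]) simp
  also have "\<dots> = (\<Sum>n. ennreal ((cmod (taylor g n))\<^sup>2 * moment \<alpha> n))"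
    using moment_pos[OF \<alpha>] by (simp add: ennreal_mult less_imp_le)
  finally show ?thesis .
qed

text \<open>
  The zeros of a power series with a nonvanishing coefficient are isolated, apart from the
  constant term, which is checked at the origin.
\<close>

lemma taylor_unique:
  assumes "\<And>z. z \<in> disk \<Longrightarrow> (\<lambda>n. a n * z ^ n) sums f z"
  shows "taylor f n = a n"
proof -
  have hol: "f holomorphic_on disk"
    by (rule power_series_holomorphic[of 0 1 a]) (use assms in auto)
  define d where "d n = taylor f n - a n" for n
  have d: "(\<lambda>n. d n * (z - 0) ^ n) sums 0" if "cmod (z - 0) < 1" for z
    using sums_diff[OF taylor_sums[OF hol, of z] assms[of z]] that by (simp add: d_def ring_distribs)
  have "d n = 0"
  proof (cases "n = 0")
    case True
    have "(\<lambda>n. d n * 0 ^ n) sums 0" using d[of 0] by simp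
    moreover have "(\<lambda>n. d n * 0 ^ n) sums d 0" by (rule powser_sums_zero)
    ultimately show ?thesis using True sums_unique2 by blast
  next
    case False
    show ?thesis
    proof (rule ccontr)
      assume "d n \<noteq> 0"
      then obtain s where s: "0 < s" "\<And>z. z \<in> cball 0 s - {0} \<Longrightarrow> (\<lambda>z::complex. 0::complex) z \<noteq> 0"
        using powser_0_nonzero[of 1 0 d "\<lambda>_. 0" n] d False by auto
      then show False using s(2)[of "of_real s"] by auto
    qed
  qed
  then show ?thesis by (simp add: d_def)
qed

lemma taylor_deriv: "taylor (deriv f) n = of_nat (Suc n) * taylor f (Suc n)"
proof -
  have "(deriv ^^ n) (deriv f) 0 = (deriv ^^ Suc n) f 0" by (simp add: funpow_Suc_right del: funpow.simps)
  then show ?thesis by (simp add: taylor_def del: of_nat_Suc funpow.simps)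
qed

lemma taylor_0 [simp]: "taylor f 0 = f 0"
  by (simp add: taylor_def)

lemma taylor_add:
  assumes "f holomorphic_on disk" "g holomorphic_on disk"
  shows "taylor (f + g) n = taylor f n + taylor g n"
  using higher_deriv_add[OF assms, of 0 n] by (simp add: taylor_def plus_fun_def add_divide_distrib)

lemma taylor_cmult:
  assumes "f holomorphic_on disk"
  shows "taylor (\<lambda>z. c * f z) n = c * taylor f n"
  using higher_deriv_cmult[OF assms, of 0 n c] by (simp add: taylor_def)

text \<open>
  The reciprocals of the moments are \<open>pochhammer (\<alpha> + 2) m / fact m\<close>, that is, the
  coefficients in the binomial series.
\<close>

lemma bergman_kernel_sums:
  assumes \<alpha>: "\<alpha> > -1" and x: "cmod x < 1"
  shows "(\<lambda>m. x ^ m / of_real (moment \<alpha> m)) sums ((1 - x) powr of_real (- (\<alpha> + 2)))"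
proof -
  have m: "1 / moment \<alpha> n = pochhammer (\<alpha> + 2) n / fact n" for n
  proof -
    have np: "\<alpha> + 2 \<notin> \<int>\<^sub>\<le>\<^sub>0" using \<alpha> by (auto simp: nonpos_Ints_def)
    have G2: "Gamma (\<alpha> + 2) = (\<alpha> + 1) * Gamma (\<alpha> + 1)"
      using Gamma_plus1[of "\<alpha> + 1"] \<alpha> by (simp add: nonpos_Ints_def add_ac)
    have G1: "Gamma (\<alpha> + 1) > 0" "Gamma (real n + \<alpha> + 2) > 0" using \<alpha> by (auto intro: Gamma_real_pos)
    have "1 / moment \<alpha> n = Gamma (real n + \<alpha> + 2) / ((1 + \<alpha>) * Gamma (\<alpha> + 1) * Gamma (real n + 1))"
      using G1 by (simp add: moment_def Beta_def add_ac mult_ac)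
    also have "\<dots> = Gamma (\<alpha> + 2 + real n) / Gamma (\<alpha> + 2) / fact n"
      by (simp add: G2 Gamma_fact[symmetric] add_ac mult_ac)
    also have "\<dots> = pochhammer (\<alpha> + 2) n / fact n"
      using pochhammer_Gamma[OF np, of n] by simp
    finally show ?thesis .
  qed
  have "(\<lambda>n. (of_real (- (\<alpha> + 2)) gchoose n) * (- x) ^ n) sums (1 + (- x)) powr of_real (- (\<alpha> + 2))"
    by (rule gen_binomial_complex) (use x in simp)
  moreover have "(of_real (- (\<alpha> + 2)) gchoose n) * (- x) ^ n = x ^ n / of_real (moment \<alpha> n)" for n
  proof -
    have "complex_of_real (- (\<alpha> + 2)) gchoose n = (- 1) ^ n * of_real (pochhammer (\<alpha> + 2) n / fact n)"
    proof -
      have e: "- complex_of_real (- (\<alpha> + 2)) = of_real (\<alpha> + 2)" by simp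
      show ?thesis unfolding gbinomial_pochhammer e
        by (simp only: pochhammer_of_real of_real_divide of_real_fact times_divide_eq_right)
    qed
    also have "pochhammer (\<alpha> + 2) n / fact n = 1 / moment \<alpha> n" by (rule m[symmetric])
    finally have "(complex_of_real (- (\<alpha> + 2)) gchoose n) * (- x) ^ n = ((- 1) * (- x)) ^ n * of_real (1 / moment \<alpha> n)"
      by (simp only: power_mult_distrib mult_ac)
    then show ?thesis by (simp add: divide_inverse)
  qed
  ultimately show ?thesis by simp
qed

section \<open>Coordinates on the weighted Dirichlet space\<close>

abbreviation (input) fscale :: "complex \<Rightarrow> (complex \<Rightarrow> complex) \<Rightarrow> (complex \<Rightarrow> complex)" where
  "fscale \<equiv> \<lambda>c f z. c * f z"

text \<open>
  Functions in the space are handled through their coordinates with respect to the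
  normalised monomials. In these coordinates the space is the space of square-summable
  sequences.
\<close>

locale weighted_dirichlet =
  fixes \<alpha> :: real
  assumes \<alpha>: "\<alpha> > -1"
begin

abbreviation D where "D \<equiv> dirichlet_space \<alpha>"
abbreviation ip where "ip \<equiv> dirichlet_inner \<alpha>"
abbreviation nrm where "nrm \<equiv> dirichlet_norm \<alpha>"

text \<open>
  The squared norm of the monomial of degree \<open>n\<close>.
\<close>

definition wt :: "nat \<Rightarrow> real" where
  "wt n = (if n = 0 then 1 else (real n)\<^sup>2 * moment \<alpha> (n - 1))"

definition coord :: "(complex \<Rightarrow> complex) \<Rightarrow> nat \<Rightarrow> complex" where
  "coord f n = of_real (sqrt (wt n)) * taylor f n"

lemma wt_pos: "wt n > 0"
  using moment_pos[OF \<alpha>] by (simp add: wt_def)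

lemma coord_0 [simp]: "coord f 0 = f 0"
  by (simp add: coord_def wt_def)

lemma cmod_coord_sq: "(cmod (coord f n))\<^sup>2 = wt n * (cmod (taylor f n))\<^sup>2"
  using wt_pos[of n] by (simp add: coord_def norm_mult power_mult_distrib)

lemma D_holomorphic: "f \<in> D \<Longrightarrow> f holomorphic_on disk"
  by (simp add: dirichlet_space_def)

lemma D_outside: "f \<in> D \<Longrightarrow> z \<notin> disk \<Longrightarrow> f z = 0"
  by (simp add: dirichlet_space_def)

lemma deriv_measurable:
  assumes "f holomorphic_on disk"
  shows "deriv f \<in> borel_measurable (weighted_area \<alpha>)"
  by (intro continuous_on_borel_measurable_weighted_area holomorphic_on_imp_continuous_on
      holomorphic_deriv[OF assms] open_ball)

lemma nn_integral_deriv: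
  assumes "f holomorphic_on disk"
  shows "(\<integral>\<^sup>+z. ennreal ((cmod (deriv f z))\<^sup>2) \<partial>weighted_area \<alpha>) = (\<Sum>n. ennreal ((cmod (coord f (Suc n)))\<^sup>2))"
proof -
  have "(cmod (taylor (deriv f) n))\<^sup>2 * moment \<alpha> n = (cmod (coord f (Suc n)))\<^sup>2" for n
    by (simp add: cmod_coord_sq taylor_deriv wt_def norm_mult power_mult_distrib del: of_nat_Suc)
  then show ?thesis
    using bergman_parseval[OF \<alpha> holomorphic_deriv[OF assms open_ball]] by simp
qed

lemma D_iff:
  "f \<in> D \<longleftrightarrow> f holomorphic_on disk \<and> (\<forall>z. z \<notin> disk \<longrightarrow> f z = 0) \<and> summable (\<lambda>n. (cmod (coord f n))\<^sup>2)"
proof -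
  have "integrable (weighted_area \<alpha>) (\<lambda>z. (cmod (deriv f z))\<^sup>2) \<longleftrightarrow> summable (\<lambda>n. (cmod (coord f (Suc n)))\<^sup>2)"
    if f: "f holomorphic_on disk"
  proof -
    have "integrable (weighted_area \<alpha>) (\<lambda>z. (cmod (deriv f z))\<^sup>2) \<longleftrightarrow>
      (\<integral>\<^sup>+z. ennreal ((cmod (deriv f z))\<^sup>2) \<partial>weighted_area \<alpha>) < \<infinity>"
      using deriv_measurable[OF f] by (simp add: integrable_iff_bounded)
    also have "\<dots> \<longleftrightarrow> (\<Sum>n. ennreal ((cmod (coord f (Suc n)))\<^sup>2)) \<noteq> top"
      by (simp add: nn_integral_deriv[OF f] less_top)
    also have "\<dots> \<longleftrightarrow> summable (\<lambda>n. (cmod (coord f (Suc n)))\<^sup>2)"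
      by (rule iffI, rule summable_suminf_not_top, simp, assumption, rule ennreal_suminf_neq_top, assumption, simp)
    finally show ?thesis .
  qed
  then show ?thesis unfolding dirichlet_space_def using summable_Suc_iff[of "\<lambda>n. (cmod (coord f n))\<^sup>2"] by auto
qed

lemma nrm_nonneg [simp]: "0 \<le> nrm f"
  unfolding dirichlet_norm_def by simp

lemma nrm_sq: "(nrm f)\<^sup>2 = (cmod (f 0))\<^sup>2 + (\<integral>z. (cmod (deriv f z))\<^sup>2 \<partial>weighted_area \<alpha>)"
  unfolding dirichlet_norm_def by simp

lemma coord_sq_sums:
  assumes "f \<in> D"
  shows "(\<lambda>n. (cmod (coord f n))\<^sup>2) sums (nrm f)\<^sup>2"
proof -
  have f: "f holomorphic_on disk" by (rule D_holomorphic[OF assms])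
  have s: "summable (\<lambda>n. (cmod (coord f (Suc n)))\<^sup>2)"
    using assms summable_Suc_iff[of "\<lambda>n. (cmod (coord f n))\<^sup>2"] by (simp add: D_iff)
  have "(\<integral>z. (cmod (deriv f z))\<^sup>2 \<partial>weighted_area \<alpha>) = enn2real (\<integral>\<^sup>+z. ennreal ((cmod (deriv f z))\<^sup>2) \<partial>weighted_area \<alpha>)"
    using deriv_measurable[OF f] by (intro integral_eq_nn_integral) auto
  also have "\<dots> = (\<Sum>n. (cmod (coord f (Suc n)))\<^sup>2)"
    using s by (simp add: nn_integral_deriv[OF f] suminf_ennreal2 suminf_nonneg)
  finally have "(nrm f)\<^sup>2 = (\<Sum>n. (cmod (coord f (Suc n)))\<^sup>2) + (cmod (coord f 0))\<^sup>2"
    by (simp add: nrm_sq)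
  moreover have "(\<lambda>n. (cmod (coord f n))\<^sup>2) sums ((\<Sum>n. (cmod (coord f (Suc n)))\<^sup>2) + (cmod (coord f 0))\<^sup>2)"
    by (rule sums_Suc[OF summable_sums[OF s]])
  ultimately show ?thesis by simp
qed

lemma coord_add: "f holomorphic_on disk \<Longrightarrow> g holomorphic_on disk \<Longrightarrow> coord (f + g) n = coord f n + coord g n"
  by (simp add: coord_def taylor_add ring_distribs)

lemma coord_scale: "f holomorphic_on disk \<Longrightarrow> coord (fscale c f) n = c * coord f n"
  by (simp add: coord_def taylor_cmult)

lemma D_add:
  assumes "f \<in> D" "g \<in> D"
  shows "f + g \<in> D"
proof -
  have "summable (\<lambda>n. (cmod (coord f n + coord g n))\<^sup>2)"
  proof (rule summable_comparison_test')
    show "summable (\<lambda>n. 2 * (cmod (coord f n))\<^sup>2 + 2 * (cmod (coord g n))\<^sup>2)"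
      using assms by (intro summable_add summable_mult) (auto simp: D_iff)
    fix n
    have "(cmod (coord f n + coord g n))\<^sup>2 \<le> (cmod (coord f n) + cmod (coord g n))\<^sup>2"
      by (intro power_mono norm_triangle_ineq) auto
    also have "\<dots> \<le> 2 * (cmod (coord f n))\<^sup>2 + 2 * (cmod (coord g n))\<^sup>2"
      using sum_squares_bound[of "cmod (coord f n)" "cmod (coord g n)"] by (simp add: power2_sum)
    finally show "norm ((cmod (coord f n + coord g n))\<^sup>2) \<le> 2 * (cmod (coord f n))\<^sup>2 + 2 * (cmod (coord g n))\<^sup>2" by simp
  qed
  moreover have "(f + g) holomorphic_on disk"
    using assms by (simp add: D_iff plus_fun_def holomorphic_on_add)
  ultimately show ?thesis using assms by (simp add: D_iff coord_add)
qed

lemma D_scale: "f \<in> D \<Longrightarrow> fscale c f \<in> D"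
  by (auto simp: D_iff coord_scale norm_mult power_mult_distrib intro: summable_mult holomorphic_intros)

lemma D_zero: "0 \<in> D"
proof -
  have "coord (\<lambda>z. 0) n = 0" for n
    using coord_scale[of "\<lambda>z. 0" 0 n] by simp
  then show ?thesis by (simp add: D_iff zero_fun_def)
qed

lemma D_diff:
  assumes "f \<in> D" "g \<in> D"
  shows "f - g \<in> D"
proof -
  have "f - g = f + fscale (-1) g" by (simp add: fun_eq_iff)
  then show ?thesis using assms D_add D_scale by metis
qed

lemma coord_diff: "f \<in> D \<Longrightarrow> g \<in> D \<Longrightarrow> coord (f - g) n = coord f n - coord g n"
proof -
  assume "f \<in> D" "g \<in> D"
  moreover have "f - g = f + fscale (-1) g" by (simp add: fun_eq_iff)
  ultimately show ?thesis
    using coord_add[of f "fscale (-1) g" n] coord_scale[of g "-1" n] D_holomorphic D_scale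
    by (metis add_uminus_conv_diff mult_minus1)
qed

lemma D_sum: "(\<And>i. i \<in> I \<Longrightarrow> f i \<in> D) \<Longrightarrow> sum f I \<in> D"
  by (induction I rule: infinite_finite_induct) (auto simp: D_zero D_add)

lemma coord_zero: "coord 0 n = 0"
  using coord_diff[OF D_zero D_zero, of n] by simp

lemma coord_sum: "(\<And>i. i \<in> I \<Longrightarrow> f i \<in> D) \<Longrightarrow> coord (sum f I) n = (\<Sum>i\<in>I. coord (f i) n)"
  by (induction I rule: infinite_finite_induct) (auto simp: coord_zero coord_add D_sum D_holomorphic)

text \<open>
  Parseval's formula for the inner product follows from the one for the norm by polarisation,
  applied both to the derivatives under the integral and to the coordinates.
\<close>

lemma ip_sums:
  assumes f: "f \<in> D" and g: "g \<in> D"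
  shows "(\<lambda>n. coord f n * cnj (coord g n)) sums ip f g"
proof -
  let ?M = "weighted_area \<alpha>"
  have pol: "4 * (a * cnj b) = of_real ((cmod (a + 1 * b))\<^sup>2) - of_real ((cmod (a + (-1) * b))\<^sup>2)
      + \<i> * of_real ((cmod (a + \<i> * b))\<^sup>2) - \<i> * of_real ((cmod (a + (-\<i>) * b))\<^sup>2)" for a b :: complex
    by (cases a; cases b) (simp add: complex_eq_iff cmod_power2, simp add: power2_eq_square algebra_simps)
  \<comment> \<open>polarisation over the fourth roots of unity\<close>
  define h where "h c = f + fscale c g" for c
  have h: "h c \<in> D" for c unfolding h_def by (intro D_add D_scale f g)
  have dh: "deriv (h c) z = deriv f z + c * deriv g z" if "z \<in> disk" for c z
  proof -
    have "(f has_field_derivative deriv f z) (at z)" "(g has_field_derivative deriv g z) (at z)"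
      using holomorphic_derivI[OF D_holomorphic open_ball that] f g by auto
    then have "(h c has_field_derivative deriv f z + c * deriv g z) (at z)"
      unfolding h_def plus_fun_def by (auto intro!: derivative_eq_intros)
    then show ?thesis by (rule DERIV_imp_deriv)
  qed
  have hint: "integrable ?M (\<lambda>z. (cmod (deriv (h c) z))\<^sup>2)" for c
    using h[of c] by (simp add: dirichlet_space_def)
  have int: "4 * (\<integral>z. deriv f z * cnj (deriv g z) \<partial>?M)
      = of_real (\<integral>z. (cmod (deriv (h 1) z))\<^sup>2 \<partial>?M) - of_real (\<integral>z. (cmod (deriv (h (-1)) z))\<^sup>2 \<partial>?M)
      + \<i> * of_real (\<integral>z. (cmod (deriv (h \<i>) z))\<^sup>2 \<partial>?M) - \<i> * of_real (\<integral>z. (cmod (deriv (h (-\<i>)) z))\<^sup>2 \<partial>?M)"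
  proof -
    let ?I = "\<lambda>c. complex_of_real (\<integral>z. (cmod (deriv (h c) z))\<^sup>2 \<partial>?M)"
    have hb: "has_bochner_integral ?M (\<lambda>z. complex_of_real ((cmod (deriv (h c) z))\<^sup>2)) (?I c)" for c
      by (intro has_bochner_integral_of_real has_bochner_integral_integrable hint)
    have "has_bochner_integral ?M (\<lambda>z. of_real ((cmod (deriv (h 1) z))\<^sup>2) - of_real ((cmod (deriv (h (-1)) z))\<^sup>2)
      + \<i> * of_real ((cmod (deriv (h \<i>) z))\<^sup>2) - \<i> * of_real ((cmod (deriv (h (-\<i>)) z))\<^sup>2))
      (?I 1 - ?I (-1) + \<i> * ?I \<i> - \<i> * ?I (-\<i>))"
      by (intro has_bochner_integral_add has_bochner_integral_diff has_bochner_integral_mult_right hb)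
    then have "(\<integral>z. of_real ((cmod (deriv (h 1) z))\<^sup>2) - of_real ((cmod (deriv (h (-1)) z))\<^sup>2)
      + \<i> * of_real ((cmod (deriv (h \<i>) z))\<^sup>2) - \<i> * of_real ((cmod (deriv (h (-\<i>)) z))\<^sup>2) \<partial>?M)
      = ?I 1 - ?I (-1) + \<i> * ?I \<i> - \<i> * ?I (-\<i>)" by (rule has_bochner_integral_integral_eq)
    moreover have "(\<integral>z. 4 * (deriv f z * cnj (deriv g z)) \<partial>?M)
      = (\<integral>z. of_real ((cmod (deriv (h 1) z))\<^sup>2) - of_real ((cmod (deriv (h (-1)) z))\<^sup>2)
      + \<i> * of_real ((cmod (deriv (h \<i>) z))\<^sup>2) - \<i> * of_real ((cmod (deriv (h (-\<i>)) z))\<^sup>2) \<partial>?M)"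
      by (intro Bochner_Integration.integral_cong refl) (simp only: pol dh space_weighted_area)
    ultimately show ?thesis by (simp only: integral_mult_right_zero)
  qed
  have "4 * ip f g = of_real ((nrm (h 1))\<^sup>2) - of_real ((nrm (h (-1)))\<^sup>2)
      + \<i> * of_real ((nrm (h \<i>))\<^sup>2) - \<i> * of_real ((nrm (h (-\<i>)))\<^sup>2)"
    unfolding dirichlet_inner_def distrib_left int pol[of "f 0" "g 0"] nrm_sq
    by (simp only: h_def plus_fun_apply of_real_add) (simp add: algebra_simps)
  moreover have "(\<lambda>n. of_real ((cmod (coord (h 1) n))\<^sup>2) - of_real ((cmod (coord (h (-1)) n))\<^sup>2)
      + \<i> * of_real ((cmod (coord (h \<i>) n))\<^sup>2) - \<i> * of_real ((cmod (coord (h (-\<i>)) n))\<^sup>2)) sums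
     (of_real ((nrm (h 1))\<^sup>2) - of_real ((nrm (h (-1)))\<^sup>2)
      + \<i> * of_real ((nrm (h \<i>))\<^sup>2) - \<i> * of_real ((nrm (h (-\<i>)))\<^sup>2))"
    by (intro sums_add sums_diff sums_mult sums_of_real coord_sq_sums h)
  moreover have "coord (h c) n = coord f n + c * coord g n" for c n
    using f g by (simp add: h_def coord_add coord_scale D_holomorphic D_scale)
  ultimately have "(\<lambda>n. 4 * (coord f n * cnj (coord g n))) sums (4 * ip f g)"
    by (simp only: pol)
  from sums_mult[OF this, of "1/4"] show ?thesis by simp
qed

lemma D_eqI:
  assumes "f \<in> D" "g \<in> D" "\<And>n. coord f n = coord g n"
  shows "f = g"
proof
  fix z
  have "taylor f n = taylor g n" for n
    using assms(3)[of n] wt_pos[of n] by (simp add: coord_def)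
  then have eq: "taylor f = taylor g" by blast
  show "f z = g z"
  proof (cases "z \<in> disk")
    case True
    show ?thesis
      using sums_unique2[OF taylor_sums[OF D_holomorphic[OF assms(1)] True, unfolded eq]
        taylor_sums[OF D_holomorphic[OF assms(2)] True]] .
  next
    case False
    then show ?thesis using D_outside[OF assms(1) False] D_outside[OF assms(2) False] by simp
  qed
qed

lemma wt_ge_moment: "wt (Suc n) \<ge> moment \<alpha> n"
proof -
  have "1 * moment \<alpha> n \<le> (real (Suc n))\<^sup>2 * moment \<alpha> n"
    using moment_pos[OF \<alpha>, of n] by (intro mult_right_mono) auto
  then show ?thesis by (simp add: wt_def)
qed

lemma summable_inverse_moment:
  assumes "0 \<le> r" "r < 1"
  shows "summable (\<lambda>n. r ^ n / moment \<alpha> n)"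
proof -
  have c: "cmod (of_real r :: complex) < 1" using assms by simp
  have "summable (\<lambda>m. (of_real r :: complex) ^ m / of_real (moment \<alpha> m))"
    using bergman_kernel_sums[OF \<alpha> c] sums_summable by blast
  then have "summable (\<lambda>m. complex_of_real (r ^ m / moment \<alpha> m))" by simp
  then show ?thesis by (simp only: summable_of_real_iff)
qed

text \<open>
  The weights do not decay geometrically; this is what makes every square-summable
  coordinate sequence belong to a power series that converges in the whole disk.
\<close>

lemma summable_inverse_wt:
  assumes "0 \<le> r" "r < 1"
  shows "summable (\<lambda>n. r ^ n / wt n)"
proof -
  note s = summable_inverse_moment[OF assms]
  have "summable (\<lambda>n. r ^ Suc n / wt (Suc n))"
  proof (rule summable_comparison_test'[OF s])
    fix n
    have "r ^ Suc n / wt (Suc n) \<le> r ^ n / moment \<alpha> n"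
      using assms wt_ge_moment[of n] moment_pos[OF \<alpha>, of n]
      by (intro frac_le) (auto intro: mult_left_le_one_le)
    then show "norm (r ^ Suc n / wt (Suc n)) \<le> r ^ n / moment \<alpha> n"
      using assms wt_pos[of "Suc n"] by simp
  qed
  then show ?thesis using summable_Suc_iff[of "\<lambda>n. r ^ n / wt n"] by simp
qed

text \<open>
  Completeness of the space, in coordinates.
\<close>

lemma D_synthesis:
  assumes b: "summable (\<lambda>n. (cmod (b n))\<^sup>2)"
  obtains f where "f \<in> D" "\<And>n. coord f n = b n"
proof -
  define a where "a n = b n / of_real (sqrt (wt n))" for n
  have s: "summable (\<lambda>n. a n * z ^ n)" if z: "z \<in> disk" for z
  proof (rule summable_comparison_test')
    show "summable (\<lambda>n. (cmod (b n))\<^sup>2 + ((cmod z)\<^sup>2) ^ n / wt n)"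
      using z by (intro summable_add b summable_inverse_wt) (auto simp: power_less_one_iff)
    fix n
    have e: "cmod (a n * z ^ n) = cmod (b n) * (cmod z ^ n / sqrt (wt n))"
      using wt_pos[of n] by (simp add: a_def norm_mult norm_divide norm_power)
    have "0 \<le> cmod (b n) * (cmod z ^ n / sqrt (wt n))" using wt_pos[of n] by simp
    then have "cmod (b n) * (cmod z ^ n / sqrt (wt n)) \<le> (cmod (b n))\<^sup>2 + (cmod z ^ n / sqrt (wt n))\<^sup>2"
      using sum_squares_bound[of "cmod (b n)" "cmod z ^ n / sqrt (wt n)"] by linarith
    also have "(cmod z ^ n / sqrt (wt n))\<^sup>2 = ((cmod z)\<^sup>2) ^ n / wt n"
      using wt_pos[of n] by (simp add: power_divide power_mult[symmetric] mult.commute)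
    finally show "cmod (a n * z ^ n) \<le> (cmod (b n))\<^sup>2 + ((cmod z)\<^sup>2) ^ n / wt n" by (simp only: e)
  qed
  define f where "f z = (if z \<in> disk then \<Sum>n. a n * z ^ n else 0)" for z
  have sf: "(\<lambda>n. a n * z ^ n) sums f z" if "z \<in> disk" for z
    using s[OF that] that by (simp add: f_def summable_sums)
  have hol: "f holomorphic_on disk"
    by (rule power_series_holomorphic[of 0 1 a]) (use sf in auto)
  have "taylor f n = a n" for n by (rule taylor_unique[OF sf])
  then have c: "coord f n = b n" for n
    using wt_pos[of n] by (simp add: coord_def a_def)
  moreover have "f \<in> D" using hol b by (simp add: D_iff c) (simp add: f_def)
  ultimately show ?thesis using that by blast
qed

section \<open>Hilbert space geometry\<close>

lemma sum_coord_sq_le: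
  assumes "f \<in> D" "finite A"
  shows "(\<Sum>k\<in>A. (cmod (coord f k))\<^sup>2) \<le> (nrm f)\<^sup>2"
proof -
  have "(\<Sum>k\<in>A. (cmod (coord f k))\<^sup>2) \<le> (\<Sum>k. (cmod (coord f k))\<^sup>2)"
    by (rule sum_le_suminf[OF sums_summable[OF coord_sq_sums[OF assms(1)]] assms(2)]) simp
  also have "\<dots> = (nrm f)\<^sup>2" by (rule sums_unique[OF coord_sq_sums[OF assms(1)], symmetric])
  finally show ?thesis .
qed

lemma ip_add_left:
  assumes "f \<in> D" "g \<in> D" "h \<in> D"
  shows "ip (f + g) h = ip f h + ip g h"
proof (rule sums_unique2[OF ip_sums])
  show "(\<lambda>n. coord (f + g) n * cnj (coord h n)) sums (ip f h + ip g h)"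
    using sums_add[OF ip_sums[OF assms(1,3)] ip_sums[OF assms(2,3)]] assms
    by (simp add: coord_add D_holomorphic ring_distribs)
qed (use assms D_add in auto)

lemma ip_scale_left:
  assumes "f \<in> D" "h \<in> D"
  shows "ip (fscale c f) h = c * ip f h"
proof (rule sums_unique2[OF ip_sums])
  show "(\<lambda>n. coord (fscale c f) n * cnj (coord h n)) sums (c * ip f h)"
    using sums_mult[OF ip_sums[OF assms], of c] assms
    by (simp add: coord_scale D_holomorphic mult_ac)
qed (use assms D_scale in auto)

lemma ip_cnj:
  assumes "f \<in> D" "g \<in> D"
  shows "ip g f = cnj (ip f g)"
proof (rule sums_unique2[OF ip_sums])
  have "(\<lambda>n. cnj (coord f n * cnj (coord g n))) sums cnj (ip f g)"
    using ip_sums[OF assms] by (simp only: sums_cnj)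
  then show "(\<lambda>n. coord g n * cnj (coord f n)) sums cnj (ip f g)" by (simp add: mult.commute)
qed (use assms in auto)

lemma ip_add_right:
  assumes "f \<in> D" "g \<in> D" "h \<in> D"
  shows "ip h (f + g) = ip h f + ip h g"
  using assms ip_add_left[OF assms] by (simp add: ip_cnj[of "f + g" h] ip_cnj[of f h] ip_cnj[of g h] D_add)

lemma ip_scale_right:
  assumes "f \<in> D" "h \<in> D"
  shows "ip h (fscale c f) = cnj c * ip h f"
  using assms by (simp add: ip_cnj[of "fscale c f" h] ip_cnj[of f h] D_scale ip_scale_left)

lemma ip_diff_left:
  assumes "f \<in> D" "g \<in> D" "h \<in> D"
  shows "ip (f - g) h = ip f h - ip g h"
proof -
  have e: "f - g = f + fscale (-1) g" by (simp add: fun_eq_iff)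
  show ?thesis unfolding e
    by (simp only: ip_add_left[OF assms(1) D_scale[OF assms(2)] assms(3)] ip_scale_left[OF assms(2,3)]) simp
qed

lemma ip_diff_right:
  assumes "f \<in> D" "g \<in> D" "h \<in> D"
  shows "ip h (f - g) = ip h f - ip h g"
  using assms ip_diff_left[OF assms] by (simp add: ip_cnj[of "f - g" h] ip_cnj[of f h] ip_cnj[of g h] D_diff)

lemma ip_zero_left: "h \<in> D \<Longrightarrow> ip 0 h = 0"
  using ip_diff_left[OF D_zero D_zero, of h] by simp

lemma ip_sum_left:
  assumes "\<And>i. i \<in> I \<Longrightarrow> f i \<in> D" "h \<in> D"
  shows "ip (sum f I) h = (\<Sum>i\<in>I. ip (f i) h)"
  using assms(1) by (induction I rule: infinite_finite_induct) (auto simp: ip_zero_left ip_add_left D_sum assms(2))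

lemma ip_sum_right:
  assumes "\<And>i. i \<in> I \<Longrightarrow> f i \<in> D" "h \<in> D"
  shows "ip h (sum f I) = (\<Sum>i\<in>I. ip h (f i))"
proof -
  have "ip h (sum f I) = cnj (\<Sum>i\<in>I. ip (f i) h)"
    using assms by (simp add: ip_cnj[of "sum f I" h] D_sum ip_sum_left)
  also have "\<dots> = (\<Sum>i\<in>I. ip h (f i))"
    unfolding cnj_sum using assms by (intro sum.cong refl ip_cnj[symmetric]) auto
  finally show ?thesis .
qed

lemma ip_self:
  assumes "f \<in> D"
  shows "ip f f = of_real ((nrm f)\<^sup>2)"
proof (rule sums_unique2[OF ip_sums[OF assms assms]])
  have "complex_of_real ((cmod (coord f n))\<^sup>2) = coord f n * cnj (coord f n)" for n
    by (rule complex_norm_square)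
  then show "(\<lambda>n. coord f n * cnj (coord f n)) sums of_real ((nrm f)\<^sup>2)"
    using sums_of_real[OF coord_sq_sums[OF assms], where ?'a=complex] by (simp only:)
qed

lemma cmod_ip_le:
  assumes f: "f \<in> D" and g: "g \<in> D"
  shows "cmod (ip f g) \<le> nrm f * nrm g"
proof (rule LIMSEQ_le_const2)
  show "(\<lambda>N. cmod (\<Sum>n<N. coord f n * cnj (coord g n))) \<longlonglongrightarrow> cmod (ip f g)"
    using ip_sums[OF f g] by (intro tendsto_norm) (simp add: sums_def)
  have *: "L2_set (\<lambda>n. cmod (coord h n)) {..<N} \<le> nrm h" if "h \<in> D" for h N
  proof -
    have "sqrt (\<Sum>n<N. (cmod (coord h n))\<^sup>2) \<le> sqrt ((nrm h)\<^sup>2)"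
      by (intro real_sqrt_le_mono sum_coord_sq_le that) simp
    then show ?thesis by (simp add: L2_set_def)
  qed
  have "cmod (\<Sum>n<N. coord f n * cnj (coord g n)) \<le> nrm f * nrm g" for N
  proof -
    have "cmod (\<Sum>n<N. coord f n * cnj (coord g n)) \<le> (\<Sum>n<N. \<bar>cmod (coord f n)\<bar> * \<bar>cmod (coord g n)\<bar>)"
      by (rule order_trans[OF norm_sum]) (simp add: norm_mult)
    also have "\<dots> \<le> L2_set (\<lambda>n. cmod (coord f n)) {..<N} * L2_set (\<lambda>n. cmod (coord g n)) {..<N}"
      by (rule L2_set_mult_ineq)
    also have "\<dots> \<le> nrm f * nrm g"
      using *[OF f] *[OF g] by (intro mult_mono) (auto simp: L2_set_nonneg)
    finally show ?thesis .
  qed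
  then show "\<exists>N. \<forall>n\<ge>N. cmod (\<Sum>n<n. coord f n * cnj (coord g n)) \<le> nrm f * nrm g" by blast
qed

lemma nrm_scale: "f \<in> D \<Longrightarrow> nrm (fscale c f) = cmod c * nrm f"
proof -
  assume f: "f \<in> D"
  have "complex_of_real ((nrm (fscale c f))\<^sup>2) = (c * cnj c) * ip f f"
    by (simp only: ip_self[OF D_scale[OF f], symmetric] ip_scale_left[OF f D_scale[OF f]] ip_scale_right[OF f f] mult.assoc)
  also have "\<dots> = of_real ((cmod c * nrm f)\<^sup>2)"
    by (simp only: complex_norm_square[symmetric] ip_self[OF f] of_real_mult of_real_power power_mult_distrib)
  finally have "complex_of_real ((nrm (fscale c f))\<^sup>2) = of_real ((cmod c * nrm f)\<^sup>2)" .
  then have "(nrm (fscale c f))\<^sup>2 = (cmod c * nrm f)\<^sup>2" by (simp only: of_real_eq_iff)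
  then show ?thesis by (simp add: power2_eq_iff_nonneg)
qed

lemma nrm_triangle:
  assumes f: "f \<in> D" and g: "g \<in> D"
  shows "nrm (f + g) \<le> nrm f + nrm g"
proof -
  have "complex_of_real ((nrm (f + g))\<^sup>2) = of_real ((nrm f)\<^sup>2) + (ip f g + cnj (ip f g)) + of_real ((nrm g)\<^sup>2)"
    using f g ip_self[OF f] ip_self[OF g] ip_self[OF D_add[OF f g]]
    by (simp add: ip_add_left ip_add_right D_add ip_cnj[of f g] add_ac)
  also have "ip f g + cnj (ip f g) = of_real (2 * Re (ip f g))" by (simp add: complex_add_cnj)
  finally have "(nrm (f + g))\<^sup>2 = (nrm f)\<^sup>2 + 2 * Re (ip f g) + (nrm g)\<^sup>2"
    by (simp only: of_real_add[symmetric] of_real_eq_iff)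
  also have "\<dots> \<le> (nrm f)\<^sup>2 + 2 * (nrm f * nrm g) + (nrm g)\<^sup>2"
    using cmod_ip_le[OF f g] complex_Re_le_cmod[of "ip f g"] by linarith
  also have "\<dots> = (nrm f + nrm g)\<^sup>2" by (simp add: power2_sum)
  finally show ?thesis by (rule power2_le_imp_le) simp
qed

lemma nrm_zero: "nrm 0 = 0"
  using nrm_scale[OF D_zero, of 0] by (simp add: zero_fun_def)

lemma cmod_coord_le: "f \<in> D \<Longrightarrow> cmod (coord f n) \<le> nrm f"
proof -
  assume f: "f \<in> D"
  have "(\<Sum>k\<in>{n}. (cmod (coord f k))\<^sup>2) \<le> (nrm f)\<^sup>2" by (rule sum_coord_sq_le[OF f]) simp
  then show ?thesis by (auto intro: power2_le_imp_le[of "cmod (coord f n)"])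
qed

lemma nrm_eq_0_iff: "f \<in> D \<Longrightarrow> nrm f = 0 \<longleftrightarrow> f = 0"
proof
  assume f: "f \<in> D" and "nrm f = 0"
  then have "coord f n = 0" for n using cmod_coord_le[OF f, of n] by simp
  then show "f = 0" by (intro D_eqI f D_zero) (simp add: coord_zero)
qed (simp add: nrm_zero)

lemma ip_right_eqI:
  assumes "g \<in> D" "h \<in> D" "\<And>f. f \<in> D \<Longrightarrow> ip f g = ip f h"
  shows "g = h"
proof -
  have d: "g - h \<in> D" using assms D_diff by blast
  then have "ip (g - h) (g - h) = 0" using assms by (simp add: ip_diff_right)
  then have "nrm (g - h) = 0" by (simp add: ip_self[OF d])
  then show ?thesis using nrm_eq_0_iff[OF d] by simp
qed

section \<open>The orthonormal basis of monomials\<close>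

definition basis :: "nat \<Rightarrow> complex \<Rightarrow> complex" where
  "basis n z = (if z \<in> disk then z ^ n / of_real (sqrt (wt n)) else 0)"

lemma coord_basis: "coord (basis n) m = (if m = n then 1 else 0)"
proof -
  have "taylor (basis n) m = (if m = n then 1 / of_real (sqrt (wt n)) else 0)"
  proof (rule taylor_unique)
    fix z :: complex assume "z \<in> disk"
    have "(\<lambda>m. if m = n then z ^ n / of_real (sqrt (wt n)) else 0) sums (z ^ n / of_real (sqrt (wt n)))"
      by (rule sums_single)
    also have "(\<lambda>m. if m = n then z ^ n / of_real (sqrt (wt n)) else 0)
        = (\<lambda>m. (if m = n then 1 / of_real (sqrt (wt n)) else 0) * z ^ m)" by auto
    finally show "(\<lambda>m. (if m = n then 1 / of_real (sqrt (wt n)) else 0) * z ^ m) sums basis n z"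
      using \<open>z \<in> disk\<close> by (simp add: basis_def)
  qed
  then show ?thesis using wt_pos[of n] by (simp add: coord_def)
qed

lemma basis_D [simp]: "basis n \<in> D"
proof -
  have "(\<lambda>z. z ^ n / complex_of_real (sqrt (wt n))) holomorphic_on disk"
    using wt_pos[of n] by (intro holomorphic_intros) auto
  then have "basis n holomorphic_on disk"
    by (rule holomorphic_transform) (simp add: basis_def)
  moreover have "(\<lambda>m. (cmod (coord (basis n) m))\<^sup>2) = (\<lambda>m. if m = n then 1 else 0)"
    by (auto simp: coord_basis)
  ultimately show ?thesis by (auto simp: D_iff basis_def)
qed

definition partial :: "(nat \<Rightarrow> complex) \<Rightarrow> nat \<Rightarrow> complex \<Rightarrow> complex" where
  "partial x N = (\<Sum>k<N. fscale (x k) (basis k))"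

lemma partial_D [simp]: "partial x N \<in> D"
  unfolding partial_def by (intro D_sum D_scale basis_D)

lemma coord_partial: "coord (partial x N) n = (if n < N then x n else 0)"
  unfolding partial_def
  by (subst coord_sum) (auto simp: D_scale coord_scale D_holomorphic coord_basis if_distrib[of "\<lambda>c. _ * c"] cong: if_cong)

lemma nrm_partial: "(nrm (partial x N))\<^sup>2 = (\<Sum>k<N. (cmod (x k))\<^sup>2)"
proof (rule sums_unique2[OF coord_sq_sums[OF partial_D]])
  have "(\<lambda>n. if n \<in> {..<N} then (cmod (x n))\<^sup>2 else 0) sums (\<Sum>k<N. (cmod (x k))\<^sup>2)"
    by (rule sums_If_finite_set) simp
  also have "(\<lambda>n. if n \<in> {..<N} then (cmod (x n))\<^sup>2 else 0) = (\<lambda>n. (cmod (coord (partial x N) n))\<^sup>2)"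
    by (auto simp: coord_partial)
  finally show "(\<lambda>n. (cmod (coord (partial x N) n))\<^sup>2) sums (\<Sum>k<N. (cmod (x k))\<^sup>2)" .
qed

lemma partial_tendsto:
  assumes f: "f \<in> D"
  shows "(\<lambda>N. nrm (f - partial (coord f) N)) \<longlonglongrightarrow> 0"
proof -
  have e: "(nrm (f - partial (coord f) N))\<^sup>2 = (nrm f)\<^sup>2 - (\<Sum>k<N. (cmod (coord f k))\<^sup>2)" for N
  proof (rule sums_unique2[OF coord_sq_sums])
    have "(\<lambda>n. (cmod (coord f n))\<^sup>2 - (cmod (coord (partial (coord f) N) n))\<^sup>2) sums ((nrm f)\<^sup>2 - (\<Sum>k<N. (cmod (coord f k))\<^sup>2))"
      unfolding nrm_partial[symmetric] by (intro sums_diff coord_sq_sums f partial_D)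
    then show "(\<lambda>n. (cmod (coord (f - partial (coord f) N) n))\<^sup>2) sums ((nrm f)\<^sup>2 - (\<Sum>k<N. (cmod (coord f k))\<^sup>2))"
      by (rule sums_cong[THEN iffD1, rotated]) (simp add: coord_diff f coord_partial)
  qed (use f D_diff in auto)
  have "(\<lambda>N. (nrm f)\<^sup>2 - (\<Sum>k<N. (cmod (coord f k))\<^sup>2)) \<longlonglongrightarrow> (nrm f)\<^sup>2 - (nrm f)\<^sup>2"
    using coord_sq_sums[OF f] by (intro tendsto_intros) (simp add: sums_def)
  then have "(\<lambda>N. sqrt ((nrm (f - partial (coord f) N))\<^sup>2)) \<longlonglongrightarrow> sqrt 0"
    unfolding e by (intro tendsto_real_sqrt) simp
  then show ?thesis by simp
qed

section \<open>Bounded operators and adjoints\<close>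

lemma op_D: "bounded_operator \<alpha> T \<Longrightarrow> f \<in> D \<Longrightarrow> T f \<in> D"
  by (simp add: bounded_operator_def)

lemma op_add: "bounded_operator \<alpha> T \<Longrightarrow> f \<in> D \<Longrightarrow> g \<in> D \<Longrightarrow> T (f + g) = T f + T g"
  by (simp add: bounded_operator_def)

lemma op_scale: "bounded_operator \<alpha> T \<Longrightarrow> f \<in> D \<Longrightarrow> T (fscale c f) = fscale c (T f)"
  by (simp add: bounded_operator_def)

lemma op_bound:
  assumes "bounded_operator \<alpha> T"
  obtains B where "B > 0" "\<And>f. f \<in> D \<Longrightarrow> nrm (T f) \<le> B * nrm f"
proof -
  obtain B where B: "\<forall>f\<in>D. nrm (T f) \<le> B * nrm f" using assms by (auto simp: bounded_operator_def)
  show ?thesis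
  proof (rule that[of "max B 1"])
    fix f assume "f \<in> D"
    then have "nrm (T f) \<le> B * nrm f" using B by blast
    also have "\<dots> \<le> max B 1 * nrm f" by (intro mult_right_mono) auto
    finally show "nrm (T f) \<le> max B 1 * nrm f" .
  qed simp
qed

lemma op_diff:
  assumes "bounded_operator \<alpha> T" "f \<in> D" "g \<in> D"
  shows "T (f - g) = T f - T g"
proof -
  have "f - g = f + fscale (-1) g" by (simp add: fun_eq_iff)
  then have "T (f - g) = T (f + fscale (-1) g)" by (rule arg_cong)
  also have "\<dots> = T f + fscale (-1) (T g)"
    by (simp only: op_add[OF assms(1,2) D_scale[OF assms(3)]] op_scale[OF assms(1,3)])
  also have "\<dots> = T f - T g" by (simp add: fun_eq_iff)
  finally show ?thesis .
qed

lemma op_zero: "bounded_operator \<alpha> T \<Longrightarrow> T 0 = 0"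
  using op_diff[OF _ D_zero D_zero, of T] by simp

lemma op_sum:
  assumes "bounded_operator \<alpha> T" "\<And>i. i \<in> I \<Longrightarrow> f i \<in> D"
  shows "T (sum f I) = (\<Sum>i\<in>I. T (f i))"
  using assms(2) by (induction I rule: infinite_finite_induct) (auto simp: op_zero op_add D_sum assms(1))

lemma nrm_sum_le:
  assumes "\<And>i. i \<in> I \<Longrightarrow> f i \<in> D"
  shows "nrm (sum f I) \<le> (\<Sum>i\<in>I. nrm (f i))"
  using assms
proof (induction I rule: infinite_finite_induct)
  case (insert x F)
  have "sum f (insert x F) = f x + sum f F" by (rule sum.insert[OF insert.hyps(1,2)])
  then have "nrm (sum f (insert x F)) = nrm (f x + sum f F)" by (rule arg_cong)
  also have "\<dots> \<le> nrm (f x) + nrm (sum f F)" by (intro nrm_triangle D_sum insert.prems) auto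
  also have "\<dots> \<le> nrm (f x) + (\<Sum>i\<in>F. nrm (f i))" using insert.IH insert.prems by auto
  also have "\<dots> = (\<Sum>i\<in>insert x F. nrm (f i))" by (rule sum.insert[OF insert.hyps(1,2), symmetric])
  finally show ?case .
qed (auto simp: nrm_zero)

text \<open>
  A triangle inequality for the basis expansion, stated with a majorant so that it also
  applies to tails of the expansion.
\<close>

lemma nrm_op_le_suminf:
  assumes T: "bounded_operator \<alpha> T" and f: "f \<in> D" and t: "summable t"
    and le: "\<And>k. cmod (coord f k) * nrm (T (basis k)) \<le> t k"
  shows "nrm (T f) \<le> suminf t"
proof -
  obtain B where B: "\<And>f. f \<in> D \<Longrightarrow> nrm (T f) \<le> B * nrm f" using op_bound[OF T] by metis
  have t0: "t k \<ge> 0" for k using le[of k] by (rule order_trans[rotated]) auto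
  have "nrm (T f) \<le> B * nrm (f - partial (coord f) N) + suminf t" for N
  proof -
    let ?p = "partial (coord f) N"
    have d: "f - ?p \<in> D" using f D_diff by simp
    have "nrm (T f) = nrm (T (f - ?p) + T ?p)" by (subst op_add[OF T, symmetric]) (use d in auto)
    also have "\<dots> \<le> nrm (T (f - ?p)) + nrm (T ?p)" using d by (intro nrm_triangle op_D[OF T]) auto
    also have "T ?p = (\<Sum>k<N. fscale (coord f k) (T (basis k)))"
      unfolding partial_def by (subst op_sum[OF T]) (auto simp: D_scale op_scale[OF T])
    also have "nrm \<dots> \<le> (\<Sum>k<N. nrm (fscale (coord f k) (T (basis k))))"
      by (rule nrm_sum_le, rule D_scale, rule op_D[OF T], rule basis_D)
    also have "\<dots> = (\<Sum>k<N. cmod (coord f k) * nrm (T (basis k)))"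
      by (intro sum.cong refl nrm_scale op_D[OF T]) auto
    also have "\<dots> \<le> (\<Sum>k<N. t k)" by (intro sum_mono le)
    also have "\<dots> \<le> suminf t" by (intro sum_le_suminf t) (use t0 in auto)
    finally show ?thesis using B[OF d] by linarith
  qed
  moreover have "(\<lambda>N. B * nrm (f - partial (coord f) N) + suminf t) \<longlonglongrightarrow> B * 0 + suminf t"
    by (intro tendsto_intros partial_tendsto f)
  ultimately show ?thesis by (intro LIMSEQ_le_const) auto
qed

text \<open>
  The representing vector has the conjugated values of the functional on the basis as its
  coordinates. They are square-summable by the usual test on their own partial sums.
\<close>

lemma riesz:
  assumes add: "\<And>f g. f \<in> D \<Longrightarrow> g \<in> D \<Longrightarrow> L (f + g) = L f + L g"
    and scale: "\<And>c f. f \<in> D \<Longrightarrow> L (fscale c f) = c * L f"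
    and bound: "\<And>f. f \<in> D \<Longrightarrow> cmod (L f) \<le> B * nrm f"
  obtains h where "h \<in> D" "\<And>f. f \<in> D \<Longrightarrow> ip f h = L f"
proof -
  \<comment> \<open>the coordinates that the representing vector must have\<close>
  define b where "b n = cnj (L (basis n))" for n
  have L0: "L 0 = 0" using scale[OF D_zero, of 0] by (simp add: zero_fun_def)
  have Lsum: "L (sum f I) = (\<Sum>i\<in>I. L (f i))" if "\<And>i. i \<in> I \<Longrightarrow> f i \<in> D" for f and I :: "nat set"
    using that by (induction I rule: infinite_finite_induct) (auto simp: L0 add D_sum)
  have Lp: "L (partial x N) = (\<Sum>k<N. x k * cnj (b k))" for x N
    unfolding partial_def by (subst Lsum) (auto simp: D_scale scale b_def)
  have "(\<Sum>k<N. (cmod (b k))\<^sup>2) \<le> B\<^sup>2" for N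
  proof -
    define s where "s = (\<Sum>k<N. (cmod (b k))\<^sup>2)"
    have s0: "s \<ge> 0" unfolding s_def by (intro sum_nonneg) auto
    have "L (partial b N) = of_real s"
      unfolding Lp s_def of_real_sum by (intro sum.cong refl complex_norm_square[symmetric])
    then have "s \<le> B * nrm (partial b N)" using bound[OF partial_D, of b N] s0 by simp
    also have "nrm (partial b N) = sqrt s"
      using nrm_partial[of b N] by (metis s_def nrm_nonneg real_sqrt_unique)
    finally have le: "sqrt s * sqrt s \<le> B * sqrt s" using s0 by simp
    have "sqrt s \<le> \<bar>B\<bar>"
    proof (cases "s = 0")
      case False
      then have "0 < sqrt s" using s0 by simp
      then have "sqrt s \<le> B" by (rule mult_right_le_imp_le[OF le])
      then show ?thesis by linarith
    qed simp
    then have "(sqrt s)\<^sup>2 \<le> \<bar>B\<bar>\<^sup>2" using s0 by (intro power_mono) auto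
    then show ?thesis using s0 by (simp add: s_def)
  qed
  from this[of "Suc _"] have "summable (\<lambda>n. (cmod (b n))\<^sup>2)"
    by (intro bounded_imp_summable[of "\<lambda>n. (cmod (b n))\<^sup>2" "B\<^sup>2"] zero_le_power2) (simp only: lessThan_Suc_atMost)
  then obtain h where h: "h \<in> D" "\<And>n. coord h n = b n" by (rule D_synthesis) auto
  have "ip f h = L f" if f: "f \<in> D" for f
  proof (rule LIMSEQ_unique)
    show "(\<lambda>N. \<Sum>n<N. coord f n * cnj (b n)) \<longlonglongrightarrow> ip f h"
      using ip_sums[OF f h(1)] by (simp add: h(2) sums_def)
    have le: "\<forall>N. cmod (L (f - partial (coord f) N)) \<le> B * nrm (f - partial (coord f) N)"
      by (intro allI bound D_diff f partial_D)
    have "(\<lambda>N. B * nrm (f - partial (coord f) N)) \<longlonglongrightarrow> B * 0"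
      by (intro tendsto_intros partial_tendsto f)
    then have "(\<lambda>N. B * nrm (f - partial (coord f) N)) \<longlonglongrightarrow> 0" by (simp only: mult_zero_right)
    then have lim0: "(\<lambda>N. L (f - partial (coord f) N)) \<longlonglongrightarrow> 0"
      by (rule Lim_null_comparison[OF always_eventually[OF le]])
    have "L f = L (f - partial (coord f) N) + L (partial (coord f) N)" for N
      by (subst add[symmetric]) (use f D_diff in auto)
    then have "L (partial (coord f) N) = L f - L (f - partial (coord f) N)" for N
      by (metis add_diff_cancel_left')
    moreover have "(\<lambda>N. L f - L (f - partial (coord f) N)) \<longlonglongrightarrow> L f - 0"
      by (intro tendsto_intros lim0)
    ultimately show "(\<lambda>N. \<Sum>n<N. coord f n * cnj (b n)) \<longlonglongrightarrow> L f"
      by (simp add: Lp[symmetric])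
  qed
  then show ?thesis using that h(1) by blast
qed

lemma adjoint_exists:
  assumes T: "bounded_operator \<alpha> T" and g: "g \<in> D"
  shows "\<exists>!h. h \<in> D \<and> (\<forall>f\<in>D. ip (T f) g = ip f h)"
proof -
  obtain B where B: "\<And>f. f \<in> D \<Longrightarrow> nrm (T f) \<le> B * nrm f" using op_bound[OF T] by metis
  obtain h where h: "h \<in> D" "\<And>f. f \<in> D \<Longrightarrow> ip f h = ip (T f) g"
  proof (rule riesz[of "\<lambda>f. ip (T f) g" "B * nrm g"])
    fix f assume f: "f \<in> D"
    have "cmod (ip (T f) g) \<le> nrm (T f) * nrm g" by (intro cmod_ip_le op_D[OF T] f g)
    also have "\<dots> \<le> B * nrm f * nrm g" using B[OF f] by (intro mult_right_mono) auto
    finally show "cmod (ip (T f) g) \<le> B * nrm g * nrm f" by (simp add: mult_ac)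
  qed (simp_all add: op_add[OF T] op_scale[OF T] op_D[OF T] ip_add_left ip_scale_left g)
  show ?thesis
  proof (rule ex1I[of _ h])
    show "h \<in> D \<and> (\<forall>f\<in>D. ip (T f) g = ip f h)" using h by simp
    fix h' assume h': "h' \<in> D \<and> (\<forall>f\<in>D. ip (T f) g = ip f h')"
    show "h' = h" by (rule ip_right_eqI) (use h h' in auto)
  qed
qed

lemma adjoint_D:
  assumes "bounded_operator \<alpha> T" "g \<in> D"
  shows "hilbert_adjoint \<alpha> T g \<in> D"
  unfolding hilbert_adjoint_def by (rule conjunct1[OF theI'[OF adjoint_exists[OF assms]]])

lemma adjoint_ip:
  assumes "bounded_operator \<alpha> T" "f \<in> D" "g \<in> D"
  shows "ip (T f) g = ip f (hilbert_adjoint \<alpha> T g)"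
  unfolding hilbert_adjoint_def
  by (rule bspec[OF conjunct2[OF theI'[OF adjoint_exists[OF assms(1,3)]]] assms(2)])

lemma adjoint_eqI:
  assumes "bounded_operator \<alpha> T" "g \<in> D" "h \<in> D" "\<And>f. f \<in> D \<Longrightarrow> ip (T f) g = ip f h"
  shows "hilbert_adjoint \<alpha> T g = h"
  unfolding hilbert_adjoint_def using adjoint_exists[OF assms(1,2)] assms(3,4)
  by (intro the1_equality) auto

lemma adjoint_bounded:
  assumes T: "bounded_operator \<alpha> T"
  shows "bounded_operator \<alpha> (hilbert_adjoint \<alpha> T)"
proof -
  let ?A = "hilbert_adjoint \<alpha> T"
  obtain B where B: "B > 0" "\<And>f. f \<in> D \<Longrightarrow> nrm (T f) \<le> B * nrm f" using op_bound[OF T] by metis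
  note A = adjoint_D[OF T] and Aip = adjoint_ip[OF T, symmetric]
  have "nrm (?A g) \<le> B * nrm g" if g: "g \<in> D" for g
  proof -
    have "complex_of_real ((nrm (?A g))\<^sup>2) = ip (T (?A g)) g"
      using A[OF g] g by (simp only: ip_self[symmetric] Aip)
    then have "(nrm (?A g))\<^sup>2 = cmod (ip (T (?A g)) g)"
      by (metis norm_of_real abs_power2)
    also have "\<dots> \<le> nrm (T (?A g)) * nrm g" by (intro cmod_ip_le op_D[OF T] A g)
    also have "\<dots> \<le> B * nrm (?A g) * nrm g" using B(2)[OF A[OF g]] by (intro mult_right_mono) auto
    finally have "nrm (?A g) * nrm (?A g) \<le> (B * nrm g) * nrm (?A g)"
      by (simp add: power2_eq_square mult_ac)
    moreover have "0 \<le> B * nrm g" using B(1) by simp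
    ultimately show ?thesis
      using nrm_nonneg[of "?A g"] by (smt (verit) mult_le_cancel_right)
  qed
  moreover have "?A (f + g) = ?A f + ?A g" if "f \<in> D" "g \<in> D" for f g
    by (rule adjoint_eqI[OF T]) (use that in \<open>auto simp: D_add A ip_add_right Aip op_D[OF T]\<close>)
  moreover have "?A (fscale c f) = fscale c (?A f)" if "f \<in> D" for c f
    by (rule adjoint_eqI[OF T]) (use that in \<open>auto simp: D_scale A ip_scale_right Aip op_D[OF T]\<close>)
  ultimately show ?thesis unfolding bounded_operator_def using A by blast
qed

lemma bounded_operator_compose:
  assumes S: "bounded_operator \<alpha> S" and T: "bounded_operator \<alpha> T"
  shows "bounded_operator \<alpha> (S \<circ> T)"
proof -
  obtain B where B: "B > 0" "\<And>f. f \<in> D \<Longrightarrow> nrm (S f) \<le> B * nrm f" using op_bound[OF S] by metis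
  obtain C where C: "C > 0" "\<And>f. f \<in> D \<Longrightarrow> nrm (T f) \<le> C * nrm f" using op_bound[OF T] by metis
  have "nrm (S (T f)) \<le> B * C * nrm f" if f: "f \<in> D" for f
  proof -
    have "nrm (S (T f)) \<le> B * nrm (T f)" by (intro B op_D[OF T] f)
    also have "\<dots> \<le> B * (C * nrm f)" using C(2)[OF f] B(1) by (intro mult_left_mono) auto
    finally show ?thesis by (simp add: mult.assoc)
  qed
  then show ?thesis
    unfolding bounded_operator_def o_def
    using op_D[OF T] op_D[OF S] op_add[OF T] op_add[OF S] op_scale[OF T] op_scale[OF S] by metis
qed

section \<open>Reproducing kernels\<close>

text \<open>
  Through the Cauchy-Schwarz inequality this bounds values at a point by the norm.
\<close>

lemma eval_kernel:
  assumes u: "u \<in> disk"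
  obtains k where "k \<in> D" "\<And>f. f \<in> D \<Longrightarrow> ip f k = f u"
proof -
  define b where "b n = cnj u ^ n / of_real (sqrt (wt n))" for n
  have "(cmod (b n))\<^sup>2 = ((cmod u)\<^sup>2) ^ n / wt n" for n
    using wt_pos[of n] by (simp add: b_def norm_divide norm_power power_divide power_mult[symmetric] mult.commute)
  moreover have "summable (\<lambda>n. ((cmod u)\<^sup>2) ^ n / wt n)"
    using u by (intro summable_inverse_wt) (auto simp: power_less_one_iff)
  ultimately have "summable (\<lambda>n. (cmod (b n))\<^sup>2)" by simp
  then obtain k where k: "k \<in> D" "\<And>n. coord k n = b n" by (rule D_synthesis) auto
  have "ip f k = f u" if f: "f \<in> D" for f
  proof -
    have "coord f n * cnj (b n) = taylor f n * u ^ n" for n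
      using wt_pos[of n] by (simp add: b_def coord_def)
    then have "coord f n * cnj (coord k n) = taylor f n * u ^ n" for n by (simp only: k(2))
    then have "(\<lambda>n. taylor f n * u ^ n) sums ip f k" using ip_sums[OF f k(1)] by simp
    then show ?thesis using taylor_sums[OF D_holomorphic[OF f] u] sums_unique2 by blast
  qed
  then show ?thesis using that k(1) by blast
qed

text \<open>
  The representing function of \<open>f \<mapsto> f' u\<close>, determined by its coordinates.
\<close>

definition dkernel :: "complex \<Rightarrow> complex \<Rightarrow> complex" where
  "dkernel u = (SOME k. k \<in> D \<and> (\<forall>n. coord k n = of_nat n * cnj u ^ (n - 1) / of_real (sqrt (wt n))))"

lemma dkernel_coord:
  assumes u: "u \<in> disk"
  shows "dkernel u \<in> D" "coord (dkernel u) n = of_nat n * cnj u ^ (n - 1) / of_real (sqrt (wt n))"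
proof -
  define b where "b n = of_nat n * cnj u ^ (n - 1) / complex_of_real (sqrt (wt n))" for n
  have "(cmod (b (Suc n)))\<^sup>2 = ((cmod u)\<^sup>2) ^ n / moment \<alpha> n" for n
  proof -
    have "(cmod (b (Suc n)))\<^sup>2 = (real (Suc n))\<^sup>2 * ((cmod u)\<^sup>2) ^ n / wt (Suc n)"
      using wt_pos[of "Suc n"]
      by (simp add: b_def norm_divide norm_mult norm_power power_divide power_mult_distrib power_mult[symmetric] mult.commute del: of_nat_Suc)
    also have "\<dots> = ((cmod u)\<^sup>2) ^ n / moment \<alpha> n"
      by (simp add: wt_def del: of_nat_Suc)
    finally show ?thesis .
  qed
  moreover have "summable (\<lambda>n. ((cmod u)\<^sup>2) ^ n / moment \<alpha> n)"
    using u by (intro summable_inverse_moment) (auto simp: power_less_one_iff)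
  ultimately have "summable (\<lambda>n. (cmod (b (Suc n)))\<^sup>2)" by simp
  then have "summable (\<lambda>n. (cmod (b n))\<^sup>2)"
    using summable_Suc_iff[of "\<lambda>n. (cmod (b n))\<^sup>2"] by simp
  then obtain k where "k \<in> D" "\<And>n. coord k n = b n" by (rule D_synthesis) auto
  then have "\<exists>k. k \<in> D \<and> (\<forall>n. coord k n = of_nat n * cnj u ^ (n - 1) / of_real (sqrt (wt n)))"
    unfolding b_def by blast
  from someI_ex[OF this]
  show "dkernel u \<in> D" "coord (dkernel u) n = of_nat n * cnj u ^ (n - 1) / of_real (sqrt (wt n))"
    unfolding dkernel_def by auto
qed

lemma deriv_sums:
  assumes "f \<in> D" "u \<in> disk"
  shows "(\<lambda>n. of_nat (Suc n) * taylor f (Suc n) * u ^ n) sums deriv f u"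
  using taylor_sums[OF holomorphic_deriv[OF D_holomorphic[OF assms(1)] open_ball] assms(2)]
  by (simp only: taylor_deriv)

lemma ip_dkernel:
  assumes f: "f \<in> D" and u: "u \<in> disk"
  shows "ip f (dkernel u) = deriv f u"
proof (rule sums_unique2[OF ip_sums[OF f dkernel_coord(1)[OF u]]])
  have e: "coord f n * cnj (coord (dkernel u) n) = of_nat n * taylor f n * u ^ (n - 1)" for n
    unfolding dkernel_coord(2)[OF u] using wt_pos[of n] by (simp add: coord_def)
  have "(\<lambda>n. coord f (Suc n) * cnj (coord (dkernel u) (Suc n))) sums deriv f u"
    unfolding e using deriv_sums[OF f u] by simp
  moreover have "coord f 0 * cnj (coord (dkernel u) 0) = 0" unfolding e by simp
  ultimately show "(\<lambda>n. coord f n * cnj (coord (dkernel u) n)) sums deriv f u"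
    using sums_Suc[of "\<lambda>n. coord f n * cnj (coord (dkernel u) n)" "deriv f u"] by (simp only: add_0_right)
qed

lemma deriv_dkernel:
  assumes u: "u \<in> disk" and v: "v \<in> disk"
  shows "deriv (dkernel u) v = (1 - cnj u * v) powr of_real (- (\<alpha> + 2))"
proof (rule sums_unique2[OF deriv_sums[OF dkernel_coord(1)[OF u] v]])
  have e: "of_nat (Suc n) * taylor (dkernel u) (Suc n) * v ^ n = (cnj u * v) ^ n / of_real (moment \<alpha> n)" for n
  proof -
    define q where "q = complex_of_real (sqrt (wt (Suc n)))"
    have q: "q \<noteq> 0" "of_real (wt (Suc n)) = q * q"
      using wt_pos[of "Suc n"] by (auto simp: q_def simp flip: of_real_mult)
    have "q * taylor (dkernel u) (Suc n) = of_nat (Suc n) * cnj u ^ n / q"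
      using dkernel_coord(2)[OF u, of "Suc n"] by (simp add: coord_def q_def del: of_nat_Suc)
    then have "q * (q * taylor (dkernel u) (Suc n)) = of_nat (Suc n) * cnj u ^ n"
      using q(1) by (simp del: of_nat_Suc)
    then have "of_real (wt (Suc n)) * taylor (dkernel u) (Suc n) = of_nat (Suc n) * cnj u ^ n"
      by (simp only: q(2) mult.assoc)
    moreover have "complex_of_real (wt (Suc n)) = (of_nat (Suc n))\<^sup>2 * of_real (moment \<alpha> n)"
      by (simp add: wt_def del: of_nat_Suc)
    ultimately have "of_nat (Suc n) * (of_nat (Suc n) * taylor (dkernel u) (Suc n) * of_real (moment \<alpha> n)) = of_nat (Suc n) * cnj u ^ n"
      by (simp add: power2_eq_square mult_ac del: of_nat_Suc)
    then have "of_nat (Suc n) * taylor (dkernel u) (Suc n) * of_real (moment \<alpha> n) = cnj u ^ n"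
      by (simp only: mult_cancel_left of_nat_eq_0_iff) simp
    then have "of_nat (Suc n) * taylor (dkernel u) (Suc n) = cnj u ^ n / of_real (moment \<alpha> n)"
      using moment_pos[OF \<alpha>, of n] by (simp add: eq_divide_eq)
    then show ?thesis by (simp add: power_mult_distrib del: of_nat_Suc)
  qed
  have "cmod (cnj u * v) < 1"
    using u v norm_mult_less[of "cnj u" 1 v 1] by simp
  then show "(\<lambda>n. of_nat (Suc n) * taylor (dkernel u) (Suc n) * v ^ n) sums ((1 - cnj u * v) powr of_real (- (\<alpha> + 2)))"
    unfolding e by (rule bergman_kernel_sums[OF \<alpha>])
qed

lemma nrm_dkernel:
  assumes u: "u \<in> disk"
  shows "(nrm (dkernel u))\<^sup>2 = (1 - (cmod u)\<^sup>2) powr (- (\<alpha> + 2))"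
proof -
  have "cnj u * u = complex_of_real ((cmod u)\<^sup>2)" by (simp only: complex_norm_square mult.commute)
  then have "1 - cnj u * u = complex_of_real (1 - (cmod u)\<^sup>2)" by simp
  moreover have "0 \<le> 1 - (cmod u)\<^sup>2" using u by (simp add: power_le_one)
  moreover have "complex_of_real ((nrm (dkernel u))\<^sup>2) = (1 - cnj u * u) powr of_real (- (\<alpha> + 2))"
    using ip_self[OF dkernel_coord(1)[OF u]] ip_dkernel[OF dkernel_coord(1)[OF u] u] deriv_dkernel[OF u u] by simp
  ultimately have "complex_of_real ((nrm (dkernel u))\<^sup>2) = of_real ((1 - (cmod u)\<^sup>2) powr (- (\<alpha> + 2)))"
    by (simp only: powr_of_real)
  then show ?thesis by (simp only: of_real_eq_iff)
qed

end

section \<open>Raising the weight by two\<close>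

text \<open>
  The functional equation of the gamma function, applied to the two beta values.
\<close>

lemma moment_shift:
  assumes "\<alpha> > -1"
  shows "real (Suc n) * moment (\<alpha> + 2) n * (real n + \<alpha> + 3) = (\<alpha> + 2) * (\<alpha> + 3) * moment \<alpha> (Suc n)"
proof -
  have G: "Gamma (x + 1) = x * Gamma x" if "x > 0" for x :: real
    using Gamma_plus1[of x] that nonpos_Ints_cases[of x] by (force simp: add.commute)
  have 1: "Gamma (\<alpha> + 3) = (\<alpha> + 2) * ((\<alpha> + 1) * Gamma (\<alpha> + 1))"
    using G[of "\<alpha> + 2"] G[of "\<alpha> + 1"] assms by (simp add: add.commute add.left_commute)
  have 2: "Gamma (real n + 2) = (real n + 1) * Gamma (real n + 1)"
    using G[of "real n + 1"] by (simp add: add.commute add.left_commute)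
  have 3: "Gamma (real n + \<alpha> + 4) = (real n + \<alpha> + 3) * Gamma (real n + \<alpha> + 3)"
    using G[of "real n + \<alpha> + 3"] assms by (simp add: add.commute add.left_commute)
  have pos: "Gamma (real n + \<alpha> + 3) > 0" "real n + \<alpha> + 3 > 0"
    using assms by (auto intro: Gamma_real_pos)
  have a: "moment (\<alpha> + 2) n = (\<alpha> + 3) * (Gamma (real n + 1) * Gamma (\<alpha> + 3) / Gamma (real n + \<alpha> + 4))"
    by (simp add: moment_def Beta_def add_ac)
  have b: "moment \<alpha> (Suc n) = (\<alpha> + 1) * (Gamma (real n + 2) * Gamma (\<alpha> + 1) / Gamma (real n + \<alpha> + 3))"
    by (simp add: moment_def Beta_def add_ac)
  have gen: "N * (p * (B * (q * (r * A)) / (t * C))) * t = q * p * (r * (N * B * A / C))"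
    if "t \<noteq> 0" "C \<noteq> 0" for N p q r t A B C :: real using that by (simp add: field_simps)
  have nz: "real n + \<alpha> + 3 \<noteq> 0" "Gamma (real n + \<alpha> + 3) \<noteq> 0" using pos by linarith+
  show ?thesis unfolding a b 1 2 3 of_nat_Suc gen[OF nz] by (simp add: add.commute)
qed

lemma moment_shift_le:
  assumes "\<alpha> > -1"
  shows "(\<alpha> + 2) * moment \<alpha> (Suc n) \<le> (real (Suc n))\<^sup>2 * moment (\<alpha> + 2) n"
    and "(real (Suc n))\<^sup>2 * moment (\<alpha> + 2) n \<le> (\<alpha> + 2) * (\<alpha> + 3) * moment \<alpha> (Suc n)"
proof -
  let ?x = "real (Suc n)" let ?m = "moment (\<alpha> + 2) n" let ?k = "(\<alpha> + 2) * moment \<alpha> (Suc n)"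
  have k: "?k > 0" using moment_pos[OF assms, of "Suc n"] assms by simp
  have m: "?m > 0" using moment_pos[of "\<alpha> + 2" n] assms by simp
  have e: "?x * ?m * (?x + (\<alpha> + 2)) = (\<alpha> + 3) * ?k"
    using moment_shift[OF assms, of n] by (simp add: algebra_simps)
  have "?x * ((\<alpha> + 3) * ?k) = ?x\<^sup>2 * ?m * (?x + (\<alpha> + 2))"
    unfolding e[symmetric] by (simp add: power2_eq_square)
  moreover have "?x + (\<alpha> + 2) \<le> ?x * (\<alpha> + 3)"
  proof -
    have "1 * (\<alpha> + 2) \<le> ?x * (\<alpha> + 2)" using assms by (intro mult_right_mono) auto
    then show ?thesis by (simp add: algebra_simps)
  qed
  ultimately have "(?x + (\<alpha> + 2)) * ?k \<le> ?x\<^sup>2 * ?m * (?x + (\<alpha> + 2))"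
    using mult_right_mono[of "?x + (\<alpha> + 2)" "?x * (\<alpha> + 3)" ?k] k by (simp add: mult_ac)
  moreover have p: "?x + (\<alpha> + 2) > 0" using assms by simp
  ultimately show "?k \<le> ?x\<^sup>2 * ?m" by (metis mult.commute mult_le_cancel_right_pos)
  have "?x\<^sup>2 * ?m * (?x + (\<alpha> + 2)) = ?x * ((\<alpha> + 3) * ?k)"
    unfolding e[symmetric] by (simp add: power2_eq_square)
  also have "\<dots> \<le> (?x + (\<alpha> + 2)) * ((\<alpha> + 3) * ?k)"
    using k assms by (intro mult_right_mono) auto
  finally have "?x\<^sup>2 * ?m * (?x + (\<alpha> + 2)) \<le> (\<alpha> + 3) * ?k * (?x + (\<alpha> + 2))" by (simp only: mult.commute)
  then have "?x\<^sup>2 * ?m \<le> (\<alpha> + 3) * ?k" using p by (simp only: mult_le_cancel_right_pos)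
  then show "?x\<^sup>2 * ?m \<le> (\<alpha> + 2) * (\<alpha> + 3) * moment \<alpha> (Suc n)" by (simp add: mult_ac)
qed

abbreviation bergman_sq :: "real \<Rightarrow> (complex \<Rightarrow> complex) \<Rightarrow> ennreal" where
  "bergman_sq \<alpha> g \<equiv> (\<integral>\<^sup>+z. ennreal ((cmod (g z))\<^sup>2) \<partial>weighted_area \<alpha>)"

lemma bergman_sq_deriv:
  assumes \<alpha>: "\<alpha> > -1" and g: "g holomorphic_on disk"
  shows "bergman_sq (\<alpha> + 2) (deriv g) = (\<Sum>n. ennreal ((cmod (taylor g (Suc n)))\<^sup>2 * ((real (Suc n))\<^sup>2 * moment (\<alpha> + 2) n)))"
proof -
  have e: "(cmod (taylor (deriv g) n))\<^sup>2 * moment (\<alpha> + 2) n = (cmod (taylor g (Suc n)))\<^sup>2 * ((real (Suc n))\<^sup>2 * moment (\<alpha> + 2) n)" for n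
    by (simp add: taylor_deriv norm_mult power_mult_distrib del: of_nat_Suc)
  have "\<alpha> + 2 > -1" using \<alpha> by simp
  then show ?thesis
    by (simp only: bergman_parseval[OF _ holomorphic_deriv[OF g open_ball]] e)
qed

lemma suminf_ennreal_split_head: "(\<Sum>n. f n) = f 0 + (\<Sum>n. f (Suc n))" for f :: "nat \<Rightarrow> ennreal"
  using suminf_offset[OF summableI, of f 1] by (simp add: add.commute)

text \<open>
  Together with the next lemma this says that a Bergman norm is equivalent to the norm of the
  derivative with respect to the weight with exponent \<open>\<alpha> + 2\<close>. In coordinates it is a comparison
  of moments.
\<close>

lemma bergman_sq_deriv_le:
  assumes \<alpha>: "\<alpha> > -1" and g: "g holomorphic_on disk"
  shows "bergman_sq (\<alpha> + 2) (deriv g) \<le> ennreal ((\<alpha> + 2) * (\<alpha> + 3)) * bergman_sq \<alpha> g"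
proof -
  let ?f = "\<lambda>n. ennreal ((\<alpha> + 2) * (\<alpha> + 3)) * ennreal ((cmod (taylor g n))\<^sup>2 * moment \<alpha> n)"
  have "bergman_sq (\<alpha> + 2) (deriv g) \<le> (\<Sum>n. ?f (Suc n))"
    unfolding bergman_sq_deriv[OF assms]
  proof (rule suminf_le)
    fix n
    have "(cmod (taylor g (Suc n)))\<^sup>2 * ((real (Suc n))\<^sup>2 * moment (\<alpha> + 2) n)
       \<le> (cmod (taylor g (Suc n)))\<^sup>2 * ((\<alpha> + 2) * (\<alpha> + 3) * moment \<alpha> (Suc n))"
      by (intro mult_left_mono moment_shift_le \<alpha>) simp
    also have "\<dots> = (\<alpha> + 2) * (\<alpha> + 3) * ((cmod (taylor g (Suc n)))\<^sup>2 * moment \<alpha> (Suc n))" by (simp only: mult_ac)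
    finally have "ennreal ((cmod (taylor g (Suc n)))\<^sup>2 * ((real (Suc n))\<^sup>2 * moment (\<alpha> + 2) n))
      \<le> ennreal ((\<alpha> + 2) * (\<alpha> + 3) * ((cmod (taylor g (Suc n)))\<^sup>2 * moment \<alpha> (Suc n)))" by (rule ennreal_leI)
    also have "\<dots> = ?f (Suc n)" using \<alpha> by (intro ennreal_mult') simp
    finally show "ennreal ((cmod (taylor g (Suc n)))\<^sup>2 * ((real (Suc n))\<^sup>2 * moment (\<alpha> + 2) n)) \<le> ?f (Suc n)" .
  qed auto
  also have "\<dots> \<le> (\<Sum>n. ?f n)" by (subst suminf_ennreal_split_head[of ?f]) simp
  also have "\<dots> = ennreal ((\<alpha> + 2) * (\<alpha> + 3)) * bergman_sq \<alpha> g"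
    by (simp add: bergman_parseval[OF \<alpha> g])
  finally show ?thesis .
qed

lemma bergman_sq_le_deriv:
  assumes \<alpha>: "\<alpha> > -1" and g: "g holomorphic_on disk"
  shows "bergman_sq \<alpha> g \<le> ennreal ((cmod (g 0))\<^sup>2) + bergman_sq (\<alpha> + 2) (deriv g)"
proof -
  have "bergman_sq \<alpha> g = ennreal ((cmod (g 0))\<^sup>2) + (\<Sum>n. ennreal ((cmod (taylor g (Suc n)))\<^sup>2 * moment \<alpha> (Suc n)))"
    unfolding bergman_parseval[OF assms] by (subst suminf_ennreal_split_head) (simp add: moment_0[OF \<alpha>])
  also have "(\<Sum>n. ennreal ((cmod (taylor g (Suc n)))\<^sup>2 * moment \<alpha> (Suc n)))
      \<le> (\<Sum>n. ennreal ((cmod (taylor g (Suc n)))\<^sup>2 * ((real (Suc n))\<^sup>2 * moment (\<alpha> + 2) n)))"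
  proof (intro suminf_le ennreal_leI mult_left_mono)
    fix n
    have "1 * moment \<alpha> (Suc n) \<le> (\<alpha> + 2) * moment \<alpha> (Suc n)"
      using \<alpha> moment_pos[OF \<alpha>, of "Suc n"] by (intro mult_right_mono) auto
    then show "moment \<alpha> (Suc n) \<le> (real (Suc n))\<^sup>2 * moment (\<alpha> + 2) n"
      using moment_shift_le(1)[OF \<alpha>, of n] by linarith
  qed auto
  also have "\<dots> = bergman_sq (\<alpha> + 2) (deriv g)" by (rule bergman_sq_deriv[OF assms, symmetric])
  finally show ?thesis by (simp add: add_left_mono)
qed

lemma bergman_sq_raise_weight:
  assumes \<alpha>: "\<alpha> > -1" and g: "g holomorphic_on disk"
  shows "bergman_sq (\<alpha> + 2) g \<le> ennreal ((\<alpha> + 3) / (\<alpha> + 1)) * bergman_sq \<alpha> g"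
proof -
  have gm: "(\<lambda>z. ennreal ((cmod (g z))\<^sup>2)) \<in> borel_measurable (weighted_area \<beta>)" for \<beta>
    by (intro continuous_on_borel_measurable_weighted_area continuous_on_ennreal continuous_intros holomorphic_on_imp_continuous_on g)
  have \<alpha>2: "\<alpha> + 2 > -1" using \<alpha> by simp
  have "bergman_sq (\<alpha> + 2) g = (\<integral>\<^sup>+z. ennreal ((cmod (g z))\<^sup>2) * area_density (\<alpha> + 2) z * indicator disk z \<partial>lborel)"
    by (rule nn_integral_weighted_area[OF \<alpha>2 gm])
  also have "\<dots> \<le> (\<integral>\<^sup>+z. ennreal ((\<alpha> + 3) / (\<alpha> + 1)) * (ennreal ((cmod (g z))\<^sup>2) * area_density \<alpha> z * indicator disk z) \<partial>lborel)"
  proof (intro nn_integral_mono)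
    fix z :: complex
    show "ennreal ((cmod (g z))\<^sup>2) * area_density (\<alpha> + 2) z * indicator disk z
       \<le> ennreal ((\<alpha> + 3) / (\<alpha> + 1)) * (ennreal ((cmod (g z))\<^sup>2) * area_density \<alpha> z * indicator disk z)"
    proof (cases "z \<in> disk")
      case True
      have "(1 - (cmod z)\<^sup>2) powr (\<alpha> + 2) \<le> (1 - (cmod z)\<^sup>2) powr \<alpha>"
        using True by (intro powr_mono') (auto simp: power_le_one)
      then have "(1 + (\<alpha> + 2)) / pi * (1 - (cmod z)\<^sup>2) powr (\<alpha> + 2) \<le> (1 + (\<alpha> + 2)) / pi * (1 - (cmod z)\<^sup>2) powr \<alpha>"
        using \<alpha> by (intro mult_left_mono) auto
      also have "\<dots> = (\<alpha> + 3) / (\<alpha> + 1) * ((1 + \<alpha>) / pi * (1 - (cmod z)\<^sup>2) powr \<alpha>)"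
      proof -
        have "(1 + \<alpha>) / (\<alpha> + 1) = 1" using \<alpha> by (simp add: add.commute)
        moreover have "(\<alpha> + 3) / (\<alpha> + 1) * ((1 + \<alpha>) / pi * x) = (\<alpha> + 3) / pi * x * ((1 + \<alpha>) / (\<alpha> + 1))" for x
          by (simp add: divide_inverse mult_ac)
        ultimately show ?thesis by (simp add: add_ac)
      qed
      finally have "area_density (\<alpha> + 2) z \<le> ennreal ((\<alpha> + 3) / (\<alpha> + 1)) * area_density \<alpha> z"
        unfolding area_density_def using \<alpha> by (subst ennreal_mult'[symmetric]) (auto intro: ennreal_leI)
      then have "ennreal ((cmod (g z))\<^sup>2) * area_density (\<alpha> + 2) z \<le> ennreal ((cmod (g z))\<^sup>2) * (ennreal ((\<alpha> + 3) / (\<alpha> + 1)) * area_density \<alpha> z)"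
        by (rule mult_left_mono) simp
      then show ?thesis using True by (simp add: mult_ac)
    qed simp
  qed
  also have "\<dots> = ennreal ((\<alpha> + 3) / (\<alpha> + 1)) * bergman_sq \<alpha> g"
  proof (subst nn_integral_weighted_area[OF \<alpha> gm], rule nn_integral_cmult)
    have "(\<lambda>z. indicator disk z *\<^sub>R g z) \<in> borel_measurable borel"
      by (intro borel_measurable_continuous_on_indicator holomorphic_on_imp_continuous_on g) auto
    then have "(\<lambda>z. ennreal ((cmod (indicator disk z *\<^sub>R g z))\<^sup>2) * area_density \<alpha> z) \<in> borel_measurable borel"
      by measurable
    also have "(\<lambda>z. ennreal ((cmod (indicator disk z *\<^sub>R g z))\<^sup>2) * area_density \<alpha> z) =
      (\<lambda>z. ennreal ((cmod (g z))\<^sup>2) * area_density \<alpha> z * indicator disk z)"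
      by (auto simp: fun_eq_iff indicator_def)
    finally show "(\<lambda>z. ennreal ((cmod (g z))\<^sup>2) * area_density \<alpha> z * indicator disk z) \<in> borel_measurable lborel" by simp
  qed
  finally show ?thesis .
qed

section \<open>Linear fractional self-maps of the disk\<close>

text \<open>
  The inequality \<open>\<bar>a z + b\<bar> \<le> \<bar>c z + d\<bar>\<close> extends from the disk to its closure. If the
  denominator vanished at a point of the closure, then so would the numerator, contradicting
  \<open>a d - b c \<noteq> 0\<close>. Compactness then bounds the denominator from below.
\<close>

lemma linear_fractional_self_mapE:
  assumes "linear_fractional_self_map \<phi>"
  obtains a b c d m where "a * d - b * c \<noteq> 0" "\<phi> = (\<lambda>z. (a * z + b) / (c * z + d))"
    "0 < m" "\<And>z. z \<in> cball 0 1 \<Longrightarrow> m \<le> cmod (c * z + d)" "\<And>z. z \<in> cball 0 1 \<Longrightarrow> cmod (\<phi> z) \<le> 1"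
    "\<And>z. z \<in> disk \<Longrightarrow> cmod (\<phi> z) < 1"
proof -
  obtain a b c d where D: "a * d - b * c \<noteq> 0" and \<phi>: "\<phi> = (\<lambda>z. (a * z + b) / (c * z + d))"
    and nz: "\<And>z. z \<in> disk \<Longrightarrow> c * z + d \<noteq> 0" and sub: "\<phi> ` disk \<subseteq> disk"
    using assms unfolding linear_fractional_self_map_def by blast
  have lt: "cmod (\<phi> z) < 1" if "z \<in> disk" for z using sub that by (auto simp: image_subset_iff)
  have "disk \<subseteq> {z. cmod (a * z + b) \<le> cmod (c * z + d)}"
    using lt nz by (auto simp: \<phi> norm_divide divide_less_eq intro: less_imp_le)
  moreover have "closed {z. cmod (a * z + b) \<le> cmod (c * z + d)}"
    by (intro closed_Collect_le continuous_intros)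
  ultimately have "closure disk \<subseteq> {z. cmod (a * z + b) \<le> cmod (c * z + d)}" by (rule closure_minimal)
  then have le: "cmod (a * z + b) \<le> cmod (c * z + d)" if "z \<in> cball 0 1" for z using that by auto
  have nz': "c * z + d \<noteq> 0" if "z \<in> cball 0 1" for z
  proof
    assume 0: "c * z + d = 0"
    then have "a * z + b = 0" using le[OF that] by simp
    then have "b = - a * z" "d = - c * z" using 0 by (auto simp: eq_neg_iff_add_eq_0 add.commute)
    then show False using D by (simp add: algebra_simps)
  qed
  have "continuous_on (cball 0 1) (\<lambda>z. cmod (c * z + d))" by (intro continuous_intros)
  then obtain x where x: "x \<in> cball 0 1" "\<And>z. z \<in> cball 0 1 \<Longrightarrow> cmod (c * x + d) \<le> cmod (c * z + d)"
    using continuous_attains_inf[of "cball (0::complex) 1" "\<lambda>z. cmod (c * z + d)"] by auto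
  have le1: "cmod (\<phi> z) \<le> 1" if "z \<in> cball 0 1" for z
    using le[OF that] nz'[OF that] by (simp add: \<phi> norm_divide divide_le_eq)
  show ?thesis
    by (rule that[OF D \<phi> _ x(2) le1 lt]) (use nz'[OF x(1)] in auto)
qed

lemma linear_fractional_deriv:
  fixes a b c d :: complex
  assumes "c * z + d \<noteq> 0"
  shows "((\<lambda>z. (a * z + b) / (c * z + d)) has_field_derivative (a * d - b * c) / (c * z + d)\<^sup>2) (at z)"
  using assms by (auto intro!: derivative_eq_intros simp: power2_eq_square) (simp add: field_simps)

lemma linear_fractional_diff:
  fixes a b c d :: complex
  assumes "c * z + d \<noteq> 0" "c * w + d \<noteq> 0"
  shows "(a * z + b) / (c * z + d) - (a * w + b) / (c * w + d) = (a * d - b * c) * (z - w) / ((c * z + d) * (c * w + d))"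
proof -
  have "(a * z + b) / (c * z + d) - (a * w + b) / (c * w + d) = ((a * z + b) * (c * w + d) - (a * w + b) * (c * z + d)) / ((c * z + d) * (c * w + d))"
    using assms by (simp add: diff_frac_eq)
  also have "(a * z + b) * (c * w + d) - (a * w + b) * (c * z + d) = (a * d - b * c) * (z - w)"
    by (simp add: algebra_simps)
  finally show ?thesis .
qed

lemma linear_fractional_self_map_disk:
  assumes "linear_fractional_self_map \<phi>"
  shows "\<phi> holomorphic_on disk" "inj_on \<phi> disk" "\<And>z. z \<in> disk \<Longrightarrow> \<phi> z \<in> disk" "\<And>z. z \<in> cball 0 1 \<Longrightarrow> cmod (\<phi> z) \<le> 1"
proof -
  obtain a b c d m where D: "a * d - b * c \<noteq> 0" and \<phi>: "\<phi> = (\<lambda>z. (a * z + b) / (c * z + d))"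
    and m: "0 < m" "\<And>z. z \<in> cball 0 1 \<Longrightarrow> m \<le> cmod (c * z + d)"
    and le: "\<And>z. z \<in> cball 0 1 \<Longrightarrow> cmod (\<phi> z) \<le> 1" and lt: "\<And>z. z \<in> disk \<Longrightarrow> cmod (\<phi> z) < 1"
    by (rule linear_fractional_self_mapE[OF assms]) (rule that; blast)
  have nz: "c * z + d \<noteq> 0" if "z \<in> disk" for z using m(1) m(2)[of z] that by force
  show "\<phi> holomorphic_on disk" unfolding \<phi> by (intro holomorphic_intros nz)
  show "inj_on \<phi> disk"
  proof (rule inj_onI)
    fix z w assume z: "z \<in> disk" "w \<in> disk" "\<phi> z = \<phi> w"
    then have "(a * d - b * c) * (z - w) / ((c * z + d) * (c * w + d)) = 0"
      using linear_fractional_diff[of c z d w a b] nz by (simp add: \<phi>)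
    then show "z = w" using D nz z by simp
  qed
  show "\<phi> z \<in> disk" if "z \<in> disk" for z using lt[OF that] by simp
  show "cmod (\<phi> z) \<le> 1" if "z \<in> cball 0 1" for z by (rule le[OF that])
qed

text \<open>
  The logarithmic derivative of \<open>\<phi>'\<close> is \<open>-2 c / (c z + d)\<close>, which explains the bound for the
  second derivative by the first.
\<close>

lemma linear_fractional_self_map_derivs:
  assumes "linear_fractional_self_map \<phi>"
  obtains k K where "0 < k" "0 < K" "\<And>z. z \<in> disk \<Longrightarrow> k \<le> cmod (deriv \<phi> z)" "\<And>z. z \<in> disk \<Longrightarrow> cmod (deriv \<phi> z) \<le> K"
    "\<And>z. z \<in> disk \<Longrightarrow> cmod (deriv (deriv \<phi>) z) \<le> K * cmod (deriv \<phi> z)"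
proof -
  obtain a b c d m where D: "a * d - b * c \<noteq> 0" and \<phi>: "\<phi> = (\<lambda>z. (a * z + b) / (c * z + d))"
    and m: "0 < m" "\<And>z. z \<in> cball 0 1 \<Longrightarrow> m \<le> cmod (c * z + d)"
    by (rule linear_fractional_self_mapE[OF assms]) (rule that; blast)
  define D where "D = a * d - b * c"
  have D0: "cmod D > 0" using D by (simp add: D_def)
  define k where "k = cmod D / (cmod c + cmod d)\<^sup>2"
  define K where "K = cmod D / m\<^sup>2 + 2 * cmod c / m"
  have m': "m \<le> cmod (c * z + d)" if "z \<in> disk" for z using m(2)[of z] that by simp
  have nz: "c * z + d \<noteq> 0" if "z \<in> disk" for z using m(1) m'[OF that] by force
  have up: "cmod (c * z + d) \<le> cmod c + cmod d" if "z \<in> disk" for z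
  proof -
    have "cmod (c * z + d) \<le> cmod c * cmod z + cmod d" by (metis norm_mult norm_triangle_ineq)
    also have "cmod c * cmod z \<le> cmod c * 1" using that by (intro mult_left_mono) auto
    finally show ?thesis by simp
  qed
  have "m \<le> cmod d" using m'[of 0] by simp
  then have pos: "0 < cmod c + cmod d" using m(1) norm_ge_zero[of c] by linarith
  have der: "deriv \<phi> z = D / (c * z + d)\<^sup>2" if "z \<in> disk" for z
    unfolding \<phi> D_def by (intro DERIV_imp_deriv linear_fractional_deriv nz that)
  have der2: "deriv (deriv \<phi>) z = - (2 * c) / (c * z + d) * deriv \<phi> z" if z: "z \<in> disk" for z
  proof -
    have ev: "\<forall>\<^sub>F w in nhds z. w \<in> disk" using z by (intro eventually_nhds_in_open) auto
    have "deriv (deriv \<phi>) z = deriv (\<lambda>w. D / (c * w + d)\<^sup>2) z"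
      by (intro deriv_cong_ev eventually_mono[OF ev] der) auto
    also have "\<dots> = - (2 * c) * D / (c * z + d) ^ 3"
    proof -
      have "((\<lambda>x. D / x\<^sup>2) has_field_derivative - (2 * D) / x ^ 3) (at x)" if "x \<noteq> 0" for x
        using that by (auto intro!: derivative_eq_intros simp: field_simps power2_eq_square power3_eq_cube)
      moreover have "((\<lambda>w. c * w + d) has_field_derivative c) (at z)" by (auto intro!: derivative_eq_intros)
      ultimately have "((\<lambda>w. D / (c * w + d)\<^sup>2) has_field_derivative - (2 * D) / (c * z + d) ^ 3 * c) (at z)"
        using nz[OF z] by (intro DERIV_chain2[of "\<lambda>x. D / x\<^sup>2"]) auto
      then show ?thesis by (simp add: DERIV_imp_deriv mult_ac)
    qed
    also have "\<dots> = - (2 * c) / (c * z + d) * deriv \<phi> z"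
      using nz[OF z] by (simp add: der[OF z] power2_eq_square power3_eq_cube)
    finally show ?thesis .
  qed
  show ?thesis
  proof (rule that[of k K])
    show "0 < k" using D0 pos by (simp add: k_def)
    show "0 < K" using D0 m(1) unfolding K_def by (intro add_pos_nonneg) auto
    fix z assume z: "z \<in> disk"
    have "k \<le> cmod D / (cmod (c * z + d))\<^sup>2"
      unfolding k_def using nz[OF z] up[OF z] by (intro divide_left_mono power_mono mult_pos_pos) (auto simp: pos)
    then show "k \<le> cmod (deriv \<phi> z)" by (simp add: der[OF z] norm_divide norm_power)
    have "cmod D / (cmod (c * z + d))\<^sup>2 \<le> cmod D / m\<^sup>2"
      using nz[OF z] m(1) m'[OF z] by (intro divide_left_mono power_mono mult_pos_pos) auto
    then have "cmod (deriv \<phi> z) \<le> cmod D / m\<^sup>2" by (simp add: der[OF z] norm_divide norm_power)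
    also have "\<dots> \<le> K" using m(1) by (simp add: K_def)
    finally show "cmod (deriv \<phi> z) \<le> K" .
    have "cmod (- (2 * c) / (c * z + d)) \<le> 2 * cmod c / m"
      unfolding norm_divide norm_minus_cancel norm_mult using m(1) m'[OF z] nz[OF z] by (simp add: frac_le)
    also have "\<dots> \<le> K" by (simp add: K_def)
    finally show "cmod (deriv (deriv \<phi>) z) \<le> K * cmod (deriv \<phi> z)"
      unfolding der2[OF z] norm_mult by (intro mult_right_mono) auto
  qed
qed

text \<open>
  A denominator bounded below by \<open>m\<close> on the closed disk is still at least \<open>m / 2\<close> on a
  slightly larger disk.
\<close>

lemma linear_fractional_self_map_extension:
  assumes "linear_fractional_self_map \<phi>"
  obtains R L where "R > 1" "L > 0" "\<phi> holomorphic_on ball 0 R" "\<And>z. z \<in> ball 0 R \<Longrightarrow> cmod (deriv \<phi> z) \<le> L"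
    "\<And>z w. z \<in> ball 0 R \<Longrightarrow> w \<in> cball 0 1 \<Longrightarrow> cmod (\<phi> z - \<phi> w) \<le> L * cmod (z - w)"
proof -
  obtain a b c d m where D: "a * d - b * c \<noteq> 0" and \<phi>: "\<phi> = (\<lambda>z. (a * z + b) / (c * z + d))"
    and m: "0 < m" "\<And>z. z \<in> cball 0 1 \<Longrightarrow> m \<le> cmod (c * z + d)"
    by (rule linear_fractional_self_mapE[OF assms]) (rule that; blast)
  \<comment> \<open>moving by at most \<open>r\<close> changes the denominator by at most \<open>m / 2\<close>; the summand 1 covers \<open>c = 0\<close>\<close>
  define r where "r = m / (2 * (cmod c + 1))"
  have r: "r > 0" "cmod c * r \<le> m / 2"
  proof -
    have "cmod c + 1 > 0" by (smt (verit) norm_ge_zero)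
    then show "r > 0" using m(1) by (simp add: r_def)
    have "cmod c * r \<le> (cmod c + 1) * r" using \<open>r > 0\<close> by (intro mult_right_mono) auto
    also have "\<dots> = m / 2" using \<open>cmod c + 1 > 0\<close> by (simp add: r_def field_simps)
    finally show "cmod c * r \<le> m / 2" .
  qed
  define L where "L = cmod (a * d - b * c) / (m / 2)\<^sup>2"
  have L: "L > 0" using D m(1) by (simp add: L_def)
  have half: "m / 2 \<le> cmod (c * z + d)" if z: "z \<in> ball 0 (1 + r)" for z
  proof (cases "z \<in> cball 0 1")
    case True
    then show ?thesis using m(1) m(2)[of z] by simp
  next
    case False
    define w where "w = z / of_real (cmod z)"
    have z1: "cmod z > 1" using False by simp
    have z0: "z \<noteq> 0" using z1 by (cases "z = 0") simp_all
    have w1: "w \<in> cball 0 1" by (simp add: w_def norm_divide)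
    have "of_real (cmod z) * w = z" using z0 by (simp add: w_def)
    then have "z - w = of_real (cmod z - 1) * w" by (simp add: left_diff_distrib)
    then have "cmod (z - w) = (cmod z - 1) * cmod w" using z1 by (simp add: norm_mult del: of_real_diff)
    also have "cmod w = 1" using z0 by (simp add: w_def norm_divide)
    finally have zw: "cmod (z - w) \<le> r" using z by simp
    have "cmod (c * w + d) \<le> cmod (c * z + d) + cmod (c * (z - w))"
      using norm_triangle_ineq4[of "c * z + d" "c * (z - w)"] by (simp add: algebra_simps)
    moreover have "cmod (c * (z - w)) \<le> cmod c * r"
      unfolding norm_mult using zw by (intro mult_left_mono) auto
    ultimately show ?thesis using m(2)[OF w1] r(2) by linarith
  qed
  have nz: "c * z + d \<noteq> 0" if "z \<in> ball 0 (1 + r)" for z using half[OF that] m(1) by force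
  have cb: "w \<in> ball 0 (1 + r)" if "w \<in> cball 0 1" for w :: complex using that r(1) by simp
  show ?thesis
  proof (rule that[of "1 + r" L])
    show "\<phi> holomorphic_on ball 0 (1 + r)" unfolding \<phi> by (intro holomorphic_intros nz)
    fix z :: complex assume z: "z \<in> ball 0 (1 + r)"
    have "cmod (a * d - b * c) / (cmod (c * z + d))\<^sup>2 \<le> L"
      unfolding L_def using nz[OF z] half[OF z] m(1) by (intro divide_left_mono power_mono mult_pos_pos) auto
    moreover have "deriv \<phi> z = (a * d - b * c) / (c * z + d)\<^sup>2"
      unfolding \<phi> by (intro DERIV_imp_deriv linear_fractional_deriv nz z)
    ultimately show "cmod (deriv \<phi> z) \<le> L" by (simp add: norm_divide norm_power)
    fix w :: complex assume "w \<in> cball 0 1"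
    note w = cb[OF this]
    have "(m / 2)\<^sup>2 \<le> cmod (c * z + d) * cmod (c * w + d)"
      unfolding power2_eq_square using half[OF z] half[OF w] m(1) by (intro mult_mono) auto
    then have "cmod (a * d - b * c) * cmod (z - w) / (cmod (c * z + d) * cmod (c * w + d)) \<le> cmod (a * d - b * c) * cmod (z - w) / (m / 2)\<^sup>2"
      using nz[OF z] nz[OF w] m(1) by (intro divide_left_mono mult_pos_pos) auto
    moreover have "\<phi> z - \<phi> w = (a * d - b * c) * (z - w) / ((c * z + d) * (c * w + d))"
      unfolding \<phi> by (intro linear_fractional_diff nz z w)
    ultimately show "cmod (\<phi> z - \<phi> w) \<le> L * cmod (z - w)"
      by (simp add: norm_divide norm_mult L_def)
  qed (use r L in auto)
qed

section \<open>Boundedness of composition operators\<close>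

text \<open>
  The Schwarz lemma, applied to the map followed by the automorphism of the disk that moves
  the image of the origin back to the origin. It compares the distances of a point and of its
  image from the circle.
\<close>

lemma schwarz_pick_boundary:
  assumes f: "f holomorphic_on disk" and im: "\<And>z. z \<in> disk \<Longrightarrow> f z \<in> disk"
  obtains C where "C > 0" "\<And>z. z \<in> disk \<Longrightarrow> 1 - (cmod z)\<^sup>2 \<le> C * (1 - (cmod (f z))\<^sup>2)"
proof -
  define a where "a = f 0"
  have a: "cmod a < 1" using im[of 0] by (simp add: a_def)
  define g where "g = Moebius_function 0 a \<circ> f"
  have gh: "g holomorphic_on disk"
    unfolding g_def by (rule holomorphic_on_compose_gen[OF f Moebius_function_holomorphic[OF a]]) (use im in auto)
  have g0: "g 0 = 0" by (simp add: g_def a_def Moebius_function_eq_zero)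
  have g1: "cmod (g z) < 1" if "cmod z < 1" for z
    unfolding g_def o_def using im[of z] that by (intro Moebius_function_norm_lt_1 a) auto
  show ?thesis
  proof (rule that[of "1 / (1 - cmod a)\<^sup>2"])
    show "0 < 1 / (1 - cmod a)\<^sup>2" using a by simp
    fix z assume z: "z \<in> disk"
    define w where "w = f z"
    have w: "cmod w < 1" using im[OF z] by (simp add: w_def)
    have nz: "1 - cmod a \<le> cmod (1 - cnj a * w)"
    proof -
      have "cmod (cnj a * w) \<le> cmod a * 1" unfolding norm_mult using w by (intro mult_mono) auto
      then show ?thesis using norm_triangle_ineq2[of 1 "cnj a * w"] by simp
    qed
    then have pos: "cmod (1 - cnj a * w) > 0" using a by linarith
    have "cmod (g z) \<le> cmod z" using Schwarz_Lemma(1)[OF gh g0 g1] z by simp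
    then have "1 - (cmod z)\<^sup>2 \<le> 1 - (cmod (g z))\<^sup>2" by (simp add: power_mono)
    also have "cmod (g z) = cmod (w - a) / cmod (1 - cnj a * w)"
      by (simp add: g_def w_def Moebius_function_simple norm_divide)
    also have "1 - (cmod (w - a) / cmod (1 - cnj a * w))\<^sup>2
        = ((cmod (1 - cnj a * w))\<^sup>2 - (cmod (w - a))\<^sup>2) / (cmod (1 - cnj a * w))\<^sup>2"
      using pos by (simp add: power_divide diff_divide_distrib)
    also have "(cmod (1 - cnj a * w))\<^sup>2 - (cmod (w - a))\<^sup>2 = (1 - (cmod a)\<^sup>2) * (1 - (cmod w)\<^sup>2)"
      by (simp add: cmod_power2) (simp add: power2_eq_square algebra_simps)
    also have "(1 - (cmod a)\<^sup>2) * (1 - (cmod w)\<^sup>2) / (cmod (1 - cnj a * w))\<^sup>2 \<le> 1 * (1 - (cmod w)\<^sup>2) / (1 - cmod a)\<^sup>2"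
      using a w nz by (intro frac_le mult_right_mono power_mono) (auto simp: power_le_one)
    finally show "1 - (cmod z)\<^sup>2 \<le> 1 / (1 - cmod a)\<^sup>2 * (1 - (cmod (f z))\<^sup>2)" by (simp add: w_def)
  qed
qed

text \<open>
  For a nonnegative exponent the weight at a point is at most a multiple of the weight at its
  image, by the preceding lemma. The remaining integral is transformed by the change of
  variables formula.
\<close>

lemma bergman_substitution_le:
  assumes \<beta>: "\<beta> \<ge> 0" and \<phi>: "\<phi> holomorphic_on disk" "inj_on \<phi> disk" "\<And>z. z \<in> disk \<Longrightarrow> \<phi> z \<in> disk"
  obtains C where "C > 0" "\<And>G. G holomorphic_on disk \<Longrightarrow>
    (\<integral>\<^sup>+z. ennreal ((cmod (G (\<phi> z)))\<^sup>2 * (cmod (deriv \<phi> z))\<^sup>2) \<partial>weighted_area \<beta>) \<le> ennreal C * bergman_sq \<beta> G"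
proof -
  obtain C where C: "C > 0" "\<And>z. z \<in> disk \<Longrightarrow> 1 - (cmod z)\<^sup>2 \<le> C * (1 - (cmod (\<phi> z))\<^sup>2)"
    by (rule schwarz_pick_boundary[OF \<phi>(1,3)]; (rule that)?; blast)
  have \<beta>': "\<beta> > -1" using \<beta> by simp
  have dens: "area_density \<beta> z \<le> ennreal (C powr \<beta>) * area_density \<beta> (\<phi> z)" if z: "z \<in> disk" for z
  proof -
    have "0 \<le> 1 - (cmod z)\<^sup>2" using z by (simp add: power_le_one)
    then have "(1 - (cmod z)\<^sup>2) powr \<beta> \<le> (C * (1 - (cmod (\<phi> z))\<^sup>2)) powr \<beta>"
      using C(2)[OF z] \<beta> by (intro powr_mono2) auto
    also have "\<dots> = C powr \<beta> * (1 - (cmod (\<phi> z))\<^sup>2) powr \<beta>"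
      by (rule powr_mult)
    finally have "(1 + \<beta>) / pi * (1 - (cmod z)\<^sup>2) powr \<beta> \<le> (1 + \<beta>) / pi * (C powr \<beta> * (1 - (cmod (\<phi> z))\<^sup>2) powr \<beta>)"
      using \<beta> by (intro mult_left_mono) auto
    also have "\<dots> = C powr \<beta> * ((1 + \<beta>) / pi * (1 - (cmod (\<phi> z))\<^sup>2) powr \<beta>)" by (simp only: mult_ac)
    finally show ?thesis unfolding area_density_def by (subst ennreal_mult'[symmetric]) (auto intro: ennreal_leI)
  qed
  show ?thesis
  proof (rule that[of "C powr \<beta>"])
    fix G assume G: "G holomorphic_on disk"
    define h where "h w = ennreal ((cmod (indicator disk w *\<^sub>R G w))\<^sup>2) * area_density \<beta> w" for w
    have "(\<lambda>w. indicator disk w *\<^sub>R G w) \<in> borel_measurable borel"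
      by (intro borel_measurable_continuous_on_indicator holomorphic_on_imp_continuous_on G) auto
    then have h: "h \<in> borel_measurable borel" unfolding h_def by measurable
    have Gm: "(\<lambda>z. ennreal ((cmod (G z))\<^sup>2)) \<in> borel_measurable (weighted_area \<beta>)"
      by (intro continuous_on_borel_measurable_weighted_area continuous_on_ennreal continuous_intros holomorphic_on_imp_continuous_on G)
    have \<phi>m: "continuous_on disk (\<lambda>z. G (\<phi> z))" "continuous_on disk (deriv \<phi>)"
      using holomorphic_on_compose_gen[OF \<phi>(1) G] \<phi>(3) holomorphic_deriv[OF \<phi>(1) open_ball]
      by (auto simp: o_def image_subset_iff intro!: holomorphic_on_imp_continuous_on)
    have "(\<integral>\<^sup>+z. ennreal ((cmod (G (\<phi> z)))\<^sup>2 * (cmod (deriv \<phi> z))\<^sup>2) \<partial>weighted_area \<beta>)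
        = (\<integral>\<^sup>+z. ennreal ((cmod (G (\<phi> z)))\<^sup>2 * (cmod (deriv \<phi> z))\<^sup>2) * area_density \<beta> z * indicator disk z \<partial>lborel)"
      by (intro nn_integral_weighted_area \<beta>' continuous_on_borel_measurable_weighted_area continuous_on_ennreal continuous_intros \<phi>m)
    also have "\<dots> \<le> (\<integral>\<^sup>+z. (ennreal (C powr \<beta>) * h (\<phi> z)) * ennreal ((cmod (deriv \<phi> z))\<^sup>2) * indicator disk z \<partial>lborel)"
    proof (intro nn_integral_mono)
      fix z :: complex
      show "ennreal ((cmod (G (\<phi> z)))\<^sup>2 * (cmod (deriv \<phi> z))\<^sup>2) * area_density \<beta> z * indicator disk z
        \<le> (ennreal (C powr \<beta>) * h (\<phi> z)) * ennreal ((cmod (deriv \<phi> z))\<^sup>2) * indicator disk z"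
      proof (cases "z \<in> disk")
        case True
        have "h (\<phi> z) = ennreal ((cmod (G (\<phi> z)))\<^sup>2) * area_density \<beta> (\<phi> z)"
          using \<phi>(3)[OF True] by (simp add: h_def)
        moreover have "ennreal ((cmod (G (\<phi> z)))\<^sup>2 * (cmod (deriv \<phi> z))\<^sup>2) = ennreal ((cmod (G (\<phi> z)))\<^sup>2) * ennreal ((cmod (deriv \<phi> z))\<^sup>2)"
          by (rule ennreal_mult) auto
        moreover have "ennreal ((cmod (G (\<phi> z)))\<^sup>2) * ennreal ((cmod (deriv \<phi> z))\<^sup>2) * area_density \<beta> z
          \<le> ennreal ((cmod (G (\<phi> z)))\<^sup>2) * ennreal ((cmod (deriv \<phi> z))\<^sup>2) * (ennreal (C powr \<beta>) * area_density \<beta> (\<phi> z))"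
          by (intro mult_left_mono dens True) simp
        ultimately show ?thesis using True by (simp add: mult_ac)
      qed simp
    qed
    also have "\<dots> = (\<integral>\<^sup>+w. ennreal (C powr \<beta>) * h w * indicator (\<phi> ` disk) w \<partial>lborel)"
      using h by (intro nn_integral_holomorphic_substitution[symmetric] \<phi> open_ball borel_measurable_times_ennreal) auto
    also have "\<dots> \<le> (\<integral>\<^sup>+w. ennreal (C powr \<beta>) * (ennreal ((cmod (G w))\<^sup>2) * area_density \<beta> w * indicator disk w) \<partial>lborel)"
    proof (intro nn_integral_mono)
      fix w :: complex
      show "ennreal (C powr \<beta>) * h w * indicator (\<phi> ` disk) w \<le> ennreal (C powr \<beta>) * (ennreal ((cmod (G w))\<^sup>2) * area_density \<beta> w * indicator disk w)"
        using \<phi>(3) by (cases "w \<in> \<phi> ` disk") (auto simp: h_def mult_ac)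
    qed
    also have "\<dots> = ennreal (C powr \<beta>) * (\<integral>\<^sup>+w. ennreal ((cmod (G w))\<^sup>2) * area_density \<beta> w * indicator disk w \<partial>lborel)"
    proof (rule nn_integral_cmult)
      have "h = (\<lambda>w. ennreal ((cmod (G w))\<^sup>2) * area_density \<beta> w * indicator disk w)"
        by (auto simp: h_def fun_eq_iff indicator_def)
      then show "(\<lambda>w. ennreal ((cmod (G w))\<^sup>2) * area_density \<beta> w * indicator disk w) \<in> borel_measurable lborel"
        using h by simp
    qed
    also have "(\<integral>\<^sup>+w. ennreal ((cmod (G w))\<^sup>2) * area_density \<beta> w * indicator disk w \<partial>lborel) = bergman_sq \<beta> G"
      by (rule nn_integral_weighted_area[OF \<beta>' Gm, symmetric])
    finally show "(\<integral>\<^sup>+z. ennreal ((cmod (G (\<phi> z)))\<^sup>2 * (cmod (deriv \<phi> z))\<^sup>2) \<partial>weighted_area \<beta>) \<le> ennreal (C powr \<beta>) * bergman_sq \<beta> G" .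
  qed (use C in simp)
qed

text \<open>
  The direct change of variables fails for negative \<open>\<alpha>\<close>. Passing to the derivative of
  \<open>F (\<phi> z) * \<phi>' z\<close> raises the exponent to \<open>\<alpha> + 2 > 0\<close>, where it works. Both terms
  of this derivative carry a factor \<open>\<phi>'\<close>, as the substitution requires, because the second
  derivative of \<open>\<phi>\<close> is dominated by the first.
\<close>

lemma bergman_sq_compose_le:
  assumes \<alpha>: "\<alpha> > -1" and lf: "linear_fractional_self_map \<phi>"
  obtains C where "C > 0" "\<And>F. F holomorphic_on disk \<Longrightarrow> bergman_sq \<alpha> (\<lambda>z. F (\<phi> z) * deriv \<phi> z)
    \<le> ennreal ((cmod (F (\<phi> 0) * deriv \<phi> 0))\<^sup>2) + ennreal C * bergman_sq \<alpha> F"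
proof -
  note \<phi> = linear_fractional_self_map_disk[OF lf]
  obtain k K where K: "K > 0" "\<And>z. z \<in> disk \<Longrightarrow> cmod (deriv \<phi> z) \<le> K"
    "\<And>z. z \<in> disk \<Longrightarrow> cmod (deriv (deriv \<phi>) z) \<le> K * cmod (deriv \<phi> z)"
    by (rule linear_fractional_self_map_derivs[OF lf]) (rule that; blast)
  have \<alpha>2: "\<alpha> + 2 \<ge> 0" "\<alpha> + 2 > -1" using \<alpha> by auto
  obtain C where C: "C > 0" "\<And>G. G holomorphic_on disk \<Longrightarrow>
    (\<integral>\<^sup>+z. ennreal ((cmod (G (\<phi> z)))\<^sup>2 * (cmod (deriv \<phi> z))\<^sup>2) \<partial>weighted_area (\<alpha> + 2)) \<le> ennreal C * bergman_sq (\<alpha> + 2) G"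
    by (rule bergman_substitution_le[OF \<alpha>2(1) \<phi>(1-3)]; (rule that)?; blast)
  define B where "B = 2 * K\<^sup>2 * (C * ((\<alpha> + 2) * (\<alpha> + 3))) + 2 * K\<^sup>2 * (C * ((\<alpha> + 3) / (\<alpha> + 1)))"
  have dh: "deriv \<phi> holomorphic_on disk" by (rule holomorphic_deriv[OF \<phi>(1) open_ball])
  show ?thesis
  proof (rule that[of B])
    have "\<alpha> + 1 > 0" "\<alpha> + 2 > 0" "\<alpha> + 3 > 0" using \<alpha> by auto
    then have "2 * K\<^sup>2 * (C * ((\<alpha> + 2) * (\<alpha> + 3))) > 0" "2 * K\<^sup>2 * (C * ((\<alpha> + 3) / (\<alpha> + 1))) > 0"
      using K(1) C(1) by simp_all
    then show "B > 0" unfolding B_def by (rule add_pos_pos)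
    fix F assume F: "F holomorphic_on disk"
    have F': "deriv F holomorphic_on disk" by (rule holomorphic_deriv[OF F open_ball])
    have comp: "(\<lambda>z. H (\<phi> z)) holomorphic_on disk" if "H holomorphic_on disk" for H
      using holomorphic_on_compose_gen[OF \<phi>(1) that] \<phi>(3) by (auto simp: o_def image_subset_iff)
    define g where "g z = F (\<phi> z) * deriv \<phi> z" for z
    have g: "g holomorphic_on disk" unfolding g_def by (intro holomorphic_on_mult comp F dh)
    have dg: "deriv g z = deriv F (\<phi> z) * deriv \<phi> z * deriv \<phi> z + F (\<phi> z) * deriv (deriv \<phi>) z" if z: "z \<in> disk" for z
    proof -
      have 1: "(F has_field_derivative deriv F (\<phi> z)) (at (\<phi> z))" by (rule holomorphic_derivI[OF F open_ball \<phi>(3)[OF z]])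
      have 2: "(\<phi> has_field_derivative deriv \<phi> z) (at z)" by (rule holomorphic_derivI[OF \<phi>(1) open_ball z])
      have 3: "(deriv \<phi> has_field_derivative deriv (deriv \<phi>) z) (at z)" by (rule holomorphic_derivI[OF dh open_ball z])
      have "(g has_field_derivative (deriv F (\<phi> z) * deriv \<phi> z) * deriv \<phi> z + deriv (deriv \<phi>) z * F (\<phi> z)) (at z)"
        unfolding g_def by (rule DERIV_mult[OF DERIV_chain2[OF 1 2] 3])
      then show ?thesis by (simp add: DERIV_imp_deriv mult.commute)
    qed
    let ?A = "\<lambda>H z. ennreal ((cmod (H (\<phi> z)))\<^sup>2 * (cmod (deriv \<phi> z))\<^sup>2)"
    have Am: "?A H \<in> borel_measurable (weighted_area (\<alpha> + 2))" if "H holomorphic_on disk" for H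
      by (intro continuous_on_borel_measurable_weighted_area continuous_on_ennreal continuous_intros
          holomorphic_on_imp_continuous_on comp that dh)
    have "bergman_sq (\<alpha> + 2) (deriv g) \<le> (\<integral>\<^sup>+z. ennreal (2 * K\<^sup>2) * ?A (deriv F) z + ennreal (2 * K\<^sup>2) * ?A F z \<partial>weighted_area (\<alpha> + 2))"
    proof (rule nn_integral_mono)
      fix z assume "z \<in> space (weighted_area (\<alpha> + 2))"
      then have z: "z \<in> disk" by simp
      let ?x = "cmod (deriv F (\<phi> z)) * cmod (deriv \<phi> z)" let ?y = "cmod (F (\<phi> z)) * cmod (deriv \<phi> z)"
      have "cmod (deriv g z) \<le> ?x * cmod (deriv \<phi> z) + cmod (F (\<phi> z)) * cmod (deriv (deriv \<phi>) z)"
        unfolding dg[OF z] by (rule order_trans[OF norm_triangle_ineq]) (simp add: norm_mult)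
      also have "\<dots> \<le> ?x * K + cmod (F (\<phi> z)) * (K * cmod (deriv \<phi> z))"
        by (intro add_mono mult_left_mono K z) auto
      also have "\<dots> = K * ?x + K * ?y" by (simp add: mult_ac)
      finally have "(cmod (deriv g z))\<^sup>2 \<le> (K * ?x + K * ?y)\<^sup>2" by (intro power_mono) auto
      also have "\<dots> \<le> 2 * (K * ?x)\<^sup>2 + 2 * (K * ?y)\<^sup>2"
        using sum_squares_bound[of "K * ?x" "K * ?y"] by (simp add: power2_sum)
      also have "\<dots> = 2 * K\<^sup>2 * ((cmod (deriv F (\<phi> z)))\<^sup>2 * (cmod (deriv \<phi> z))\<^sup>2) + 2 * K\<^sup>2 * ((cmod (F (\<phi> z)))\<^sup>2 * (cmod (deriv \<phi> z))\<^sup>2)"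
        by (simp add: power_mult_distrib mult_ac)
      finally have "ennreal ((cmod (deriv g z))\<^sup>2) \<le> ennreal (2 * K\<^sup>2 * ((cmod (deriv F (\<phi> z)))\<^sup>2 * (cmod (deriv \<phi> z))\<^sup>2) + 2 * K\<^sup>2 * ((cmod (F (\<phi> z)))\<^sup>2 * (cmod (deriv \<phi> z))\<^sup>2))"
        by (rule ennreal_leI)
      also have "\<dots> = ennreal (2 * K\<^sup>2) * ?A (deriv F) z + ennreal (2 * K\<^sup>2) * ?A F z"
        by (simp only: ennreal_plus ennreal_mult mult_nonneg_nonneg zero_le_power2 zero_le_numeral)
      finally show "ennreal ((cmod (deriv g z))\<^sup>2) \<le> ennreal (2 * K\<^sup>2) * ?A (deriv F) z + ennreal (2 * K\<^sup>2) * ?A F z" .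
    qed
    also have "\<dots> = ennreal (2 * K\<^sup>2) * (\<integral>\<^sup>+z. ?A (deriv F) z \<partial>weighted_area (\<alpha> + 2)) + ennreal (2 * K\<^sup>2) * (\<integral>\<^sup>+z. ?A F z \<partial>weighted_area (\<alpha> + 2))"
      using Am[OF F] Am[OF F'] by (simp add: nn_integral_add nn_integral_cmult)
    also have "\<dots> \<le> ennreal (2 * K\<^sup>2) * (ennreal C * (ennreal ((\<alpha> + 2) * (\<alpha> + 3)) * bergman_sq \<alpha> F))
        + ennreal (2 * K\<^sup>2) * (ennreal C * (ennreal ((\<alpha> + 3) / (\<alpha> + 1)) * bergman_sq \<alpha> F))"
      using order_trans[OF C(2)[OF F'] mult_left_mono[OF bergman_sq_deriv_le[OF \<alpha> F]]]
        order_trans[OF C(2)[OF F] mult_left_mono[OF bergman_sq_raise_weight[OF \<alpha> F]]]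
      by (intro add_mono mult_left_mono) auto
    also have "\<dots> = ennreal B * bergman_sq \<alpha> F"
    proof -
      have n: "0 \<le> (\<alpha> + 2) * (\<alpha> + 3)" "0 \<le> (\<alpha> + 3) / (\<alpha> + 1)" "0 \<le> 2 * K\<^sup>2" "0 \<le> C" using \<alpha> C(1) by auto
      have "ennreal B = ennreal (2 * K\<^sup>2) * (ennreal C * ennreal ((\<alpha> + 2) * (\<alpha> + 3))) + ennreal (2 * K\<^sup>2) * (ennreal C * ennreal ((\<alpha> + 3) / (\<alpha> + 1)))"
        unfolding B_def using n by (simp only: ennreal_plus ennreal_mult mult_nonneg_nonneg)
      then show ?thesis by (simp only: distrib_right mult.assoc)
    qed
    finally have "bergman_sq (\<alpha> + 2) (deriv g) \<le> ennreal B * bergman_sq \<alpha> F" .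
    then have "bergman_sq \<alpha> g \<le> ennreal ((cmod (g 0))\<^sup>2) + ennreal B * bergman_sq \<alpha> F"
      using bergman_sq_le_deriv[OF \<alpha> g] by (meson add_left_mono order_trans)
    then show "bergman_sq \<alpha> (\<lambda>z. F (\<phi> z) * deriv \<phi> z) \<le> ennreal ((cmod (F (\<phi> 0) * deriv \<phi> 0))\<^sup>2) + ennreal B * bergman_sq \<alpha> F"
      by (simp only: g_def)
  qed
qed

context weighted_dirichlet
begin

lemma bergman_sq_deriv_le_nrm:
  assumes "f \<in> D"
  shows "bergman_sq \<alpha> (deriv f) \<le> ennreal ((nrm f)\<^sup>2)"
proof -
  have "integrable (weighted_area \<alpha>) (\<lambda>z. (cmod (deriv f z))\<^sup>2)" using assms by (simp add: dirichlet_space_def)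
  then have "bergman_sq \<alpha> (deriv f) = ennreal (\<integral>z. (cmod (deriv f z))\<^sup>2 \<partial>weighted_area \<alpha>)"
    by (rule nn_integral_eq_integral) simp
  also have "\<dots> \<le> ennreal ((nrm f)\<^sup>2)" by (intro ennreal_leI) (simp add: nrm_sq)
  finally show ?thesis .
qed

lemma deriv_composition_operator:
  assumes lf: "linear_fractional_self_map \<phi>" and f: "f \<in> D"
  shows "composition_operator \<phi> f holomorphic_on disk"
    and "z \<in> disk \<Longrightarrow> deriv (composition_operator \<phi> f) z = deriv f (\<phi> z) * deriv \<phi> z"
proof -
  note \<phi> = linear_fractional_self_map_disk[OF lf]
  have "(f \<circ> \<phi>) holomorphic_on disk"
    by (rule holomorphic_on_compose_gen[OF \<phi>(1) D_holomorphic[OF f]]) (use \<phi>(3) in auto)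
  then show "composition_operator \<phi> f holomorphic_on disk"
    by (rule holomorphic_transform) (simp add: composition_operator_def)
  assume z: "z \<in> disk"
  have "(f has_field_derivative deriv f (\<phi> z)) (at (\<phi> z))" by (rule holomorphic_derivI[OF D_holomorphic[OF f] open_ball \<phi>(3)[OF z]])
  from DERIV_chain2[OF this holomorphic_derivI[OF \<phi>(1) open_ball z]]
  have "((\<lambda>z. f (\<phi> z)) has_field_derivative deriv f (\<phi> z) * deriv \<phi> z) (at z)" .
  then have "(composition_operator \<phi> f has_field_derivative deriv f (\<phi> z) * deriv \<phi> z) (at z)"
    by (rule has_field_derivative_transform_within_open[OF _ open_ball z]) (simp add: composition_operator_def)
  then show "deriv (composition_operator \<phi> f) z = deriv f (\<phi> z) * deriv \<phi> z" by (rule DERIV_imp_deriv)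
qed

text \<open>
  The estimate \<open>bergman_sq_compose_le\<close> for \<open>F = f'\<close> leaves the values of \<open>f\<close> and \<open>f'\<close> at \<open>\<phi> 0\<close>, which the
  reproducing kernels at that point control.
\<close>

theorem composition_operator_bounded:
  assumes lf: "linear_fractional_self_map \<phi>"
  shows "bounded_operator \<alpha> (composition_operator \<phi>)"
proof -
  let ?C = "composition_operator \<phi>" let ?M = "weighted_area \<alpha>"
  note \<phi> = linear_fractional_self_map_disk[OF lf]
  have \<phi>0: "\<phi> 0 \<in> disk" using \<phi>(3)[of 0] by simp
  obtain B where B: "B > 0" "\<And>F. F holomorphic_on disk \<Longrightarrow> bergman_sq \<alpha> (\<lambda>z. F (\<phi> z) * deriv \<phi> z)
    \<le> ennreal ((cmod (F (\<phi> 0) * deriv \<phi> 0))\<^sup>2) + ennreal B * bergman_sq \<alpha> F"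
    by (rule bergman_sq_compose_le[OF \<alpha> lf]) (rule that; blast)
  obtain k where k: "k \<in> D" "\<And>f. f \<in> D \<Longrightarrow> ip f k = f (\<phi> 0)" by (rule eval_kernel[OF \<phi>0]) (rule that; blast)
  define E where "E = (nrm (dkernel (\<phi> 0)) * cmod (deriv \<phi> 0))\<^sup>2 + B"
  have E: "E \<ge> 0" using B(1) by (simp add: E_def)
  have main: "?C f \<in> D \<and> nrm (?C f) \<le> sqrt ((nrm k)\<^sup>2 + E) * nrm f" if f: "f \<in> D" for f
  proof -
    note hol = deriv_composition_operator(1)[OF lf f]
    have "cmod (deriv f (\<phi> 0)) \<le> nrm f * nrm (dkernel (\<phi> 0))"
      using cmod_ip_le[OF f dkernel_coord(1)[OF \<phi>0]] ip_dkernel[OF f \<phi>0] by simp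
    then have "cmod (deriv f (\<phi> 0) * deriv \<phi> 0) \<le> nrm f * (nrm (dkernel (\<phi> 0)) * cmod (deriv \<phi> 0))"
      unfolding norm_mult mult.assoc[symmetric] by (intro mult_right_mono) auto
    then have d0: "(cmod (deriv f (\<phi> 0) * deriv \<phi> 0))\<^sup>2 \<le> (nrm f)\<^sup>2 * (nrm (dkernel (\<phi> 0)) * cmod (deriv \<phi> 0))\<^sup>2"
      by (metis norm_ge_zero power_mono power_mult_distrib)
    have "bergman_sq \<alpha> (deriv (?C f)) = bergman_sq \<alpha> (\<lambda>z. deriv f (\<phi> z) * deriv \<phi> z)"
      by (intro nn_integral_cong) (simp add: deriv_composition_operator(2)[OF lf f])
    also have "\<dots> \<le> ennreal ((cmod (deriv f (\<phi> 0) * deriv \<phi> 0))\<^sup>2) + ennreal B * bergman_sq \<alpha> (deriv f)"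
      by (intro B holomorphic_deriv D_holomorphic f open_ball)
    also have "\<dots> \<le> ennreal ((nrm f)\<^sup>2 * (nrm (dkernel (\<phi> 0)) * cmod (deriv \<phi> 0))\<^sup>2) + ennreal B * ennreal ((nrm f)\<^sup>2)"
      by (intro add_mono ennreal_leI d0 mult_left_mono bergman_sq_deriv_le_nrm f) simp
    also have "\<dots> = ennreal (E * (nrm f)\<^sup>2)"
      using B(1) by (simp add: E_def ennreal_plus[symmetric] ennreal_mult'[symmetric] algebra_simps del: ennreal_plus)
    finally have le: "bergman_sq \<alpha> (deriv (?C f)) \<le> ennreal (E * (nrm f)\<^sup>2)" .
    have int: "integrable ?M (\<lambda>z. (cmod (deriv (?C f) z))\<^sup>2)"
    proof (rule integrableI_bounded)
      show "(\<lambda>z. (cmod (deriv (?C f) z))\<^sup>2) \<in> borel_measurable ?M" using deriv_measurable[OF hol] by measurable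
      show "(\<integral>\<^sup>+z. ennreal (norm ((cmod (deriv (?C f) z))\<^sup>2)) \<partial>?M) < \<infinity>"
        using le by (simp add: le_less_trans[OF _ ennreal_less_top])
    qed
    then have "bergman_sq \<alpha> (deriv (?C f)) = ennreal (\<integral>z. (cmod (deriv (?C f) z))\<^sup>2 \<partial>?M)"
      by (rule nn_integral_eq_integral) simp
    then have I: "(\<integral>z. (cmod (deriv (?C f) z))\<^sup>2 \<partial>?M) \<le> E * (nrm f)\<^sup>2"
      using le E by (simp add: ennreal_le_iff)
    have "cmod (f (\<phi> 0)) \<le> nrm f * nrm k" using cmod_ip_le[OF f k(1)] k(2)[OF f] by simp
    then have "(cmod (?C f 0))\<^sup>2 \<le> (nrm f)\<^sup>2 * (nrm k)\<^sup>2"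
      unfolding composition_operator_def by (simp add: power_mono power_mult_distrib[symmetric])
    then have "(nrm (?C f))\<^sup>2 \<le> ((nrm k)\<^sup>2 + E) * (nrm f)\<^sup>2"
      using I by (simp add: nrm_sq algebra_simps)
    then have "sqrt ((nrm (?C f))\<^sup>2) \<le> sqrt (((nrm k)\<^sup>2 + E) * (nrm f)\<^sup>2)" by (rule real_sqrt_le_mono)
    then have "nrm (?C f) \<le> sqrt ((nrm k)\<^sup>2 + E) * nrm f" by (simp add: real_sqrt_mult)
    moreover have "?C f \<in> D"
      using hol int by (simp add: dirichlet_space_def) (simp add: composition_operator_def)
    ultimately show ?thesis by blast
  qed
  have "?C (f + g) = ?C f + ?C g" "?C (fscale c f) = fscale c (?C f)" for f g c
    by (auto simp: composition_operator_def fun_eq_iff)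
  then show ?thesis unfolding bounded_operator_def using main by blast
qed

end

section \<open>Geometric decay and singular values\<close>

text \<open>
  Gaussian elimination of one unknown per equation.
\<close>

lemma underdetermined_system_solution:
  fixes a :: "'b \<Rightarrow> nat \<Rightarrow> complex"
  assumes "finite C" "card C > N"
  shows "\<exists>u. (\<exists>b\<in>C. u b \<noteq> 0) \<and> (\<forall>n<N. (\<Sum>b\<in>C. u b * a b n) = 0)"
  using assms
proof (induction N arbitrary: C a)
  case 0
  then obtain b where "b \<in> C" by fastforce
  then show ?case by (intro exI[of _ "\<lambda>_. 1"]) auto
next
  case (Suc N)
  show ?case
  proof (cases "\<forall>b\<in>C. a b N = 0")
    case True
    obtain u where u: "\<exists>b\<in>C. u b \<noteq> 0" "\<forall>n<N. (\<Sum>b\<in>C. u b * a b n) = 0"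
      using Suc.IH[of C a] Suc.prems by auto
    have "(\<Sum>b\<in>C. u b * a b N) = 0" using True by simp
    then show ?thesis using u by (intro exI[of _ u]) (auto simp: less_Suc_eq)
  next
    case False
    then obtain b0 where b0: "b0 \<in> C" "a b0 N \<noteq> 0" by blast
    define C' where "C' = C - {b0}"
    define a' where "a' b n = a b n - a b N / a b0 N * a b0 n" for b n
    have C': "finite C'" "card C' > N" "b0 \<notin> C'" "C = insert b0 C'"
      using Suc.prems b0 by (auto simp: C'_def)
    obtain v where v: "\<exists>b\<in>C'. v b \<noteq> 0" "\<forall>n<N. (\<Sum>b\<in>C'. v b * a' b n) = 0"
      using Suc.IH[OF C'(1,2), of a'] by blast
    have vN: "(\<Sum>b\<in>C'. v b * a' b n) = 0" if "n < Suc N" for n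
    proof (cases "n = N")
      case True
      then show ?thesis using b0 by (simp add: a'_def)
    qed (use that v(2) in auto)
    \<comment> \<open>the value at \<open>b0\<close> solves equation \<open>N\<close>\<close>
    define u where "u = v(b0 := - (\<Sum>b\<in>C'. v b * a b N) / a b0 N)"
    have "(\<Sum>b\<in>C. u b * a b n) = (\<Sum>b\<in>C'. v b * a' b n)" for n
    proof -
      have "(\<Sum>b\<in>C. u b * a b n) = u b0 * a b0 n + (\<Sum>b\<in>C'. u b * a b n)"
        unfolding C'(4) using C'(1,3) by (rule sum.insert)
      also have "(\<Sum>b\<in>C'. u b * a b n) = (\<Sum>b\<in>C'. v b * a b n)"
        using C'(3) by (intro sum.cong) (auto simp: u_def)
      also have "u b0 * a b0 n = - (\<Sum>b\<in>C'. v b * (a b N / a b0 N * a b0 n))"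
      proof -
        have "(\<Sum>b\<in>C'. v b * (a b N / a b0 N * a b0 n)) = (\<Sum>b\<in>C'. v b * a b N) * (a b0 n / a b0 N)"
          unfolding sum_distrib_right by (intro sum.cong) auto
        then show ?thesis by (simp add: u_def)
      qed
      finally show ?thesis by (simp add: a'_def right_diff_distrib sum_subtractf)
    qed
    then have "\<forall>n<Suc N. (\<Sum>b\<in>C. u b * a b n) = 0" using vN by simp
    moreover have "\<exists>b\<in>C. u b \<noteq> 0" using v(1) C' by (auto simp: u_def)
    ultimately show ?thesis by blast
  qed
qed

text \<open>
  Multiplicities \<open>d\<close> with finite total mass on every \<open>{\<epsilon>..}\<close> can be listed in decreasing
  order. The \<open>n\<close>-th entry is the largest \<open>\<sigma>\<close> with \<open>d \<sigma> > 0\<close> such that the values from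
  \<open>\<sigma>\<close> upwards have total multiplicity more than \<open>n\<close>. The last conclusion allows an entry to
  be estimated from counting bounds.
\<close>

lemma decreasing_enumeration:
  fixes d :: "real \<Rightarrow> nat"
  assumes bnd: "\<And>\<epsilon>. \<epsilon> > 0 \<Longrightarrow> \<exists>K. \<forall>F. finite F \<longrightarrow> F \<subseteq> {\<epsilon>..} \<longrightarrow> sum d F \<le> K"
  obtains s :: "nat \<Rightarrow> real" where "decseq s" "\<And>n. 0 \<le> s n"
    "\<And>\<sigma>. \<sigma> > 0 \<Longrightarrow> finite {n. s n = \<sigma>} \<and> card {n. s n = \<sigma>} = d \<sigma>"
    "\<And>n. s n > 0 \<Longrightarrow> \<exists>F. finite F \<and> F \<subseteq> {s n..} \<and> n < sum d F"
proof -
  define A where "A \<epsilon> = {\<sigma>. \<epsilon> \<le> \<sigma> \<and> d \<sigma> > 0}" for \<epsilon> :: real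
  define M where "M \<epsilon> = sum d (A \<epsilon>)" for \<epsilon>
  have fin: "finite (A \<epsilon>)" if pos: "\<epsilon> > 0" for \<epsilon>
  proof (rule ccontr)
    assume inf: "infinite (A \<epsilon>)"
    obtain K where K: "\<And>F. finite F \<Longrightarrow> F \<subseteq> {\<epsilon>..} \<Longrightarrow> sum d F \<le> K" using bnd[OF pos] by blast
    obtain F where F: "finite F" "card F = Suc K" "F \<subseteq> A \<epsilon>"
      using infinite_arbitrarily_large[OF inf] by blast
    have "Suc K = (\<Sum>x\<in>F. 1)" using F by simp
    also have "\<dots> \<le> sum d F" by (intro sum_mono) (use F(3) in \<open>auto simp: A_def\<close>)
    also have "\<dots> \<le> K" by (rule K) (use F in \<open>auto simp: A_def\<close>)
    finally show False by simp
  qed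
  have Amono: "A b \<subseteq> A a" if "a \<le> b" for a b using that by (auto simp: A_def)
  have Mmono: "M b \<le> M a" if "0 < a" "a \<le> b" for a b
    unfolding M_def by (intro sum_mono2 fin Amono that) auto
  define P where "P n \<sigma> \<longleftrightarrow> \<sigma> > 0 \<and> d \<sigma> > 0 \<and> n < M \<sigma>" for n \<sigma>
  \<comment> \<open>the least element of a nonempty \<open>A \<epsilon>\<close> cuts off the same set\<close>
  have Amin: "\<exists>\<tau>\<in>A \<epsilon>. M \<tau> = M \<epsilon>" if "\<epsilon> > 0" "n < M \<epsilon>" for \<epsilon> n
  proof -
    have "A \<epsilon> \<noteq> {}" using that(2) by (auto simp: M_def)
    then have m: "Min (A \<epsilon>) \<in> A \<epsilon>" "\<And>x. x \<in> A \<epsilon> \<Longrightarrow> Min (A \<epsilon>) \<le> x" using fin[OF that(1)] by auto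
    then have "A (Min (A \<epsilon>)) = A \<epsilon>" by (force simp: A_def)
    then have "M (Min (A \<epsilon>)) = M \<epsilon>" unfolding M_def by (rule arg_cong)
    then show ?thesis using m(1) by blast
  qed
  have ex: "\<exists>m. P n m \<and> (\<forall>\<sigma>. P n \<sigma> \<longrightarrow> \<sigma> \<le> m)" if "\<epsilon> > 0" "n < M \<epsilon>" for n \<epsilon>
  proof -
    define Q where "Q = {\<sigma>\<in>A \<epsilon>. n < M \<sigma>}"
    have Q: "finite Q" "Q \<noteq> {}" using fin[OF that(1)] Amin[OF that] that(2) by (auto simp: Q_def)
    have "Max Q \<in> Q" using Q by (rule Max_in)
    then have "P n (Max Q)" using that(1) by (auto simp: Q_def P_def A_def)
    moreover have "\<sigma> \<le> Max Q" if "P n \<sigma>" for \<sigma>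
    proof (cases "\<epsilon> \<le> \<sigma>")
      case True
      then have "\<sigma> \<in> Q" using that by (auto simp: P_def Q_def A_def)
      then show ?thesis using Q by simp
    next
      case False
      then show ?thesis using \<open>Max Q \<in> Q\<close> by (auto simp: Q_def A_def)
    qed
    ultimately show ?thesis by blast
  qed
  define s where "s n = (if \<exists>\<epsilon>>0. n < M \<epsilon> then (SOME m. P n m \<and> (\<forall>\<sigma>. P n \<sigma> \<longrightarrow> \<sigma> \<le> m)) else 0)" for n
  have s_max: "P n (s n)" "\<And>\<sigma>. P n \<sigma> \<Longrightarrow> \<sigma> \<le> s n" if "\<epsilon> > 0" "n < M \<epsilon>" for n \<epsilon>
    using someI_ex[OF ex[OF that]] that by (auto simp: s_def)
  have s_pos: "P n (s n)" if "s n > 0" for n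
  proof -
    have "\<exists>\<epsilon>>0. n < M \<epsilon>" using that by (auto simp: s_def split: if_splits)
    then show ?thesis using s_max(1) by blast
  qed
  have s0: "0 \<le> s n" for n
  proof (cases "\<exists>\<epsilon>>0. n < M \<epsilon>")
    case True
    then show ?thesis using s_max(1) by (auto simp: P_def intro: less_imp_le)
  next
    case False
    then have "s n = 0" unfolding s_def by (rule if_not_P)
    then show ?thesis by simp
  qed
  have key: "\<sigma> \<le> s n \<longleftrightarrow> n < M \<sigma>" if \<sigma>: "\<sigma> > 0" for \<sigma> n
  proof
    assume "\<sigma> \<le> s n"
    then have "P n (s n)" using \<sigma> s_pos by auto
    then show "n < M \<sigma>" using Mmono[OF \<sigma> \<open>\<sigma> \<le> s n\<close>] by (auto simp: P_def)
  next
    assume n: "n < M \<sigma>"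
    obtain \<tau> where "\<tau> \<in> A \<sigma>" "M \<tau> = M \<sigma>" using Amin[OF \<sigma> n] by blast
    then have "P n \<tau>" "\<sigma> \<le> \<tau>" using n \<sigma> by (auto simp: P_def A_def)
    then show "\<sigma> \<le> s n" using s_max(2)[OF \<sigma> n] by force
  qed
  have "decseq s"
  proof (rule decseq_SucI)
    fix n show "s (Suc n) \<le> s n"
    proof (cases "s (Suc n) > 0")
      case True
      then show ?thesis using key[of "s (Suc n)" "Suc n"] key[of "s (Suc n)" n] by simp
    qed (use s0[of n] s0[of "Suc n"] in auto)
  qed
  moreover have "finite {n. s n = \<sigma>} \<and> card {n. s n = \<sigma>} = d \<sigma>" if \<sigma>: "\<sigma> > 0" for \<sigma>
  proof -
    define m where "m = sum d (A \<sigma> - {\<sigma>})"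
    have m: "M \<sigma> = m + d \<sigma>"
    proof (cases "d \<sigma> > 0")
      case True
      then have "\<sigma> \<in> A \<sigma>" by (simp add: A_def)
      then show ?thesis unfolding M_def m_def using sum.remove[OF fin[OF \<sigma>], of \<sigma> d] by simp
    next
      case False
      then have "A \<sigma> - {\<sigma>} = A \<sigma>" by (auto simp: A_def)
      then show ?thesis using False by (simp add: M_def m_def)
    qed
    have gt: "\<sigma> < s n \<longleftrightarrow> n < m" for n
    proof
      assume "\<sigma> < s n"
      then have "n < M (s n)" using key[of "s n" n] \<sigma> by simp
      also have "M (s n) \<le> m" unfolding M_def m_def
        by (intro sum_mono2) (use fin[OF \<sigma>] \<open>\<sigma> < s n\<close> in \<open>auto simp: A_def\<close>)
      finally show "n < m" .
    next
      assume n: "n < m"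
      define B where "B = A \<sigma> - {\<sigma>}"
      have B: "finite B" "B \<noteq> {}" 
      proof -
        show "finite B" using fin[OF \<sigma>] by (simp add: B_def)
        show "B \<noteq> {}"
        proof
          assume "B = {}"
          then have "m = 0" unfolding m_def B_def[symmetric] by simp
          then show False using n by simp
        qed
      qed
      have "Min B \<in> B" using B by simp
      then have gt: "Min B > \<sigma>" by (auto simp: B_def A_def)
      have "A (Min B) = B"
      proof
        show "A (Min B) \<subseteq> B" using gt by (auto simp: B_def A_def)
        show "B \<subseteq> A (Min B)" using Min_le[OF B(1)] by (auto simp: B_def A_def)
      qed
      then have "M (Min B) = m" by (simp add: M_def m_def B_def)
      then have "Min B \<le> s n" using key[of "Min B" n] gt \<sigma> n by simp
      then show "\<sigma> < s n" using gt by simp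
    qed
    have "s n = \<sigma> \<longleftrightarrow> n < M \<sigma> \<and> \<not> n < m" for n
      unfolding key[OF \<sigma>, symmetric] gt[symmetric] by auto
    then have "{n. s n = \<sigma>} = {n. n < M \<sigma> \<and> \<not> n < m}" by (rule Collect_cong)
    also have "\<dots> = {m..<M \<sigma>}" by auto
    finally show ?thesis using m by simp
  qed
  moreover have "\<exists>F. finite F \<and> F \<subseteq> {s n..} \<and> n < sum d F" if "s n > 0" for n
  proof (intro exI[of _ "A (s n)"] conjI)
    show "n < sum d (A (s n))" using key[OF that, of n] by (simp add: M_def)
  qed (use fin[OF that] in \<open>auto simp: A_def\<close>)
  ultimately show ?thesis using that s0 by blast
qed

interpretation cfun: vector_space fscale
  by unfold_locales (auto simp: fun_eq_iff algebra_simps)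

context weighted_dirichlet
begin

text \<open>
  A bounded sequence has a coordinatewise convergent subsequence by Tychonoff's theorem. Its
  limit is again square-summable, and the summable majorant turns coordinatewise convergence
  into norm convergence of the images.
\<close>

lemma compact_operator_if_summable:
  assumes T: "bounded_operator \<alpha> T" and sm: "summable (\<lambda>k. nrm (T (basis k)))"
  shows "compact_operator \<alpha> T"
  unfolding compact_operator_def
proof (intro conjI T allI impI)
  fix f :: "nat \<Rightarrow> complex \<Rightarrow> complex"
  assume fD: "range f \<subseteq> D" and "\<exists>B. \<forall>n. nrm (f n) \<le> B"
  then obtain B where B: "\<And>n. nrm (f n) \<le> B" by blast
  have f: "f n \<in> D" for n using fD by auto
  define K where "K = (PiE UNIV (\<lambda>_. cball 0 B) :: (nat \<Rightarrow> complex) set)"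
  have "compactin (product_topology (\<lambda>_::nat. euclidean :: complex topology) UNIV) K"
    unfolding K_def by (subst compactin_PiE) auto
  then have "compact K" by (simp add: euclidean_product_topology)
  then have sc: "seq_compact K" by (rule compact_imp_seq_compact)
  have inK: "coord (f n) \<in> K" for n
    unfolding K_def by (auto intro: order_trans[OF cmod_coord_le[OF f] B])
  have "\<exists>l\<in>K. \<exists>r::nat \<Rightarrow> nat. strict_mono r \<and> ((\<lambda>n. coord (f n)) \<circ> r) \<longlonglongrightarrow> l"
    by (rule mp[OF spec[OF sc[unfolded seq_compact_def], of "\<lambda>n. coord (f n)"]]) (simp add: inK)
  then obtain y r where r: "strict_mono (r :: nat \<Rightarrow> nat)" and y: "((\<lambda>n. coord (f n)) \<circ> r) \<longlonglongrightarrow> y"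
    by blast
  have lim: "(\<lambda>n. coord (f (r n)) k) \<longlonglongrightarrow> y k" for k
    using continuous_on_tendsto_compose[OF continuous_on_product_coordinates[of k] y] by (simp add: o_def)
  have B0: "B \<ge> 0" using B[of 0] nrm_nonneg[of "f 0"] by linarith
  have "(\<Sum>k<N. (cmod (y k))\<^sup>2) \<le> B\<^sup>2" for N
  proof (rule LIMSEQ_le_const2)
    show "(\<lambda>n. \<Sum>k<N. (cmod (coord (f (r n)) k))\<^sup>2) \<longlonglongrightarrow> (\<Sum>k<N. (cmod (y k))\<^sup>2)"
      by (intro tendsto_intros lim)
    have "(\<Sum>k<N. (cmod (coord (f (r n)) k))\<^sup>2) \<le> B\<^sup>2" for n
    proof -
      have "(\<Sum>k<N. (cmod (coord (f (r n)) k))\<^sup>2) \<le> (nrm (f (r n)))\<^sup>2"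
        by (intro sum_coord_sq_le f) simp
      also have "\<dots> \<le> B\<^sup>2" by (intro power_mono B) simp
      finally show ?thesis .
    qed
    then show "\<exists>N'. \<forall>n\<ge>N'. (\<Sum>k<N. (cmod (coord (f (r n)) k))\<^sup>2) \<le> B\<^sup>2" by blast
  qed
  from this[of "Suc _"] have "summable (\<lambda>k. (cmod (y k))\<^sup>2)"
    by (intro bounded_imp_summable[of "\<lambda>k. (cmod (y k))\<^sup>2" "B\<^sup>2"] zero_le_power2) (simp only: lessThan_Suc_atMost)
  then obtain g where g: "g \<in> D" "\<And>k. coord g k = y k" by (rule D_synthesis) auto
  have gB: "cmod (y k) \<le> B" for k
    by (rule LIMSEQ_le_const2[OF tendsto_norm[OF lim[of k]]])
      (use cmod_coord_le[OF f] B order_trans in blast)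
  define t where "t n k = cmod (coord (f (r n)) k - y k) * nrm (T (basis k))" for n k
  have tle: "t n k \<le> 2 * B * nrm (T (basis k))" for n k
  proof -
    have "cmod (coord (f (r n)) k - y k) \<le> cmod (coord (f (r n)) k) + cmod (y k)" by (rule norm_triangle_ineq4)
    also have "\<dots> \<le> 2 * B" using cmod_coord_le[OF f[of "r n"], of k] B[of "r n"] gB[of k] by linarith
    finally show ?thesis unfolding t_def by (intro mult_right_mono) auto
  qed
  have t0: "t n k \<ge> 0" for n k by (simp add: t_def)
  have ts: "summable (t n)" for n
    by (rule summable_comparison_test'[OF summable_mult[OF sm, of "2 * B"]]) (use tle t0 in auto)
  have bound: "nrm (T (f (r n)) - T g) \<le> suminf (t n)" for n
  proof -
    have d: "f (r n) - g \<in> D" using f g D_diff by blast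
    have "nrm (T (f (r n) - g)) \<le> suminf (t n)"
      by (rule nrm_op_le_suminf[OF T d ts]) (simp add: t_def coord_diff f g)
    then show ?thesis by (simp add: op_diff[OF T f g(1)])
  qed
  have tlim: "(\<lambda>n. t n k) \<longlonglongrightarrow> 0" for k
  proof -
    have "(\<lambda>n. t n k) \<longlonglongrightarrow> cmod (y k - y k) * nrm (T (basis k))"
      unfolding t_def by (intro tendsto_intros lim)
    then show ?thesis by simp
  qed
  have tb: "\<forall>\<^sub>F (k, n) in at_top \<times>\<^sub>F sequentially. norm (t n k) \<le> 2 * B * nrm (T (basis k))"
    using tle t0 by (intro always_eventually) auto
  have "(\<lambda>n. suminf (t n)) \<longlonglongrightarrow> (\<Sum>k. 0)"
    using tannerys_theorem[OF tlim tb summable_mult[OF sm]] by simp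
  then have "(\<lambda>n. suminf (t n)) \<longlonglongrightarrow> 0" by simp
  then have "(\<lambda>n. nrm (T (f (r n)) - T g)) \<longlonglongrightarrow> 0"
    by (rule Lim_null_comparison[rotated]) (use bound in \<open>auto intro: always_eventually\<close>)
  then show "\<exists>r::nat \<Rightarrow> nat. \<exists>g\<in>D. strict_mono r \<and> (\<lambda>n. nrm (T (f (r n)) - g)) \<longlonglongrightarrow> 0"
    using r op_D[OF T g(1)] by blast
qed

lemma eigenspace_D: "f \<in> eigenspace \<alpha> S c \<Longrightarrow> f \<in> D"
  by (simp add: eigenspace_def)

lemma eigenspace_sum_scale:
  assumes S: "bounded_operator \<alpha> S" and "\<And>b. b \<in> I \<Longrightarrow> f b \<in> eigenspace \<alpha> S c"
  shows "(\<Sum>b\<in>I. fscale (u b) (f b)) \<in> eigenspace \<alpha> S c"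
proof -
  have D: "fscale (u b) (f b) \<in> D" if "b \<in> I" for b using assms(2)[OF that] by (simp add: D_scale eigenspace_def)
  have "S (\<Sum>b\<in>I. fscale (u b) (f b)) = (\<Sum>b\<in>I. S (fscale (u b) (f b)))" by (rule op_sum[OF S D])
  also have "\<dots> = (\<Sum>b\<in>I. fscale c (fscale (u b) (f b)))"
    by (intro sum.cong refl) (use assms(2) in \<open>simp add: eigenspace_def op_scale[OF S] mult.left_commute\<close>)
  also have "\<dots> = fscale c (\<Sum>b\<in>I. fscale (u b) (f b))" by (simp only: cfun.scale_sum_right)
  finally show ?thesis using D_sum[of I, OF D] by (simp add: eigenspace_def)
qed

lemma eigenspace_orthogonal:
  assumes T: "bounded_operator \<alpha> T" and "\<sigma> > 0" "\<tau> > 0" "\<sigma> \<noteq> \<tau>"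
    and f: "f \<in> eigenspace \<alpha> (hilbert_adjoint \<alpha> T \<circ> T) (of_real (\<sigma>\<^sup>2))"
    and g: "g \<in> eigenspace \<alpha> (hilbert_adjoint \<alpha> T \<circ> T) (of_real (\<tau>\<^sup>2))"
  shows "ip f g = 0"
proof -
  have D: "f \<in> D" "g \<in> D" using f g eigenspace_D by auto
  have "ip (T f) (T g) = ip f (fscale (of_real (\<tau>\<^sup>2)) g)"
    using adjoint_ip[OF T D(1) op_D[OF T D(2)]] g by (simp add: eigenspace_def)
  then have 1: "ip (T f) (T g) = of_real (\<tau>\<^sup>2) * ip f g" using D by (simp add: ip_scale_right)
  have "ip (T g) (T f) = ip g (fscale (of_real (\<sigma>\<^sup>2)) f)"
    using adjoint_ip[OF T D(2) op_D[OF T D(1)]] f by (simp add: eigenspace_def)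
  then have "ip (T g) (T f) = of_real (\<sigma>\<^sup>2) * ip g f" using D by (simp add: ip_scale_right)
  then have "ip (T f) (T g) = of_real (\<sigma>\<^sup>2) * ip f g"
    using ip_cnj[OF op_D[OF T D(2)] op_D[OF T D(1)]] ip_cnj[OF D(2,1)] by simp
  with 1 have "(of_real (\<sigma>\<^sup>2) - of_real (\<tau>\<^sup>2)) * ip f g = 0" by (simp add: left_diff_distrib)
  moreover have "complex_of_real (\<sigma>\<^sup>2) \<noteq> of_real (\<tau>\<^sup>2)"
    using assms(2-4) by (simp only: of_real_eq_iff) (simp add: power2_eq_iff_nonneg)
  ultimately show ?thesis by simp
qed

text \<open>
  If the eigenspaces together contained more than \<open>N\<close> independent vectors, then some nontrivial
  combination \<open>f\<close> of them would have its first \<open>N\<close> coordinates equal to 0. By orthogonality of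
  the eigenspaces \<open>T\<close> expands \<open>f\<close> by more than \<open>\<delta>\<close>, against the assumption.
\<close>

lemma eigenspace_dim_sum_le:
  assumes T: "bounded_operator \<alpha> T" and \<delta>: "\<delta> \<ge> 0"
    and small: "\<And>f. f \<in> D \<Longrightarrow> (\<And>n. n < N \<Longrightarrow> coord f n = 0) \<Longrightarrow> nrm (T f) \<le> \<delta> * nrm f"
    and F: "finite F" "\<And>\<sigma>. \<sigma> \<in> F \<Longrightarrow> \<sigma> > \<delta>"
  shows "(\<Sum>\<sigma>\<in>F. complex_dim (eigenspace \<alpha> (hilbert_adjoint \<alpha> T \<circ> T) (of_real (\<sigma>\<^sup>2)))) \<le> N"
proof -
  define S where "S = hilbert_adjoint \<alpha> T \<circ> T"
  have S: "bounded_operator \<alpha> S"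
    unfolding S_def by (intro bounded_operator_compose adjoint_bounded T)
  define E where "E \<sigma> = eigenspace \<alpha> S (of_real (\<sigma>\<^sup>2))" for \<sigma> :: real
  have "\<exists>C. finite C \<and> C \<subseteq> E \<sigma> \<and> cfun.independent C \<and> card C = cfun.dim (E \<sigma>)" for \<sigma>
  proof -
    obtain C where C: "C \<subseteq> E \<sigma>" "cfun.independent C" "card C = cfun.dim (E \<sigma>)"
      by (rule cfun.basis_exists[of "E \<sigma>"])
    show ?thesis
    \<comment> \<open>\<open>dim\<close> is 0 for infinite-dimensional spaces, and then the empty set serves as well\<close>
    proof (cases "finite C")
      case False
      then have "cfun.dim (E \<sigma>) = 0" using C(3) by simp
      then show ?thesis by (intro exI[of _ "{}"]) (auto simp: cfun.independent_empty)
    qed (use C in blast)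
  qed
  then obtain C where C: "\<And>\<sigma>. finite (C \<sigma>)" "\<And>\<sigma>. C \<sigma> \<subseteq> E \<sigma>" "\<And>\<sigma>. cfun.independent (C \<sigma>)"
    "\<And>\<sigma>. card (C \<sigma>) = cfun.dim (E \<sigma>)" by metis
  have ED: "E \<sigma> \<subseteq> D" for \<sigma> using eigenspace_D by (auto simp: E_def)
  have orth: "ip f g = 0" if "f \<in> E \<sigma>" "g \<in> E \<tau>" "\<sigma> \<in> F" "\<tau> \<in> F" "\<sigma> \<noteq> \<tau>" for f g \<sigma> \<tau>
    using eigenspace_orthogonal[OF T _ _ \<open>\<sigma> \<noteq> \<tau>\<close>, of f g] that F(2)[OF that(3)] F(2)[OF that(4)] \<delta>
    by (simp add: E_def S_def)
  define I where "I = (SIGMA \<sigma>:F. C \<sigma>)"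
  have I: "finite I" "card I = (\<Sum>\<sigma>\<in>F. cfun.dim (E \<sigma>))"
    unfolding I_def using F(1) C(1) by (auto simp: C(4))
  show ?thesis
  proof (rule ccontr)
    assume "\<not> ?thesis"
    then have "card I > N" by (simp add: I E_def S_def)
    then obtain u where u: "\<exists>i\<in>I. u i \<noteq> 0" "\<forall>n<N. (\<Sum>i\<in>I. u i * coord (snd i) n) = 0"
      using underdetermined_system_solution[OF I(1), of N "\<lambda>i. coord (snd i)"] by blast
    define v where "v \<sigma> = (\<Sum>b\<in>C \<sigma>. fscale (u (\<sigma>, b)) b)" for \<sigma>
    have vE: "v \<sigma> \<in> E \<sigma>" for \<sigma>
      unfolding v_def E_def by (rule eigenspace_sum_scale[OF S]) (use C(2)[of \<sigma>] in \<open>auto simp: E_def\<close>)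
    have vD: "v \<sigma> \<in> D" for \<sigma> using vE ED by blast
    define f where "f = (\<Sum>\<sigma>\<in>F. v \<sigma>)"
    have fD: "f \<in> D" unfolding f_def by (intro D_sum vD)
    have "coord f n = (\<Sum>i\<in>I. u i * coord (snd i) n)" for n
    proof -
      have "coord (v \<sigma>) n = (\<Sum>b\<in>C \<sigma>. u (\<sigma>, b) * coord b n)" for \<sigma>
        unfolding v_def using C(2)[of \<sigma>] ED[of \<sigma>]
        by (subst coord_sum) (auto simp: D_scale coord_scale D_holomorphic subset_iff intro!: sum.cong)
      then have "coord f n = (\<Sum>\<sigma>\<in>F. \<Sum>b\<in>C \<sigma>. u (\<sigma>, b) * coord b n)"
        unfolding f_def by (subst coord_sum) (auto simp: vD)
      also have "\<dots> = (\<Sum>i\<in>I. u i * coord (snd i) n)"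
        unfolding I_def using F(1) C(1) by (subst sum.Sigma) (auto simp: case_prod_beta)
      finally show ?thesis .
    qed
    then have le: "nrm (T f) \<le> \<delta> * nrm f" using u(2) by (intro small fD) auto
    have ipv: "ip (\<Sum>\<sigma>\<in>F. v \<sigma>) (fscale c (v \<tau>)) = cnj c * of_real ((nrm (v \<tau>))\<^sup>2)" if "\<tau> \<in> F" for \<tau> c
    proof -
      have "ip (\<Sum>\<sigma>\<in>F. v \<sigma>) (fscale c (v \<tau>)) = (\<Sum>\<sigma>\<in>F. cnj c * ip (v \<sigma>) (v \<tau>))"
        by (subst ip_sum_left) (auto simp: vD D_scale ip_scale_right)
      also have "\<dots> = (\<Sum>\<sigma>\<in>F. if \<sigma> = \<tau> then cnj c * of_real ((nrm (v \<tau>))\<^sup>2) else 0)"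
        using orth[OF vE vE _ that] ip_self[OF vD] by (intro sum.cong refl) auto
      also have "\<dots> = cnj c * of_real ((nrm (v \<tau>))\<^sup>2)" using F(1) that by simp
      finally show ?thesis .
    qed
    have "complex_of_real ((nrm f)\<^sup>2) = (\<Sum>\<sigma>\<in>F. ip f (v \<sigma>))"
      by (subst ip_self[OF fD, symmetric], subst (2) f_def, subst ip_sum_right) (auto simp: vD fD)
    also have "\<dots> = of_real (\<Sum>\<sigma>\<in>F. (nrm (v \<sigma>))\<^sup>2)"
      unfolding of_real_sum by (intro sum.cong refl) (use ipv[of _ 1] in \<open>simp add: f_def\<close>)
    finally have nf: "(nrm f)\<^sup>2 = (\<Sum>\<sigma>\<in>F. (nrm (v \<sigma>))\<^sup>2)" by (simp only: of_real_eq_iff)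
    have Sf: "S f = (\<Sum>\<sigma>\<in>F. fscale (of_real (\<sigma>\<^sup>2)) (v \<sigma>))"
      unfolding f_def by (subst op_sum[OF S vD]) (use vE in \<open>auto simp: E_def eigenspace_def intro!: sum.cong\<close>)
    have "complex_of_real ((nrm (T f))\<^sup>2) = ip f (S f)"
      using adjoint_ip[OF T fD op_D[OF T fD]] by (simp only: ip_self[OF op_D[OF T fD], symmetric] S_def o_apply)
    also have "\<dots> = (\<Sum>\<sigma>\<in>F. ip f (fscale (of_real (\<sigma>\<^sup>2)) (v \<sigma>)))"
      unfolding Sf by (rule ip_sum_right) (auto simp: vD D_scale fD)
    also have "\<dots> = of_real (\<Sum>\<sigma>\<in>F. \<sigma>\<^sup>2 * (nrm (v \<sigma>))\<^sup>2)"
      unfolding of_real_sum by (intro sum.cong refl) (simp add: f_def ipv)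
    finally have nT: "(nrm (T f))\<^sup>2 = (\<Sum>\<sigma>\<in>F. \<sigma>\<^sup>2 * (nrm (v \<sigma>))\<^sup>2)" by (simp only: of_real_eq_iff)
    have "(nrm (T f))\<^sup>2 \<le> (\<delta> * nrm f)\<^sup>2" using le by (intro power_mono) auto
    then have sle: "(\<Sum>\<sigma>\<in>F. (\<sigma>\<^sup>2 - \<delta>\<^sup>2) * (nrm (v \<sigma>))\<^sup>2) \<le> 0"
      by (simp add: nT power_mult_distrib nf left_diff_distrib sum_subtractf sum_distrib_left)
    have pos: "\<sigma>\<^sup>2 - \<delta>\<^sup>2 > 0" if "\<sigma> \<in> F" for \<sigma>
      using F(2)[OF that] \<delta> by (simp add: power_strict_mono)
    have nn: "0 \<le> (\<sigma>\<^sup>2 - \<delta>\<^sup>2) * (nrm (v \<sigma>))\<^sup>2" if "\<sigma> \<in> F" for \<sigma>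
      using pos[OF that] by simp
    have "(\<Sum>\<sigma>\<in>F. (\<sigma>\<^sup>2 - \<delta>\<^sup>2) * (nrm (v \<sigma>))\<^sup>2) = 0"
      by (intro antisym[OF sle] sum_nonneg nn)
    then have "\<forall>\<sigma>\<in>F. (\<sigma>\<^sup>2 - \<delta>\<^sup>2) * (nrm (v \<sigma>))\<^sup>2 = 0"
      using sum_nonneg_eq_0_iff[OF F(1), of "\<lambda>\<sigma>. (\<sigma>\<^sup>2 - \<delta>\<^sup>2) * (nrm (v \<sigma>))\<^sup>2"] nn by blast
    then have "nrm (v \<sigma>) = 0" if "\<sigma> \<in> F" for \<sigma> using pos[OF that] that by force
    then have v0: "v \<sigma> = 0" if "\<sigma> \<in> F" for \<sigma> using nrm_eq_0_iff[OF vD] that by blast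
    obtain \<sigma> b where sb: "\<sigma> \<in> F" "b \<in> C \<sigma>" "u (\<sigma>, b) \<noteq> 0" using u(1) by (auto simp: I_def)
    have "u (\<sigma>, b) = 0"
      by (rule cfun.independentD[OF C(3)[of \<sigma>] C(1) subset_refl _ sb(2), of "\<lambda>b. u (\<sigma>, b)"])
        (use v0[OF sb(1)] in \<open>simp add: v_def\<close>)
    then show False using sb(3) by simp
  qed
qed

text \<open>
  The norm of the operator on the functions whose first \<open>N\<close> coordinates are 0 is at most a tail
  of the geometric series. By the counting lemma this bounds the \<open>N\<close>-th singular value.
\<close>

theorem schatten_class_if_geometric:
  assumes T: "bounded_operator \<alpha> T" and \<rho>: "0 < \<rho>" "\<rho> < 1"
    and decay: "\<And>k. nrm (T (basis k)) \<le> C * \<rho> ^ k" and q: "q > 0"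
  shows "T \<in> schatten_class q \<alpha>"
proof -
  have C0: "C \<ge> 0" using order_trans[OF nrm_nonneg decay[of 0]] by simp
  have geo: "summable (\<lambda>k. C * \<rho> ^ k)" using \<rho> by (intro summable_mult summable_geometric) simp
  have "summable (\<lambda>k. nrm (T (basis k)))"
    by (rule summable_comparison_test'[OF geo]) (use decay in simp)
  then have comp: "compact_operator \<alpha> T" by (rule compact_operator_if_summable[OF T])
  define L where "L = C / (1 - \<rho>)"
  have L0: "L \<ge> 0" using C0 \<rho> by (simp add: L_def)
  have small: "nrm (T f) \<le> (L * \<rho> ^ N) * nrm f" if f: "f \<in> D" and z: "\<And>n. n < N \<Longrightarrow> coord f n = 0" for f N
  proof -
    define t where "t k = (if k < N then 0 else nrm f * (C * \<rho> ^ k))" for k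
    have "(\<lambda>k. nrm f * (C * \<rho> ^ (k + N))) sums (nrm f * (C * \<rho> ^ N * (1 / (1 - \<rho>))))"
    proof (rule sums_mult)
      have "(\<lambda>k. C * \<rho> ^ N * \<rho> ^ k) sums (C * \<rho> ^ N * (1 / (1 - \<rho>)))"
        using \<rho> by (intro sums_mult geometric_sums) simp
      then show "(\<lambda>k. C * \<rho> ^ (k + N)) sums (C * \<rho> ^ N * (1 / (1 - \<rho>)))"
        by (simp add: power_add mult_ac)
    qed
    then have "(\<lambda>k. t (k + N)) sums (nrm f * (C * \<rho> ^ N * (1 / (1 - \<rho>))))" by (simp add: t_def)
    then have "t sums (nrm f * (C * \<rho> ^ N * (1 / (1 - \<rho>))) + (\<Sum>k<N. t k))" by (rule sums_iff_shift[THEN iffD1])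
    then have ts: "t sums ((L * \<rho> ^ N) * nrm f)" by (simp add: t_def L_def mult_ac)
    have "nrm (T f) \<le> suminf t"
    proof (rule nrm_op_le_suminf[OF T f])
      show "summable t" using ts by (rule sums_summable)
      fix k
      show "cmod (coord f k) * nrm (T (basis k)) \<le> t k"
        using z[of k] decay[of k] cmod_coord_le[OF f, of k] by (auto simp: t_def intro!: mult_mono)
    qed
    then show ?thesis using ts by (simp add: sums_iff)
  qed
  define d where "d \<sigma> = complex_dim (eigenspace \<alpha> (hilbert_adjoint \<alpha> T \<circ> T) (of_real (\<sigma>\<^sup>2)))" for \<sigma> :: real
  have count: "sum d F \<le> N" if "finite F" "\<And>\<sigma>. \<sigma> \<in> F \<Longrightarrow> \<sigma> > L * \<rho> ^ N" for F N
    unfolding d_def by (rule eigenspace_dim_sum_le[OF T _ small that]) (use L0 \<rho> in auto)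
  have "\<exists>K. \<forall>F. finite F \<longrightarrow> F \<subseteq> {\<epsilon>..} \<longrightarrow> sum d F \<le> K" if "\<epsilon> > 0" for \<epsilon>
  proof -
    have "(\<lambda>N. L * \<rho> ^ N) \<longlonglongrightarrow> L * 0" using \<rho> by (intro tendsto_intros LIMSEQ_realpow_zero) auto
    then have "\<forall>\<^sub>F N in sequentially. L * \<rho> ^ N < \<epsilon>" using that by (intro order_tendstoD) auto
    then obtain N where "L * \<rho> ^ N < \<epsilon>" by (auto simp: eventually_sequentially)
    then show ?thesis by (intro exI[of _ N]) (auto intro!: count)
  qed
  then obtain s where s: "decseq s" "\<And>n. 0 \<le> s n"
    "\<And>\<sigma>. \<sigma> > 0 \<Longrightarrow> finite {n. s n = \<sigma>} \<and> card {n. s n = \<sigma>} = d \<sigma>"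
    "\<And>n. s n > 0 \<Longrightarrow> \<exists>F. finite F \<and> F \<subseteq> {s n..} \<and> n < sum d F"
    using decreasing_enumeration[of d] by metis
  have sv: "singular_values \<alpha> T s"
    using s unfolding singular_values_def d_def by blast
  have sle: "s n \<le> L * \<rho> ^ n" for n
  proof (rule ccontr)
    assume "\<not> s n \<le> L * \<rho> ^ n"
    then have gt: "s n > L * \<rho> ^ n" by simp
    moreover have "L * \<rho> ^ n \<ge> 0" using L0 \<rho> by simp
    ultimately have "s n > 0" by linarith
    then obtain F where F: "finite F" "F \<subseteq> {s n..}" "n < sum d F" using s(4) by blast
    have "sum d F \<le> n" by (rule count) (use F gt in auto)
    then show False using F(3) by simp
  qed
  have "summable (\<lambda>n. s n powr q)"
  proof (rule summable_comparison_test')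
    show "summable (\<lambda>n. L powr q * (\<rho> powr q) ^ n)"
      using \<rho> q powr_less_mono2[of q \<rho> 1] by (intro summable_mult summable_geometric) simp
    fix n
    have "s n powr q \<le> (L * \<rho> ^ n) powr q" using q s(2) sle by (intro powr_mono2) auto
    also have "\<dots> = L powr q * (\<rho> powr q) ^ n"
      using L0 \<rho> by (simp add: powr_mult powr_power powr_realpow[symmetric] powr_powr mult.commute)
    finally show "norm (s n powr q) \<le> L powr q * (\<rho> powr q) ^ n" by simp
  qed
  then show ?thesis unfolding schatten_class_def using comp sv by blast
qed

section \<open>Images of kernels touching the circle\<close>

lemma ip_basis: "f \<in> D \<Longrightarrow> ip f (basis j) = coord f j"
proof -
  assume f: "f \<in> D"
  have "(\<lambda>n. if n = j then coord f n else 0) sums coord f j" by (rule sums_single)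
  moreover have "(\<lambda>n. if n = j then coord f n else 0) = (\<lambda>n. coord f n * cnj (coord (basis j) n))"
    by (auto simp: coord_basis)
  ultimately show ?thesis using ip_sums[OF f basis_D[of j]] sums_unique2 by metis
qed

lemma deriv_fscale: "f \<in> D \<Longrightarrow> u \<in> disk \<Longrightarrow> deriv (fscale c f) u = c * deriv f u"
  using ip_dkernel[OF D_scale[of f c], of u] ip_dkernel[of f u] ip_scale_left[OF _ dkernel_coord(1), of f u c] by simp

text \<open>
  The chain rule: testing against \<open>dkernel z\<close> differentiates \<open>f \<circ> \<psi>\<close> at \<open>z\<close>.
\<close>

lemma adjoint_composition_dkernel:
  assumes \<psi>: "linear_fractional_self_map \<psi>" and z: "z \<in> disk"
  shows "hilbert_adjoint \<alpha> (composition_operator \<psi>) (dkernel z) = fscale (cnj (deriv \<psi> z)) (dkernel (\<psi> z))"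
proof (rule adjoint_eqI[OF composition_operator_bounded[OF \<psi>] dkernel_coord(1)[OF z]])
  have \<psi>z: "\<psi> z \<in> disk" by (rule linear_fractional_self_map_disk(3)[OF \<psi> z])
  show "fscale (cnj (deriv \<psi> z)) (dkernel (\<psi> z)) \<in> D" by (intro D_scale dkernel_coord \<psi>z)
  fix f assume f: "f \<in> D"
  have "ip (composition_operator \<psi> f) (dkernel z) = deriv f (\<psi> z) * deriv \<psi> z"
    using ip_dkernel[OF op_D[OF composition_operator_bounded[OF \<psi>] f] z] deriv_composition_operator(2)[OF \<psi> f z] by simp
  also have "\<dots> = ip f (fscale (cnj (deriv \<psi> z)) (dkernel (\<psi> z)))"
    using ip_scale_right[OF dkernel_coord(1)[OF \<psi>z] f, of "cnj (deriv \<psi> z)"] ip_dkernel[OF f \<psi>z] by simp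
  finally show "ip (composition_operator \<psi> f) (dkernel z) = ip f (fscale (cnj (deriv \<psi> z)) (dkernel (\<psi> z)))" .
qed

lemma nrm_dkernel_eq: "u \<in> disk \<Longrightarrow> nrm (dkernel u) = (1 - (cmod u)\<^sup>2) powr (- (\<alpha> + 2) / 2)"
proof -
  assume u: "u \<in> disk"
  have "nrm (dkernel u) = sqrt ((nrm (dkernel u))\<^sup>2)" by simp
  also have "\<dots> = sqrt ((1 - (cmod u)\<^sup>2) powr (- (\<alpha> + 2)))" by (simp only: nrm_dkernel[OF u])
  also have "\<dots> = (1 - (cmod u)\<^sup>2) powr (- (\<alpha> + 2) / 2)" by (rule powr_half_sqrt_powr[symmetric]) (use u in \<open>simp add: power_le_one\<close>)
  finally show ?thesis .
qed

text \<open>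
  The norms of the kernels tend to infinity, whereas their individual coordinates stay bounded.
  Hence finite combinations of basis vectors are annihilated in the limit, and these are dense.
\<close>

lemma normalised_dkernel_weakly_null:
  assumes g: "g \<in> D" and w: "\<And>n. w n \<in> disk" and lim: "(\<lambda>n. cmod (w n)) \<longlonglongrightarrow> 1"
  shows "(\<lambda>n. ip g (dkernel (w n)) / of_real (nrm (dkernel (w n)))) \<longlonglongrightarrow> 0"
proof (rule tendstoI)
  fix e :: real assume e: "e > 0"
  have pos: "nrm (dkernel (w n)) > 0" for n
    using w[of n] by (simp add: nrm_dkernel_eq abs_square_less_1 less_imp_neq)
  have "(\<lambda>N. nrm (g - partial (coord g) N)) \<longlonglongrightarrow> 0" by (rule partial_tendsto[OF g])
  then obtain N where N: "nrm (g - partial (coord g) N) < e / 2"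
    using order_tendstoD(2)[of _ 0 sequentially "e / 2"] e by (auto simp: eventually_sequentially)
  define p where "p = partial (coord g) N"
  have pD: "p \<in> D" by (simp add: p_def)
  \<comment> \<open>a bound for the derivative of the partial sum on the whole disk\<close>
  define B where "B = (\<Sum>k<N. cmod (coord g k) * (real k / sqrt (wt k)))"
  have ipp: "cmod (ip p (dkernel (w n))) \<le> B" for n
  proof -
    have K: "dkernel (w n) \<in> D" by (rule dkernel_coord(1)[OF w])
    have "ip p (dkernel (w n)) = (\<Sum>k<N. ip (fscale (coord g k) (basis k)) (dkernel (w n)))"
      unfolding p_def partial_def by (rule ip_sum_left) (auto intro: D_scale K)
    also have "\<dots> = (\<Sum>k<N. coord g k * cnj (coord (dkernel (w n)) k))"
      by (intro sum.cong refl) (simp only: ip_scale_left[OF basis_D K] ip_cnj[OF K basis_D] ip_basis[OF K])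
    finally have "cmod (ip p (dkernel (w n))) \<le> (\<Sum>k<N. cmod (coord g k * cnj (coord (dkernel (w n)) k)))"
      by (simp only: norm_sum)
    also have "\<dots> \<le> B" unfolding B_def
    proof (intro sum_mono)
      fix k
      have "cmod (coord (dkernel (w n)) k) = real k * cmod (w n) ^ (k - 1) / sqrt (wt k)"
        using wt_pos[of k] by (simp add: dkernel_coord(2)[OF w] norm_divide norm_mult norm_power)
      also have "\<dots> \<le> real k * 1 / sqrt (wt k)"
        using w[of n] wt_pos[of k] by (intro divide_right_mono mult_left_mono power_le_one) auto
      finally have "cmod (coord (dkernel (w n)) k) \<le> real k / sqrt (wt k)" by (simp only: mult_1_right)
      then show "cmod (coord g k * cnj (coord (dkernel (w n)) k)) \<le> cmod (coord g k) * (real k / sqrt (wt k))"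
        unfolding norm_mult complex_mod_cnj by (rule mult_left_mono) simp
    qed
    finally show ?thesis .
  qed
  have "(\<lambda>n. B * (1 - (cmod (w n))\<^sup>2) powr ((\<alpha> + 2) / 2)) \<longlonglongrightarrow> B * 0"
  proof (intro tendsto_mult tendsto_const tendsto_zero_powrI)
    have "(\<lambda>n. 1 - (cmod (w n))\<^sup>2) \<longlonglongrightarrow> 1 - 1\<^sup>2" by (intro tendsto_intros lim)
    then show "(\<lambda>n. 1 - (cmod (w n))\<^sup>2) \<longlonglongrightarrow> 0" by simp
    show "\<forall>\<^sub>F n in sequentially. 0 \<le> 1 - (cmod (w n))\<^sup>2"
      using w by (intro always_eventually allI) (simp add: power_le_one less_imp_le)
  qed (use \<alpha> in auto)
  then have "\<forall>\<^sub>F n in sequentially. B * (1 - (cmod (w n))\<^sup>2) powr ((\<alpha> + 2) / 2) < e / 2"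
    using order_tendstoD(2)[of _ 0 sequentially "e / 2"] e by simp
  then show "\<forall>\<^sub>F n in sequentially. dist (ip g (dkernel (w n)) / of_real (nrm (dkernel (w n)))) 0 < e"
  proof eventually_elim
    fix n assume n: "B * (1 - (cmod (w n))\<^sup>2) powr ((\<alpha> + 2) / 2) < e / 2"
    have K: "dkernel (w n) \<in> D" by (rule dkernel_coord(1)[OF w])
    have gp: "g - p \<in> D" by (rule D_diff[OF g pD])
    have inv: "1 / nrm (dkernel (w n)) = (1 - (cmod (w n))\<^sup>2) powr ((\<alpha> + 2) / 2)"
    proof -
      have "1 / inverse x = x" for x :: real by (simp add: divide_inverse)
      then show ?thesis unfolding nrm_dkernel_eq[OF w] minus_divide_left[symmetric] powr_minus .
    qed
    have "ip g (dkernel (w n)) = ip (g - p) (dkernel (w n)) + ip p (dkernel (w n))"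
      by (simp add: ip_diff_left[OF g pD K])
    then have "cmod (ip g (dkernel (w n))) \<le> nrm (g - p) * nrm (dkernel (w n)) + B"
      using norm_triangle_ineq[of "ip (g - p) (dkernel (w n))" "ip p (dkernel (w n))"] cmod_ip_le[OF gp K] ipp[of n] by simp
    then have "cmod (ip g (dkernel (w n))) / nrm (dkernel (w n)) \<le> (nrm (g - p) * nrm (dkernel (w n)) + B) / nrm (dkernel (w n))"
      using pos[of n] by (intro divide_right_mono) auto
    also have "\<dots> = nrm (g - p) + B * (1 / nrm (dkernel (w n)))"
      using pos[of n] by (simp add: add_divide_distrib)
    also have "\<dots> < e" using N n unfolding inv p_def by linarith
    finally show "dist (ip g (dkernel (w n)) / of_real (nrm (dkernel (w n)))) 0 < e"
      by (simp add: norm_divide)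
  qed
qed

lemma deriv_product_dkernel:
  assumes \<phi>: "linear_fractional_self_map \<phi>" and \<psi>: "linear_fractional_self_map \<psi>" and z: "z \<in> disk" and w: "w \<in> disk"
  shows "ip ((composition_operator \<phi> \<circ> hilbert_adjoint \<alpha> (composition_operator \<psi>)) (dkernel z)) (dkernel w)
    = cnj (deriv \<psi> z) * (1 - cnj (\<psi> z) * \<phi> w) powr of_real (- (\<alpha> + 2)) * deriv \<phi> w"
proof -
  let ?g = "hilbert_adjoint \<alpha> (composition_operator \<psi>) (dkernel z)"
  have g: "?g \<in> D" by (rule adjoint_D[OF composition_operator_bounded[OF \<psi>] dkernel_coord(1)[OF z]])
  have \<psi>z: "\<psi> z \<in> disk" by (rule linear_fractional_self_map_disk(3)[OF \<psi> z])
  have \<phi>w: "\<phi> w \<in> disk" by (rule linear_fractional_self_map_disk(3)[OF \<phi> w])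
  have "ip (composition_operator \<phi> ?g) (dkernel w) = deriv ?g (\<phi> w) * deriv \<phi> w"
    using ip_dkernel[OF op_D[OF composition_operator_bounded[OF \<phi>] g] w] deriv_composition_operator(2)[OF \<phi> g w] by simp
  also have "deriv ?g (\<phi> w) = cnj (deriv \<psi> z) * (1 - cnj (\<psi> z) * \<phi> w) powr of_real (- (\<alpha> + 2))"
    unfolding adjoint_composition_dkernel[OF \<psi> z] deriv_fscale[OF dkernel_coord(1)[OF \<psi>z] \<phi>w] deriv_dkernel[OF \<psi>z \<phi>w] ..
  finally show ?thesis by simp
qed

text \<open>
  The two radii towards \<open>\<zeta>\<close> and \<open>\<eta>\<close> are followed at equal speed. By the Lipschitz
  continuity of \<open>\<phi>\<close> and \<open>\<psi>\<close> the matrix entries between normalised kernels stay above a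
  positive constant. Compactness would let the images of a subsequence converge in norm, and
  weak convergence of the kernels to 0 would then force the entries to tend to 0.
\<close>

theorem product_not_compact:
  assumes \<phi>: "linear_fractional_self_map \<phi>" and \<psi>: "linear_fractional_self_map \<psi>"
    and \<zeta>: "\<zeta> \<in> circle" and \<eta>: "\<eta> \<in> circle" and eq: "\<phi> \<zeta> = \<psi> \<eta>" "\<phi> \<zeta> \<in> circle"
  shows "\<not> compact_operator \<alpha> (composition_operator \<phi> \<circ> hilbert_adjoint \<alpha> (composition_operator \<psi>))"
proof
  let ?T = "composition_operator \<phi> \<circ> hilbert_adjoint \<alpha> (composition_operator \<psi>)"
  assume comp: "compact_operator \<alpha> ?T"
  have T: "bounded_operator \<alpha> ?T" using comp by (simp add: compact_operator_def)
  obtain k1 where k1: "k1 > 0" "\<And>z. z \<in> disk \<Longrightarrow> k1 \<le> cmod (deriv \<phi> z)"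
    by (rule linear_fractional_self_map_derivs[OF \<phi>]) (rule that; blast)
  obtain k2 where k2: "k2 > 0" "\<And>z. z \<in> disk \<Longrightarrow> k2 \<le> cmod (deriv \<psi> z)"
    by (rule linear_fractional_self_map_derivs[OF \<psi>]) (rule that; blast)
  obtain R1 L1 where L1: "R1 > 1" "L1 > 0" "\<And>z w. z \<in> ball 0 R1 \<Longrightarrow> w \<in> cball 0 1 \<Longrightarrow> cmod (\<phi> z - \<phi> w) \<le> L1 * cmod (z - w)"
    by (rule linear_fractional_self_map_extension[OF \<phi>]) (rule that; blast)
  obtain R2 L2 where L2: "R2 > 1" "L2 > 0" "\<And>z w. z \<in> ball 0 R2 \<Longrightarrow> w \<in> cball 0 1 \<Longrightarrow> cmod (\<psi> z - \<psi> w) \<le> L2 * cmod (z - w)"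
    by (rule linear_fractional_self_map_extension[OF \<psi>]) (rule that; blast)
  define r where "r n = 1 - 1 / real (n + 2)" for n
  have r: "0 < r n" "r n < 1" for n by (auto simp: r_def field_simps)
  have rlim: "r \<longlonglongrightarrow> 1"
  proof -
    have "(\<lambda>n. 1 - 1 / real (n + 2)) \<longlonglongrightarrow> 1 - 0"
      by (intro tendsto_intros LIMSEQ_ignore_initial_segment[OF lim_1_over_n, of 2])
    then show ?thesis by (simp add: r_def[abs_def])
  qed
  define z where "z n = of_real (r n) * \<eta>" for n
  define w where "w n = of_real (r n) * \<zeta>" for n
  have cz: "cmod (z n) = r n" and cw: "cmod (w n) = r n" for n
    using \<zeta> \<eta> r[of n] by (auto simp: z_def w_def norm_mult)
  have zd: "z n \<in> disk" and wd: "w n \<in> disk" for n using cz[of n] cw[of n] r[of n] by auto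
  define c where "c = k1 * k2 * (L1 + L2) powr (- (\<alpha> + 2))"
  have c: "c > 0" using k1(1) k2(1) L1(2) L2(2) by (simp add: c_def)
  define s where "s = \<alpha> + 2"
  have s: "s > 0" using \<alpha> by (simp add: s_def)
  have lower: "c * (nrm (dkernel (z n)) * nrm (dkernel (w n))) \<le> cmod (ip (?T (dkernel (z n))) (dkernel (w n)))" for n
  proof -
    define x where "x = 1 - cnj (\<psi> (z n)) * \<phi> (w n)"
    have \<psi>1: "cmod (\<psi> (z n)) < 1" and \<phi>1: "cmod (\<phi> (w n)) < 1"
      using linear_fractional_self_map_disk(3)[OF \<psi> zd] linear_fractional_self_map_disk(3)[OF \<phi> wd] by auto
    have "cmod (cnj (\<psi> (z n)) * \<phi> (w n)) < 1"
      using norm_mult_less[of "cnj (\<psi> (z n))" 1 "\<phi> (w n)" 1] \<psi>1 \<phi>1 by simp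
    then have x0: "x \<noteq> 0" by (auto simp: x_def)
    \<comment> \<open>the singularity of the kernel sits at the common boundary point\<close>
    have one: "cnj (\<psi> \<eta>) * \<phi> \<zeta> = 1"
      using eq complex_norm_square[of "\<phi> \<zeta>"] by (simp add: mult.commute)
    have "x = cnj (\<psi> \<eta> - \<psi> (z n)) * \<phi> \<zeta> + cnj (\<psi> (z n)) * (\<phi> \<zeta> - \<phi> (w n))"
      using one by (simp add: x_def algebra_simps)
    then have "cmod x \<le> cmod (\<psi> \<eta> - \<psi> (z n)) * cmod (\<phi> \<zeta>) + cmod (\<psi> (z n)) * cmod (\<phi> \<zeta> - \<phi> (w n))"
      by (metis complex_mod_cnj norm_mult norm_triangle_ineq)
    also have "\<dots> \<le> (L2 * cmod (\<eta> - z n)) * 1 + 1 * (L1 * cmod (\<zeta> - w n))"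
      using \<psi>1 eq(2) L1(1,2) L2(1,2) \<zeta> \<eta> zd[of n] wd[of n]
      by (intro add_mono mult_mono L1(3) L2(3)) auto
    also have "cmod (\<eta> - z n) = 1 - r n"
    proof -
      have "\<eta> - z n = of_real (1 - r n) * \<eta>" by (simp add: z_def algebra_simps)
      then show ?thesis using \<eta> r[of n] by (simp add: norm_mult del: of_real_diff)
    qed
    also have "cmod (\<zeta> - w n) = 1 - r n"
    proof -
      have "\<zeta> - w n = of_real (1 - r n) * \<zeta>" by (simp add: w_def algebra_simps)
      then show ?thesis using \<zeta> r[of n] by (simp add: norm_mult del: of_real_diff)
    qed
    finally have x: "cmod x \<le> (L1 + L2) * (1 - r n)" by (simp add: algebra_simps)
    have "(L1 + L2) powr (- s) * (1 - (r n)\<^sup>2) powr (- s) \<le> cmod x powr (- s)"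
    proof -
      have "(r n)\<^sup>2 \<le> r n" using r[of n] by (simp add: power2_eq_square mult_left_le)
      moreover have "(r n)\<^sup>2 < 1" using r[of n] by (simp add: power_less_one_iff)
      ultimately have "(1 - (r n)\<^sup>2) powr (- s) \<le> (1 - r n) powr (- s)"
        using r[of n] s by (intro order.refl powr_mono2') auto
      then have "(L1 + L2) powr (- s) * (1 - (r n)\<^sup>2) powr (- s) \<le> (L1 + L2) powr (- s) * (1 - r n) powr (- s)"
        by (intro mult_left_mono) auto
      also have "\<dots> = ((L1 + L2) * (1 - r n)) powr (- s)"
        by (rule powr_mult[symmetric])
      also have "\<dots> \<le> cmod x powr (- s)"
        using x x0 s by (intro powr_mono2') auto
      finally show ?thesis .
    qed
    then have "k1 * k2 * ((L1 + L2) powr (- s) * (1 - (r n)\<^sup>2) powr (- s)) \<le> cmod (deriv \<phi> (w n)) * cmod (deriv \<psi> (z n)) * cmod x powr (- s)"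
      using k1 k2 zd wd by (intro mult_mono) auto
    moreover have "nrm (dkernel (z n)) * nrm (dkernel (w n)) = (1 - (r n)\<^sup>2) powr (- s)"
    proof -
      have "nrm (dkernel (z n)) * nrm (dkernel (w n)) = (1 - (r n)\<^sup>2) powr (- s / 2 + - s / 2)"
        unfolding nrm_dkernel_eq[OF zd] nrm_dkernel_eq[OF wd] cz cw s_def[symmetric] by (simp only: powr_add)
      then show ?thesis by simp
    qed
    moreover have "cmod (ip (?T (dkernel (z n))) (dkernel (w n))) = cmod (deriv \<phi> (w n)) * cmod (deriv \<psi> (z n)) * cmod x powr (- s)"
      unfolding deriv_product_dkernel[OF \<phi> \<psi> zd wd] x_def[symmetric] norm_mult s_def[symmetric]
      by (subst norm_powr_real_powr') auto
    ultimately show ?thesis by (simp add: c_def s_def mult.assoc)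
  qed
  have pos: "nrm (dkernel (z n)) > 0" "nrm (dkernel (w n)) > 0" for n
    using r[of n] by (auto simp: nrm_dkernel_eq[OF zd] nrm_dkernel_eq[OF wd] cz cw abs_square_eq_1)
  define f where "f n = fscale (1 / of_real (nrm (dkernel (z n)))) (dkernel (z n))" for n
  have fD: "f n \<in> D" for n unfolding f_def by (intro D_scale dkernel_coord zd)
  have fn: "nrm (f n) \<le> 1" for n
  proof -
    have "nrm (f n) = cmod (1 / of_real (nrm (dkernel (z n)))) * nrm (dkernel (z n))"
      unfolding f_def by (rule nrm_scale[OF dkernel_coord(1)[OF zd]])
    then show ?thesis using pos(1)[of n] by (simp add: norm_divide)
  qed
  have "range f \<subseteq> D" "\<exists>B. \<forall>n. nrm (f n) \<le> B" using fD fn by auto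
  then obtain q g where q: "strict_mono (q :: nat \<Rightarrow> nat)" and g: "g \<in> D" and lim: "(\<lambda>n. nrm (?T (f (q n)) - g)) \<longlonglongrightarrow> 0"
    using comp unfolding compact_operator_def by blast
  have rq: "(\<lambda>n. cmod (w (q n))) \<longlonglongrightarrow> 1"
    unfolding cw using LIMSEQ_subseq_LIMSEQ[OF rlim q] by (simp add: o_def)
  have "(\<lambda>n. ip g (dkernel (w (q n))) / of_real (nrm (dkernel (w (q n))))) \<longlonglongrightarrow> 0"
    by (rule normalised_dkernel_weakly_null[OF g wd rq])
  from tendsto_add[OF lim tendsto_norm_zero[OF this]]
  have lim2: "(\<lambda>n. nrm (?T (f (q n)) - g) + cmod (ip g (dkernel (w (q n))) / of_real (nrm (dkernel (w (q n)))))) \<longlonglongrightarrow> 0"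
    by simp
  have "c \<le> nrm (?T (f (q n)) - g) + cmod (ip g (dkernel (w (q n))) / of_real (nrm (dkernel (w (q n)))))" for n
  proof -
    let ?K = "dkernel (w (q n))" let ?Z = "dkernel (z (q n))"
    have KD: "?K \<in> D" "?Z \<in> D" by (intro dkernel_coord wd zd)+
    have TfD: "?T (f (q n)) \<in> D" "?T (f (q n)) - g \<in> D" using op_D[OF T fD] D_diff g by blast+
    have "?T (f (q n)) = fscale (1 / of_real (nrm ?Z)) (?T ?Z)"
      unfolding f_def by (rule op_scale[OF T KD(2)])
    then have "ip (?T (f (q n))) ?K = (1 / of_real (nrm ?Z)) * ip (?T ?Z) ?K"
      by (simp only: ip_scale_left[OF op_D[OF T KD(2)] KD(1)])
    then have "cmod (ip (?T (f (q n))) ?K) = cmod (ip (?T ?Z) ?K) / nrm ?Z"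
      by (simp add: norm_divide)
    moreover have "c * nrm ?K \<le> cmod (ip (?T ?Z) ?K) / nrm ?Z"
      using lower[of "q n"] pos(1)[of "q n"] by (simp add: le_divide_eq mult_ac)
    ultimately have 1: "c * nrm ?K \<le> cmod (ip (?T (f (q n))) ?K)" by simp
    have "ip (?T (f (q n))) ?K = ip (?T (f (q n)) - g) ?K + ip g ?K"
      using ip_diff_left[OF TfD(1) g KD(1)] by simp
    then have "cmod (ip (?T (f (q n))) ?K) \<le> nrm (?T (f (q n)) - g) * nrm ?K + cmod (ip g ?K)"
      using norm_triangle_ineq[of "ip (?T (f (q n)) - g) ?K" "ip g ?K"] cmod_ip_le[OF TfD(2) KD(1)] by simp
    with 1 have "c * nrm ?K \<le> nrm (?T (f (q n)) - g) * nrm ?K + cmod (ip g ?K)" by linarith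
    then have "c * nrm ?K / nrm ?K \<le> (nrm (?T (f (q n)) - g) * nrm ?K + cmod (ip g ?K)) / nrm ?K"
      using pos(2)[of "q n"] by (intro divide_right_mono) auto
    then show ?thesis using pos(2)[of "q n"] by (simp add: add_divide_distrib norm_divide)
  qed
  then have "c \<le> 0" by (intro LIMSEQ_le_const[OF lim2]) auto
  then show False using c by simp
qed

section \<open>Decay when the boundary images do not meet\<close>

lemma moment_le_1: "moment \<alpha> m \<le> 1"
proof -
  have "ennreal (moment \<alpha> m) \<le> ennreal (moment \<alpha> 0)"
    unfolding nn_integral_cmod_power[OF \<alpha>, symmetric]
    by (intro nn_integral_mono ennreal_leI) (auto simp: power_le_one)
  then show ?thesis using moment_pos[OF \<alpha>, of 0] by (simp add: moment_0[OF \<alpha>])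
qed

text \<open>
  The weighted area is a probability measure.
\<close>

lemma nrm_sq_le:
  assumes f: "f \<in> D" and B: "B \<ge> 0" "\<And>z. z \<in> disk \<Longrightarrow> cmod (deriv f z) \<le> B"
  shows "(nrm f)\<^sup>2 \<le> (cmod (f 0))\<^sup>2 + B\<^sup>2"
proof -
  have em: "emeasure (weighted_area \<alpha>) disk = 1"
    using nn_integral_cmod_power[OF \<alpha>, of 0] by (simp add: moment_0[OF \<alpha>])
  have "integrable (weighted_area \<alpha>) (\<lambda>z. (cmod (deriv f z))\<^sup>2)" using f by (simp add: dirichlet_space_def)
  then have "ennreal (\<integral>z. (cmod (deriv f z))\<^sup>2 \<partial>weighted_area \<alpha>) = bergman_sq \<alpha> (deriv f)"
    by (intro nn_integral_eq_integral[symmetric]) auto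
  also have "\<dots> \<le> (\<integral>\<^sup>+z. ennreal (B\<^sup>2) \<partial>weighted_area \<alpha>)"
    by (intro nn_integral_mono ennreal_leI power_mono) (use B in auto)
  also have "\<dots> = ennreal (B\<^sup>2)" by (simp add: em)
  finally show ?thesis by (simp add: nrm_sq)
qed

text \<open>
  The derivative of \<open>dkernel u \<circ> \<psi>\<close>.
\<close>

definition kernel_pullback :: "(complex \<Rightarrow> complex) \<Rightarrow> complex \<Rightarrow> complex \<Rightarrow> complex" where
  "kernel_pullback \<psi> u z = (1 - cnj u * \<psi> z) powr of_real (- (\<alpha> + 2)) * deriv \<psi> z"

text \<open>
  On the compact set \<open>X \<times> cball 0 1\<close> the product \<open>cnj u * \<psi> z\<close> lies in the closed unit disk
  and differs from 1, so \<open>Re (1 - cnj u * \<psi> z)\<close> has a positive minimum. By Lipschitz continuity it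
  stays positive when \<open>z\<close> runs through a slightly larger disk, uniformly in \<open>u\<close>. There the
  principal power is analytic and bounded, and Cauchy's inequalities apply.
\<close>

lemma kernel_coefficients_decay:
  assumes \<psi>: "linear_fractional_self_map \<psi>" and X: "compact X" "X \<subseteq> cball 0 1"
    and off: "\<And>u z. u \<in> X \<Longrightarrow> z \<in> cball 0 1 \<Longrightarrow> cnj u * \<psi> z \<noteq> 1"
  obtains M R where "M > 0" "R > 1" "\<And>u n. u \<in> X \<Longrightarrow>
    cmod (taylor (kernel_pullback \<psi> u) n) \<le> M / R ^ n"
proof (cases "X = {}")
  case True
  then show ?thesis by (intro that[of 1 2]) auto
next
  case False
  obtain R0 L where R0: "R0 > 1" "L > 0" "\<psi> holomorphic_on ball 0 R0" "\<And>z. z \<in> ball 0 R0 \<Longrightarrow> cmod (deriv \<psi> z) \<le> L"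
    "\<And>z w. z \<in> ball 0 R0 \<Longrightarrow> w \<in> cball 0 1 \<Longrightarrow> cmod (\<psi> z - \<psi> w) \<le> L * cmod (z - w)"
    by (rule linear_fractional_self_map_extension[OF \<psi>]) (rule that; blast)
  have cb: "cball 0 1 \<subseteq> ball (0::complex) R0" using R0(1) by auto
  have cont: "continuous_on (cball 0 1) \<psi>"
    by (rule continuous_on_subset[OF holomorphic_on_imp_continuous_on[OF R0(3)] cb])
  have "continuous_on (X \<times> cball 0 1) (\<lambda>p. Re (1 - cnj (fst p) * \<psi> (snd p)))"
    by (intro continuous_intros continuous_on_compose2[OF cont]) auto
  moreover have "compact (X \<times> cball (0::complex) 1)" by (intro compact_Times X compact_cball)
  moreover have "X \<times> cball (0::complex) 1 \<noteq> {}" using False by auto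
  ultimately obtain p where p: "p \<in> X \<times> cball 0 1"
    "\<And>q. q \<in> X \<times> cball 0 1 \<Longrightarrow> Re (1 - cnj (fst p) * \<psi> (snd p)) \<le> Re (1 - cnj (fst q) * \<psi> (snd q))"
    using continuous_attains_inf[of "X \<times> cball (0::complex) 1" "\<lambda>p. Re (1 - cnj (fst p) * \<psi> (snd p))"] by blast
  define \<delta> where "\<delta> = Re (1 - cnj (fst p) * \<psi> (snd p))"
  have \<delta>: "\<delta> \<le> Re (1 - cnj u * \<psi> z)" if "u \<in> X" "z \<in> cball 0 1" for u z
    using p(2)[of "(u, z)"] that by (simp add: \<delta>_def)
  have \<delta>0: "\<delta> > 0"
  proof -
    define x where "x = cnj (fst p) * \<psi> (snd p)"
    have "cmod x \<le> 1 * 1" unfolding x_def norm_mult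
      using p(1) X(2) linear_fractional_self_map_disk(4)[OF \<psi>, of "snd p"] by (intro mult_mono) (auto simp: mem_Times_iff)
    then have x1: "cmod x \<le> 1" by simp
    have "x \<noteq> 1" unfolding x_def using p(1) by (intro off) (auto simp: mem_Times_iff)
    have "Re x \<noteq> 1"
    proof
      assume re: "Re x = 1"
      have "(cmod x)\<^sup>2 \<le> 1" using x1 by (simp add: power_le_one)
      then have "(Im x)\<^sup>2 \<le> 0" by (simp add: cmod_power2 re)
      then have "Im x = 0" by simp
      then show False using re \<open>x \<noteq> 1\<close> by (simp add: complex_eq_iff)
    qed
    moreover have "Re x \<le> 1" using x1 complex_Re_le_cmod[of x] by linarith
    ultimately show ?thesis by (simp add: \<delta>_def x_def)
  qed
  \<comment> \<open>small enough to stay inside the domain of \<open>\<psi>\<close> and to lose at most half of \<open>\<delta>\<close>\<close>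
  define t where "t = min ((R0 - 1) / 2) (\<delta> / (2 * L))"
  have t: "t > 0" "1 + t < R0" "L * t \<le> \<delta> / 2"
  proof -
    show "t > 0" using R0(1,2) \<delta>0 by (simp add: t_def)
    have "t \<le> (R0 - 1) / 2" unfolding t_def by (rule min.cobounded1)
    then show "1 + t < R0" using R0(1) by simp
    have "L * t \<le> L * (\<delta> / (2 * L))" using R0(2) by (intro mult_left_mono) (auto simp: t_def)
    then show "L * t \<le> \<delta> / 2" using R0(2) by simp
  qed
  have re: "\<delta> / 2 \<le> Re (1 - cnj u * \<psi> z)" if u: "u \<in> X" and z: "z \<in> cball 0 (1 + t)" for u z
  proof -
    have "\<exists>v\<in>cball 0 1. cmod (z - v) \<le> t"
    proof (cases "z \<in> cball 0 1")
      case True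
      then show ?thesis using t(1) by (intro bexI[of _ z]) auto
    next
      case False
      then have z1: "cmod z > 1" by simp
      have z0: "z \<noteq> 0" using z1 by (cases "z = 0") simp_all
      have "of_real (cmod z) * (z / of_real (cmod z)) = z" using z0 by simp
      then have "z - z / of_real (cmod z) = of_real (cmod z - 1) * (z / of_real (cmod z))"
        by (simp only: left_diff_distrib of_real_diff of_real_1 mult_1_left)
      then have "cmod (z - z / of_real (cmod z)) = \<bar>cmod z - 1\<bar> * cmod (z / of_real (cmod z))"
        by (simp only: norm_mult norm_of_real)
      also have "cmod (z / of_real (cmod z)) = 1" using z0 by (simp add: norm_divide)
      also have "\<bar>cmod z - 1\<bar> = cmod z - 1" using z1 by simp
      finally show ?thesis using z z0 by (intro bexI[of _ "z / of_real (cmod z)"]) (auto simp: norm_divide)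
    qed
    then obtain v where v: "v \<in> cball 0 1" "cmod (z - v) \<le> t" by blast
    have "cmod (\<psi> z - \<psi> v) \<le> L * cmod (z - v)" using z t(2) by (intro R0(5) v) auto
    also have "\<dots> \<le> L * t" using v(2) R0(2) by (intro mult_left_mono) auto
    finally have d: "cmod (\<psi> z - \<psi> v) \<le> \<delta> / 2" using t(3) by linarith
    have "cmod (cnj u * (\<psi> z - \<psi> v)) \<le> 1 * (\<delta> / 2)"
      unfolding norm_mult using u X(2) d by (intro mult_mono) auto
    then have "Re (cnj u * (\<psi> z - \<psi> v)) \<le> \<delta> / 2" using complex_Re_le_cmod[of "cnj u * (\<psi> z - \<psi> v)"] by linarith
    moreover have "Re (1 - cnj u * \<psi> z) = Re (1 - cnj u * \<psi> v) - Re (cnj u * (\<psi> z - \<psi> v))"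
      by (simp add: algebra_simps)
    ultimately show ?thesis using \<delta>[OF u v(1)] by linarith
  qed
  define M where "M = (\<delta> / 2) powr (- (\<alpha> + 2)) * L"
  show ?thesis
  proof (rule that[of M "1 + t"])
    show "M > 0" using \<delta>0 R0(2) by (simp add: M_def)
    show "1 + t > 1" using t(1) by simp
    fix u n assume u: "u \<in> X"
    let ?G = "kernel_pullback \<psi> u"
    note G_def = kernel_pullback_def[abs_def]
    have sub: "cball 0 (1 + t) \<subseteq> ball (0::complex) R0" using t(2) by auto
    have dh: "deriv \<psi> holomorphic_on ball 0 R0" by (rule holomorphic_deriv[OF R0(3) open_ball])
    have G: "continuous_on (cball 0 (1 + t)) ?G" "?G holomorphic_on ball 0 (1 + t)"
    proof -
      have posre: "0 < Re (1 - cnj u * \<psi> z)" if "z \<in> cball 0 (1 + t)" for z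
        using re[OF u that] \<delta>0 by linarith
      then have nn: "1 - cnj u * \<psi> z \<notin> \<real>\<^sub>\<le>\<^sub>0" if "z \<in> cball 0 (1 + t)" for z
        using that by (force simp: complex_nonpos_Reals_iff)
      have c1: "continuous_on (cball 0 (1 + t)) \<psi>" "continuous_on (cball 0 (1 + t)) (deriv \<psi>)"
        using R0(3) dh sub by (auto intro: continuous_on_subset holomorphic_on_imp_continuous_on)
      show "continuous_on (cball 0 (1 + t)) ?G"
        unfolding G_def
      proof (intro continuous_intros c1)
        show "cball 0 (1 + t) \<subseteq> {z. 0 \<le> Re (1 - cnj u * \<psi> z) \<or> Im (1 - cnj u * \<psi> z) \<noteq> 0}"
          using posre less_imp_le by blast
        fix z assume "z \<in> cball 0 (1 + t)" "1 - cnj u * \<psi> z = 0"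
        then have "0 < Re 0" using posre by metis
        then show "0 < Re (complex_of_real (- (\<alpha> + 2)))" by simp
      qed
      have h1: "\<psi> holomorphic_on ball 0 (1 + t)" "deriv \<psi> holomorphic_on ball 0 (1 + t)"
        using t(2) by (auto intro!: holomorphic_on_subset[OF R0(3)] holomorphic_on_subset[OF dh])
      show "?G holomorphic_on ball 0 (1 + t)"
        unfolding G_def using nn by (intro holomorphic_intros h1) auto
    qed
    have "cmod (?G z) \<le> M" if "z \<in> cball 0 (1 + t)" for z
    proof -
      have "\<delta> / 2 \<le> cmod (1 - cnj u * \<psi> z)" using re[OF u that] complex_Re_le_cmod[of "1 - cnj u * \<psi> z"] by linarith
      then have "cmod (1 - cnj u * \<psi> z) powr (- (\<alpha> + 2)) \<le> (\<delta> / 2) powr (- (\<alpha> + 2))"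
        using \<delta>0 \<alpha> by (intro powr_mono2') auto
      moreover have "cmod (deriv \<psi> z) \<le> L" using that sub by (intro R0(4)) auto
      ultimately show ?thesis
        unfolding G_def M_def norm_mult by (subst norm_powr_real_powr') (auto intro!: mult_mono)
    qed
    then have "cmod ((deriv ^^ n) ?G 0) \<le> fact n * M / (1 + t) ^ n"
      using t(1) by (intro Cauchy_inequality G) auto
    then show "cmod (taylor ?G n) \<le> M / (1 + t) ^ n"
      by (simp add: taylor_def norm_divide divide_le_eq mult.commute)
  qed
qed

lemma coord_composition_dkernel:
  assumes \<psi>: "linear_fractional_self_map \<psi>" and u: "u \<in> disk"
  shows "coord (composition_operator \<psi> (dkernel u)) (Suc j) = of_real (sqrt (moment \<alpha> j))
    * taylor (kernel_pullback \<psi> u) j"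
proof -
  let ?h = "composition_operator \<psi> (dkernel u)"
  let ?G = "kernel_pullback \<psi> u"
  have dh: "deriv ?h holomorphic_on disk"
    by (intro holomorphic_deriv deriv_composition_operator \<psi> dkernel_coord u open_ball)
  have e: "deriv ?h z = ?G z" if z: "z \<in> disk" for z
    using deriv_composition_operator(2)[OF \<psi> dkernel_coord(1)[OF u] z]
      deriv_dkernel[OF u linear_fractional_self_map_disk(3)[OF \<psi> z]] by (simp add: kernel_pullback_def)
  have "taylor ?G j = taylor (deriv ?h) j"
    by (rule taylor_unique) (metis e taylor_sums[OF dh])
  also have "\<dots> = of_nat (Suc j) * taylor ?h (Suc j)" by (rule taylor_deriv)
  finally have t: "taylor ?G j = of_nat (Suc j) * taylor ?h (Suc j)" .
  have "sqrt (wt (Suc j)) = real (Suc j) * sqrt (moment \<alpha> j)"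
    by (simp add: wt_def real_sqrt_mult del: of_nat_Suc)
  then show ?thesis unfolding t coord_def by (simp del: of_nat_Suc)
qed

text \<open>
  The derivative of \<open>C\<^sub>\<psi>\<^sup>* (basis j)\<close> at \<open>u\<close> is the conjugate of the \<open>j\<close>-th coordinate of
  \<open>C\<^sub>\<psi> (dkernel u)\<close>, hence a Taylor coefficient of a pulled back kernel. This is estimated
  uniformly for \<open>u\<close> in the image of \<open>\<phi>\<close>. The set \<open>X\<close> also contains a disk around the origin
  through \<open>\<phi> 0\<close>, so that integrating the derivative from 0 controls the value at \<open>\<phi> 0\<close>.
\<close>

theorem product_basis_decay:
  assumes \<phi>: "linear_fractional_self_map \<phi>" and \<psi>: "linear_fractional_self_map \<psi>"
    and disj: "\<phi> ` circle \<inter> \<psi> ` circle \<inter> circle = {}"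
  obtains C \<rho> where "0 < \<rho>" "\<rho> < 1"
    "\<And>j. nrm ((composition_operator \<phi> \<circ> hilbert_adjoint \<alpha> (composition_operator \<psi>)) (basis j)) \<le> C * \<rho> ^ j"
proof -
  let ?A = "hilbert_adjoint \<alpha> (composition_operator \<psi>)"
  let ?T = "composition_operator \<phi> \<circ> ?A"
  note C\<psi> = composition_operator_bounded[OF \<psi>] and C\<phi> = composition_operator_bounded[OF \<phi>]
  note \<phi>d = linear_fractional_self_map_disk[OF \<phi>] and \<psi>d = linear_fractional_self_map_disk[OF \<psi>]
  have \<phi>0: "cmod (\<phi> 0) < 1" using \<phi>d(3)[of 0] by simp
  obtain K where K: "K > 0" "\<And>z. z \<in> disk \<Longrightarrow> cmod (deriv \<phi> z) \<le> K"
    by (rule linear_fractional_self_map_derivs[OF \<phi>]) (rule that; blast)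
  define X where "X = \<phi> ` cball 0 1 \<union> cball 0 (cmod (\<phi> 0))"
  obtain R0 where R0: "R0 > 1" "\<phi> holomorphic_on ball 0 R0" by (rule linear_fractional_self_map_extension[OF \<phi>]) (rule that; blast)
  have "continuous_on (cball 0 1) \<phi>"
    by (rule continuous_on_subset[OF holomorphic_on_imp_continuous_on[OF R0(2)]]) (use R0(1) in auto)
  then have X1: "compact X" unfolding X_def by (intro compact_Un compact_continuous_image compact_cball)
  have X2: "X \<subseteq> cball 0 1" using \<phi>d(4) \<phi>0 by (auto simp: X_def)
  have off: "cnj u * \<psi> z \<noteq> 1" if u: "u \<in> X" and z: "z \<in> cball 0 1" for u z
  proof
    assume one: "cnj u * \<psi> z = 1"
    then have n1: "cmod u * cmod (\<psi> z) = 1" by (metis complex_mod_cnj norm_mult norm_one)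
    have le: "cmod u \<le> 1" "cmod (\<psi> z) \<le> 1" using u X2 \<psi>d(4)[OF z] by auto
    have u1: "cmod u = 1"
    proof -
      have "cmod u * cmod (\<psi> z) \<le> cmod u * 1" using le by (intro mult_left_mono) auto
      then show ?thesis using n1 le by simp
    qed
    then have \<psi>1: "cmod (\<psi> z) = 1" using n1 by simp
    have "u = u * (cnj u * \<psi> z)" using one by simp
    also have "\<dots> = (u * cnj u) * \<psi> z" by simp
    also have "u * cnj u = 1" using u1 complex_norm_square[of u] by simp
    finally have u\<psi>: "u = \<psi> z" by simp
    have zc: "z \<in> circle" using z \<psi>1 \<psi>d(3)[of z] by force
    obtain w where w: "w \<in> cball 0 1" "u = \<phi> w" using u u1 \<phi>0 by (auto simp: X_def)
    have wc: "w \<in> circle" using w u1 \<phi>d(3)[of w] by force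
    have "u \<in> \<phi> ` circle" unfolding w(2) by (rule imageI[OF wc])
    moreover have "u \<in> \<psi> ` circle" unfolding u\<psi> by (rule imageI[OF zc])
    moreover have "u \<in> circle" using u1 by simp
    ultimately show False using disj by blast
  qed
  obtain M R where M: "M > 0" and R: "R > 1" and decay: "\<And>u n. u \<in> X \<Longrightarrow>
    cmod (taylor (kernel_pullback \<psi> u) n) \<le> M / R ^ n"
    by (rule kernel_coefficients_decay[OF \<psi> X1 X2 off]; (rule that)?; blast)
  have AD: "?A (basis j) \<in> D" for j by (rule adjoint_D[OF C\<psi> basis_D])
  have dA: "cmod (deriv (?A (basis (Suc j))) u) \<le> M / R ^ j" if u: "u \<in> X" "u \<in> disk" for u j
  proof -
    have K: "dkernel u \<in> D" by (rule dkernel_coord(1)[OF u(2)])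
    have "deriv (?A (basis (Suc j))) u = ip (?A (basis (Suc j))) (dkernel u)" by (rule ip_dkernel[OF AD u(2), symmetric])
    also have "\<dots> = cnj (ip (dkernel u) (?A (basis (Suc j))))" by (rule ip_cnj[OF K AD])
    also have "ip (dkernel u) (?A (basis (Suc j))) = ip (composition_operator \<psi> (dkernel u)) (basis (Suc j))"
      by (rule adjoint_ip[OF C\<psi> K basis_D, symmetric])
    also have "\<dots> = coord (composition_operator \<psi> (dkernel u)) (Suc j)" by (rule ip_basis[OF op_D[OF C\<psi> K]])
    finally have "cmod (deriv (?A (basis (Suc j))) u) = sqrt (moment \<alpha> j)
        * cmod (taylor (kernel_pullback \<psi> u) j)"
      using moment_pos[OF \<alpha>, of j] by (simp add: coord_composition_dkernel[OF \<psi> u(2)] norm_mult)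
    also have "\<dots> \<le> 1 * (M / R ^ j)"
      using moment_le_1 moment_pos[OF \<alpha>, of j] decay[OF u(1)] by (intro mult_mono) auto
    finally show ?thesis by simp
  qed
  have A0: "?A (basis (Suc j)) 0 = 0" for j
  proof -
    \<comment> \<open>the constant function is fixed, so the images of the other basis vectors vanish at 0\<close>
    have b0: "composition_operator \<psi> (basis 0) = basis 0"
      using \<psi>d(3) by (auto simp: composition_operator_def basis_def fun_eq_iff)
    have "?A (basis (Suc j)) 0 = ip (?A (basis (Suc j))) (basis 0)" using ip_basis[OF AD, of "Suc j" 0] by simp
    also have "\<dots> = cnj (ip (basis 0) (?A (basis (Suc j))))" by (rule ip_cnj[OF basis_D AD])
    also have "ip (basis 0) (?A (basis (Suc j))) = ip (composition_operator \<psi> (basis 0)) (basis (Suc j))"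
      by (rule adjoint_ip[OF C\<psi> basis_D basis_D, symmetric])
    also have "\<dots> = 0" by (simp add: b0 ip_basis coord_basis)
    finally show ?thesis by simp
  qed
  have A\<phi>: "cmod (?A (basis (Suc j)) (\<phi> 0)) \<le> M / R ^ j" for j
  proof -
    have sub: "cball 0 (cmod (\<phi> 0)) \<subseteq> disk" using \<phi>0 by auto
    have "cmod (?A (basis (Suc j)) (\<phi> 0) - ?A (basis (Suc j)) 0) \<le> M / R ^ j * cmod (\<phi> 0 - 0)"
    proof (rule field_differentiable_bound[of "cball 0 (cmod (\<phi> 0))" _ "deriv (?A (basis (Suc j)))"])
      fix v :: complex assume v: "v \<in> cball 0 (cmod (\<phi> 0))"
      then have v': "v \<in> disk" "v \<in> X" using sub by (auto simp: X_def)
      show "(?A (basis (Suc j)) has_field_derivative deriv (?A (basis (Suc j))) v) (at v within cball 0 (cmod (\<phi> 0)))"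
        by (rule has_field_derivative_at_within[OF holomorphic_derivI[OF D_holomorphic[OF AD] open_ball v'(1)]])
      show "cmod (deriv (?A (basis (Suc j))) v) \<le> M / R ^ j" by (rule dA[OF v'(2,1)])
    qed (simp_all add: convex_cball)
    also have "\<dots> \<le> M / R ^ j * 1"
    proof (intro mult_left_mono)
      show "cmod (\<phi> 0 - 0) \<le> 1" using \<phi>0 by simp
      show "0 \<le> M / R ^ j" using M R by simp
    qed
    finally show ?thesis by (simp only: A0 diff_zero mult_1_right)
  qed
  define B where "B = sqrt (1 + K\<^sup>2) * M * R"
  have B: "B \<ge> 0" using M R by (simp add: B_def)
  have TS: "nrm (?T (basis (Suc j))) \<le> B * (1 / R) ^ Suc j" for j
  proof -
    have TD: "?T (basis (Suc j)) \<in> D" using op_D[OF C\<phi> AD] by simp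
    have MR: "M / R ^ j \<ge> 0" using M R by simp
    have dT: "cmod (deriv (?T (basis (Suc j))) z) \<le> M / R ^ j * K" if z: "z \<in> disk" for z
    proof -
      have "\<phi> z \<in> X" "\<phi> z \<in> disk" using z \<phi>d(3)[OF z] by (auto simp: X_def)
      then have "cmod (deriv (?A (basis (Suc j))) (\<phi> z)) * cmod (deriv \<phi> z) \<le> M / R ^ j * K"
        using K(2)[OF z] MR by (intro mult_mono dA norm_ge_zero)
      then show ?thesis using deriv_composition_operator(2)[OF \<phi> AD z] by (simp add: norm_mult)
    qed
    have T0: "?T (basis (Suc j)) 0 = ?A (basis (Suc j)) (\<phi> 0)" by (simp add: composition_operator_def)
    have "(nrm (?T (basis (Suc j))))\<^sup>2 \<le> (cmod (?T (basis (Suc j)) 0))\<^sup>2 + (M / R ^ j * K)\<^sup>2"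
      by (rule nrm_sq_le[OF TD mult_nonneg_nonneg[OF MR less_imp_le[OF K(1)]] dT])
    also have "(cmod (?T (basis (Suc j)) 0))\<^sup>2 \<le> (M / R ^ j)\<^sup>2"
      unfolding T0 by (intro power_mono A\<phi>) simp
    also have "(M / R ^ j)\<^sup>2 + (M / R ^ j * K)\<^sup>2 = (1 + K\<^sup>2) * (M / R ^ j)\<^sup>2"
    proof -
      have "x\<^sup>2 + (x * K)\<^sup>2 = (1 + K\<^sup>2) * x\<^sup>2" for x by (simp add: power_mult_distrib distrib_right)
      then show ?thesis .
    qed
    finally have "(nrm (?T (basis (Suc j))))\<^sup>2 \<le> (1 + K\<^sup>2) * (M / R ^ j)\<^sup>2" by (simp only: add_right_mono)
    then have "sqrt ((nrm (?T (basis (Suc j))))\<^sup>2) \<le> sqrt ((1 + K\<^sup>2) * (M / R ^ j)\<^sup>2)" by (rule real_sqrt_le_mono)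
    then have "nrm (?T (basis (Suc j))) \<le> sqrt (1 + K\<^sup>2) * (M / R ^ j)"
      using MR by (simp only: real_sqrt_mult real_sqrt_abs abs_of_nonneg nrm_nonneg)
    also have "\<dots> = B * (1 / R) ^ Suc j" using R by (simp add: B_def power_divide)
    finally show ?thesis .
  qed
  show ?thesis
  proof (rule that[of "1 / R" "B + nrm (?T (basis 0))"])
    fix j
    show "nrm (?T (basis j)) \<le> (B + nrm (?T (basis 0))) * (1 / R) ^ j"
    proof (cases j)
      case 0
      then show ?thesis using B by simp
    next
      case (Suc i)
      have "nrm (?T (basis j)) \<le> B * (1 / R) ^ j" unfolding Suc by (rule TS)
      also have "\<dots> \<le> (B + nrm (?T (basis 0))) * (1 / R) ^ j" using R by (intro mult_right_mono) auto
      finally show ?thesis .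
    qed
  qed (use R in auto)
qed

end

section \<open>Schatten classes and boundary contact\<close>

theorem theorem3p4:
  fixes \<alpha> p :: real and \<phi> \<psi> :: "complex \<Rightarrow> complex"
  assumes "\<alpha> > -1" and "p > 0"
    and "linear_fractional_self_map \<phi>" and "linear_fractional_self_map \<psi>"
  shows "(composition_operator \<phi> \<circ> hilbert_adjoint \<alpha> (composition_operator \<psi>)
            \<in> schatten_class p \<alpha>
          \<longleftrightarrow> \<phi> ` circle \<inter> \<psi> ` circle \<inter> circle = {})
       \<and> (\<phi> ` circle \<inter> \<psi> ` circle \<inter> circle = {} \<longrightarrow>
           (\<forall>q>0. composition_operator \<phi> \<circ> hilbert_adjoint \<alpha> (composition_operator \<psi>)
              \<in> schatten_class q \<alpha>))"
proof -
  interpret weighted_dirichlet \<alpha> by unfold_locales (rule assms(1))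
  let ?T = "composition_operator \<phi> \<circ> hilbert_adjoint \<alpha> (composition_operator \<psi>)"
  have suff: "?T \<in> schatten_class q \<alpha>" if disj: "\<phi> ` circle \<inter> \<psi> ` circle \<inter> circle = {}" and q: "q > 0" for q
  proof -
    obtain C \<rho> where "0 < \<rho>" "\<rho> < 1" "\<And>j. nrm (?T (basis j)) \<le> C * \<rho> ^ j"
      by (rule product_basis_decay[OF assms(3,4) disj]) (rule that; blast)
    then show ?thesis
      using bounded_operator_compose[OF composition_operator_bounded[OF assms(3)]
          adjoint_bounded[OF composition_operator_bounded[OF assms(4)]]] q
      by (intro schatten_class_if_geometric) auto
  qed
  have nec: "\<phi> ` circle \<inter> \<psi> ` circle \<inter> circle = {}" if S: "?T \<in> schatten_class p \<alpha>"
  proof (rule ccontr)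
    assume "\<phi> ` circle \<inter> \<psi> ` circle \<inter> circle \<noteq> {}"
    then obtain \<zeta> \<eta> where "\<zeta> \<in> circle" "\<eta> \<in> circle" "\<phi> \<zeta> = \<psi> \<eta>" "\<phi> \<zeta> \<in> circle" by blast
    then have "\<not> compact_operator \<alpha> ?T" by (rule product_not_compact[OF assms(3,4)])
    then show False using S by (simp add: schatten_class_def)
  qed
  show ?thesis using suff nec assms(2) by blast
qed

end
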